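(* Let $q\in L_1(0,\pi)$ be real-valued and $f,F\in\mathscr R$. The spectral data $\{\lambda_n,\gamma_n\}_{n\ge0}$ of the problem $\mathscr P(q,f,F)$ have the asymptotics $$\sqrt{\lambda_n}=n-\frac{\operatorname{ind} f+\operatorname{ind} F}{2}+\frac{1}{\pi n}\left(\frac12\int_0^\pi q(x)\,dx+\omega_1+\Omega_1\right)+\frac{\xi_n}{n},$$ $$\gamma_n=\frac{\pi}{2}\left(n-\frac{\operatorname{ind} f+\operatorname{ind} F}{2}\right)^{2\operatorname{ind} f}\left(1+\frac{\xi_n'}{n}\right),$$ where $\xi_n,\xi_n'=o(1)$ as $n\to\infty$ if $q\in L_1(0,\pi)$, and $\{\xi_n\},\{\xi_n'\}\in\ell_2$ if $q\in L_2(0,\pi)$.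
   Context: $\mathscr R$ is the set consisting of the symbol $\infty$ together with all rational functions $f(\lambda)=h_0\lambda+h+\sum_{k=1}^d\frac{\delta_k}{h_k-\lambda}$ ($d\ge 0$) with real coefficients, $h_0\ge 0$, $\delta_k>0$, $h_1<\dots<h_d$. The index is $\operatorname{ind} f=2d+1$ if $h_0>0$, $\operatorname{ind} f=2d$ if $h_0=0$, and $\operatorname{ind}\infty=-1$. For $f\neq\infty$ put $f_\downarrow(\lambda)=h_0'\prod_{k=1}^d(h_k-\lambda)$ with $h_0'=1/h_0$ if $h_0>0$ and $h_0'=1$ if $h_0=0$, and $f_\uparrow=f\cdot f_\downarrow$ (a polynomial); for $f=\infty$ put $f_\uparrow=-1$, $f_\downarrow=0$. To $f\in\mathscr R$ assign the monic polynomial $\boldsymbol\omega_f(\lambda)=(-1)^{\lfloor\operatorname{ind} f/2\rfloor}\lambda f_\downarrow(\lambda^2)-(-1)^{\lceil\operatorname{ind} f/2\rceil}f_\uparrow(\lambda^2)=\lambda^{\operatorname{ind} f+1}+\omega_1\lambda^{\operatorname{ind} f}+\dots$; $\omega_1$ is its second coefficient ($\omega_1=0$ if $f=\infty$). $\Omega_1$ is defined in the same way from $F$. $\mathscr P(q,f,F)$ is the boundary value problem $-y''+q(x)y=\lambda y$ on $(0,\pi)$, $\frac{y'(0)}{y(0)}=-f(\lambda)$, $\frac{y'(\pi)}{y(\pi)}=F(\lambda)$, i.e. $f_\downarrow(\lambda)y'(0)+f_\uparrow(\lambda)y(0)=0$ and $F_\downarrow(\lambda)y'(\pi)-F_\uparrow(\lambda)y(\pi)=0$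 (so $\infty$ means a Dirichlet condition). $\varphi(x,\lambda)$, $\psi(x,\lambda)$ are the solutions of the equation with $\varphi(0,\lambda)=f_\downarrow(\lambda)$, $\varphi'(0,\lambda)=-f_\uparrow(\lambda)$, $\psi(\pi,\lambda)=F_\downarrow(\lambda)$, $\psi'(\pi,\lambda)=F_\uparrow(\lambda)$. The eigenvalues are real and simple, numbered $\lambda_0<\lambda_1<\dots$, and for each there is a unique $\beta_n\ne0$ with $\psi(x,\lambda_n)=\beta_n\varphi(x,\lambda_n)$. The norming constants are $\gamma_n=\int_0^\pi\varphi^2(x,\lambda_n)\,dx+f'(\lambda_n)f_\downarrow^2(\lambda_n)+\frac{1}{\beta_n^2}F'(\lambda_n)F_\downarrow^2(\lambda_n)$, where $f'f_\downarrow^2$ means the polynomial $f_\uparrow'f_\downarrow-f_\uparrow f_\downarrow'$ (so it is $0$ if $f$ is constant or $\infty$), and similarly for $F$. The spectral data of the problem is $\{\lambda_n,\gamma_n\}_{n\ge0}$. Asymptotic formulas concern all sufficiently large $n$ (so that the expressions are defined and $\lambda_n>0$). *)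

theory Defs
  imports "HOL-Analysis.Analysis" "HOL-Computational_Algebra.Polynomial"
begin

text \<open>The class of rational functions, together with the symbol \<open>\<infinity>\<close>.
  \<open>Rat h0 h ps\<close> stands for the function with linear part \<open>h0 \<lambda> + h\<close> and with
  \<open>ps = [(h\<^sub>1, \<delta>\<^sub>1), \<dots>, (h\<^sub>d, \<delta>\<^sub>d)]\<close>; for members of the class
  (predicate \<open>in_R\<close>) the coefficients are determined by the function.\<close>

datatype rfun = Infty | Rat real real "(real \<times> real) list"

fun in_R :: "rfun \<Rightarrow> bool" where
  "in_R Infty \<longleftrightarrow> True"
| "in_R (Rat h0 h ps) \<longleftrightarrow>
     h0 \<ge> 0 \<and> sorted_wrt (<) (map fst ps) \<and> (\<forall>(hk, \<delta>k) \<in> set ps. \<delta>k > 0)"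

fun ind :: "rfun \<Rightarrow> int" where
  "ind Infty = -1"
| "ind (Rat h0 h ps) = (if h0 > 0 then 2 * int (length ps) + 1 else 2 * int (length ps))"

definition lead :: "real \<Rightarrow> real" where
  "lead h0 = (if h0 > 0 then 1 / h0 else 1)"

fun down :: "rfun \<Rightarrow> real poly" where
  "down Infty = 0"
| "down (Rat h0 h ps) = smult (lead h0) (\<Prod>k<length ps. [:fst (ps ! k), -1:])"

text \<open>The product \<open>f f\<^sub>\<down>\<close> with the poles cancelled; see \<open>poly_up\<close> below.\<close>

fun up :: "rfun \<Rightarrow> real poly" where
  "up Infty = -1"
| "up (Rat h0 h ps) = smult (lead h0)
     ([:h, h0:] * (\<Prod>k<length ps. [:fst (ps ! k), -1:])
      + (\<Sum>k<length ps. smult (snd (ps ! k)) (\<Prod>j\<in>{..<length ps} - {k}. [:fst (ps ! j), -1:])))"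

lemma poly_up:
  assumes "l \<notin> fst ` set ps"
  shows "poly (up (Rat h0 h ps)) l =
    (h0 * l + h + (\<Sum>k<length ps. snd (ps ! k) / (fst (ps ! k) - l))) * poly (down (Rat h0 h ps)) l"
proof -
  let ?P = "\<Prod>j<length ps. fst (ps ! j) - l"
  have nz: "fst (ps ! k) - l \<noteq> 0" if "k < length ps" for k
    using assms that by (metis eq_iff_diff_eq_0 image_eqI nth_mem)
  have "snd (ps ! k) * (\<Prod>j\<in>{..<length ps} - {k}. fst (ps ! j) - l)
      = snd (ps ! k) / (fst (ps ! k) - l) * ?P" if "k < length ps" for k
    using that nz[OF that] by (subst prod.remove[of "{..<length ps}" k]) auto
  then show ?thesis
    by (simp add: poly_prod poly_sum algebra_simps sum_distrib_left sum_distrib_right)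
qed

definition omega :: "rfun \<Rightarrow> real poly" where
  "omega f =
     smult ((-1) powi \<lfloor>real_of_int (ind f) / 2\<rfloor>) ([:0, 1:] * pcompose (down f) [:0, 0, 1:])
   - smult ((-1) powi \<lceil>real_of_int (ind f) / 2\<rceil>) (pcompose (up f) [:0, 0, 1:])"

text \<open>\<open>omega f\<close> is monic of degree \<open>ind f + 1\<close>.\<close>

definition omega1 :: "rfun \<Rightarrow> real" where
  "omega1 f = (if f = Infty then 0 else coeff (omega f) (nat (ind f)))"

text \<open>\<open>y\<close> is a solution of \<open>-y'' + q y = l y\<close> on the interval, with derivative \<open>y'\<close>, in the
  sense appropriate for integrable \<open>q\<close>: \<open>y'\<close> is absolutely continuous, i.e. the indefinite
  integral of an integrable function \<open>y2\<close>, and the equation holds almost everywhere.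
  It is used with real as well as with complex spectral parameter.\<close>

definition is_solution ::
  "(real \<Rightarrow> real) \<Rightarrow> 'a::{real_normed_field,euclidean_space} \<Rightarrow> (real \<Rightarrow> 'a) \<Rightarrow> (real \<Rightarrow> 'a) \<Rightarrow> bool"
  where "is_solution q l y y' \<longleftrightarrow>
    (\<forall>x\<in>{0..pi}. (y has_vector_derivative y' x) (at x within {0..pi})) \<and>
    (\<exists>y2. y2 absolutely_integrable_on {0..pi} \<and>
      (\<forall>x\<in>{0..pi}. y' x = y' 0 + integral {0..x} y2) \<and>
      (AE x in lebesgue. x \<in> {0<..<pi} \<longrightarrow> - y2 x + q x *\<^sub>R y x = l * y x))"

definition is_eigenvalue :: "(real \<Rightarrow> real) \<Rightarrow> rfun \<Rightarrow> rfun \<Rightarrow> complex \<Rightarrow> bool" where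
  "is_eigenvalue q f F l \<longleftrightarrow>
    (\<exists>y y'. is_solution q l y y' \<and> (\<exists>x\<in>{0..pi}. y x \<noteq> 0) \<and>
      poly (map_poly of_real (down f)) l * y' 0 + poly (map_poly of_real (up f)) l * y 0 = 0 \<and>
      poly (map_poly of_real (down F)) l * y' pi - poly (map_poly of_real (up F)) l * y pi = 0)"

definition is_phi :: "(real \<Rightarrow> real) \<Rightarrow> rfun \<Rightarrow> real \<Rightarrow> (real \<Rightarrow> real) \<Rightarrow> bool" where
  "is_phi q f l y \<longleftrightarrow>
    (\<exists>y'. is_solution q l y y' \<and> y 0 = poly (down f) l \<and> y' 0 = - poly (up f) l)"

definition is_psi :: "(real \<Rightarrow> real) \<Rightarrow> rfun \<Rightarrow> real \<Rightarrow> (real \<Rightarrow> real) \<Rightarrow> bool" where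
  "is_psi q F l y \<longleftrightarrow>
    (\<exists>y'. is_solution q l y y' \<and> y pi = poly (down F) l \<and> y' pi = poly (up F) l)"

text \<open>The polynomial \<open>f' f\<^sub>\<down>\<^sup>2\<close>.\<close>

definition deriv_down2 :: "rfun \<Rightarrow> real poly" where
  "deriv_down2 f = pderiv (up f) * down f - up f * pderiv (down f)"

text \<open>\<open>lam\<close> lists all (complex) eigenvalues, which are real, in increasing order, and \<open>gam\<close> the
  corresponding norming constants. The functions \<open>\<phi>\<close>, \<open>\<psi>\<close> are unique on the interval, so the
  existential quantifier determines \<open>gam n\<close>.\<close>

definition spectral_data ::
  "(real \<Rightarrow> real) \<Rightarrow> rfun \<Rightarrow> rfun \<Rightarrow> (nat \<Rightarrow> real) \<Rightarrow> (nat \<Rightarrow> real) \<Rightarrow> bool"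
  where "spectral_data q f F lam gam \<longleftrightarrow>
    strict_mono lam \<and> {l. is_eigenvalue q f F l} = range (\<lambda>n. complex_of_real (lam n)) \<and>
    (\<forall>n. \<exists>\<phi> \<psi> \<beta>. is_phi q f (lam n) \<phi> \<and> is_psi q F (lam n) \<psi> \<and>
      \<beta> \<noteq> 0 \<and> (\<forall>x\<in>{0..pi}. \<psi> x = \<beta> * \<phi> x) \<and>
      gam n = integral {0..pi} (\<lambda>x. (\<phi> x)\<^sup>2) + poly (deriv_down2 f) (lam n)
              + 1 / \<beta>\<^sup>2 * poly (deriv_down2 F) (lam n))"

end

theory Submission
  imports Defs "HOL-Real_Asymp.Real_Asymp"
begin

text \<open>Write a solution as \<open>y = r sin \<theta>\<close>, \<open>y' = s r cos \<theta>\<close>, so that \<open>\<theta>' = s + (l - s\<^sup>2 - q) / s sin\<^sup>2 \<theta>\<close>.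
  Since \<open>f\<close> and \<open>F\<close> are increasing between their poles, the angles belonging to the boundary conditions
  have monotone continuous lifts in \<open>l\<close>, and by comparison so has \<open>\<theta>(\<pi>)\<close>. The resulting total angle
  \<open>G\<^sub>s(l)\<close> is a multiple of \<open>\<pi>\<close> exactly at the eigenvalues, exceeds \<open>- \<pi>\<close> and is negative for very
  negative \<open>l\<close>; hence \<open>G\<^sub>s(\<lambda>\<^sub>n) = n \<pi>\<close> for every \<open>s > 0\<close>. With \<open>s\<^sup>2 = \<lambda>\<^sub>n\<close> the equation becomes
  \<open>\<theta>' = s - (q / s) sin\<^sup>2 \<theta>\<close>, and \<open>G\<^sub>s(\<lambda>\<^sub>n) = n \<pi>\<close> is the asymptotic formula for \<open>s\<close> up to
  \<open>\<integral> q cos 2\<theta>\<close>. As \<open>2\<theta>\<close> is within \<open>O(1/n)\<close> of a line with integer slope, this remainder is controlled by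
  Bessel's inequality for \<open>cos j x\<close> and \<open>sin j x\<close> on \<open>[0, \<pi>]\<close>, and by truncation of \<open>q\<close> when \<open>q\<close> is
  only integrable. The norming constants are treated in the same way, using
  \<open>(log r)' = (q / 2s) sin 2\<theta>\<close>.\<close>

section \<open>Absolutely continuous functions\<close>

text \<open>Since \<open>q\<close> is merely integrable, the equations hold only almost everywhere;
  product rule, chain rule and comparison are therefore phrased through integrals. Monotonicity in l
  is available only for a fixed scale s, whereas the asymptotics need s^2 to be the eigenvalue
  itself. The bridge is that the level reached at the n-th eigenvalue is the same multiple of pi for
  all s, so the index is exact without any preliminary knowledge of the spectrum. The shift by half
  of \<open>ind f + ind F\<close> comes from the limits pi (ind + 1) / 2 of the two boundary angles,
  and the constants \<open>omega1\<close> from their next terms. Twice these limits are multiples of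
  pi, so sin 2\<theta> is small at both ends; this gains the additional factor 1/n in the boundary
  terms of the norming constants. After multiplication by n every error is either a trigonometric
  coefficient of q or of (pi - x) q, up to bounded factors, or O(1/n). Hence one argument serves
  both the o(1) claim and the square summable one.\<close>

lemma ai_subinterval:
  fixes g :: "real \<Rightarrow> real"
  assumes "g absolutely_integrable_on {a..b}" "a \<le> x" "y \<le> b"
  shows "g absolutely_integrable_on {x..y}"
  using absolutely_integrable_on_subinterval[OF assms(1)] assms(2,3) by auto

lemma ai_integrable: "g absolutely_integrable_on {a..b} \<Longrightarrow> g integrable_on {a..b}"
  for g :: "real \<Rightarrow> real"
  using absolutely_integrable_on_def by blast

lemma ai_abs: "g absolutely_integrable_on {a..b} \<Longrightarrow> (\<lambda>t. \<bar>g t\<bar>) absolutely_integrable_on {a..b}"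
  for g :: "real \<Rightarrow> real"
  using absolutely_integrable_norm[where f = g and S = "{a..b}"] by (simp add: o_def)

lemma ai_mult_cont:
  fixes g h :: "real \<Rightarrow> real"
  assumes "g absolutely_integrable_on {a..b}" "continuous_on {a..b} h"
  shows "(\<lambda>t. g t * h t) absolutely_integrable_on {a..b}"
proof -
  have "(\<lambda>t. h t * g t) absolutely_integrable_on {a..b}"
  proof (rule absolutely_integrable_bounded_measurable_product_real[OF _ _ _ assms(1)])
    show "h \<in> borel_measurable (lebesgue_on {a..b})"
      by (rule continuous_imp_measurable_on_sets_lebesgue[OF assms(2)]) auto
    show "bounded (h ` {a..b})"
      by (rule compact_imp_bounded[OF compact_continuous_image[OF assms(2)]]) simp
  qed simp
  then show ?thesis by (simp add: mult.commute)
qed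

lemma ai_integral_nonneg:
  fixes g :: "real \<Rightarrow> real"
  assumes "g absolutely_integrable_on {a..b}" "\<And>x. x \<in> {a..b} \<Longrightarrow> 0 \<le> g x"
  shows "0 \<le> integral {a..b} g"
  by (rule Henstock_Kurzweil_Integration.integral_nonneg[OF ai_integrable[OF assms(1)] assms(2)])

lemmas hk_integral_cong = Henstock_Kurzweil_Integration.integral_cong

lemma integral_abs_le:
  fixes f k :: "real \<Rightarrow> real"
  assumes "f absolutely_integrable_on {a..b}" "k absolutely_integrable_on {a..b}"
    "\<And>t. t \<in> {a..b} \<Longrightarrow> \<bar>f t\<bar> \<le> k t"
  shows "\<bar>integral {a..b} f\<bar> \<le> integral {a..b} k"
  proof -
  have "norm (integral {a..b} f) \<le> integral {a..b} k"
    by (rule integral_norm_bound_integral) (use assms ai_integrable in auto)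
  then show ?thesis by simp
qed

text \<open>Absolute continuity of \<open>u\<close> with derivative \<open>g\<close>, expressed
  through the integral: \<open>g\<close> may be changed on null sets, and no derivative of
  \<open>u\<close> has to be taken at a given point.\<close>

definition ac_primitive :: "(real \<Rightarrow> real) \<Rightarrow> (real \<Rightarrow> real) \<Rightarrow> real \<Rightarrow> real \<Rightarrow> bool" where
  "ac_primitive u g a b \<longleftrightarrow>
    g absolutely_integrable_on {a..b} \<and> (\<forall>x\<in>{a..b}. u x = u a + integral {a..x} g)"

lemma ac_primitive_ai: "ac_primitive u g a b \<Longrightarrow> g absolutely_integrable_on {a..b}"
  by (simp add: ac_primitive_def)

lemma ac_primitive_eq: "ac_primitive u g a b \<Longrightarrow> x \<in> {a..b} \<Longrightarrow> u x = u a + integral {a..x} g"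
  unfolding ac_primitive_def by blast

lemma ac_primitive_cont:
  assumes "ac_primitive u g a b"
  shows "continuous_on {a..b} u"
proof -
  have "continuous_on {a..b} (\<lambda>x. u a + integral {a..x} g)"
    by (intro continuous_on_add continuous_on_const indefinite_integral_continuous_1 ai_integrable
        ac_primitive_ai[OF assms])
  then show ?thesis
    by (rule continuous_on_eq) (metis ac_primitive_eq[OF assms])
qed

lemma ac_primitive_diff:
  assumes "ac_primitive u g a b" "a \<le> x" "x \<le> y" "y \<le> b"
  shows "u y - u x = integral {x..y} g"
proof -
  have "g integrable_on {a..y}"
    using ai_integrable[OF ai_subinterval[OF ac_primitive_ai[OF assms(1)]]] assms by auto
  then have "integral {a..x} g + integral {x..y} g = integral {a..y} g"
    by (intro Henstock_Kurzweil_Integration.integral_combine) (use assms in auto)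
  then show ?thesis
    using ac_primitive_eq[OF assms(1), of x] ac_primitive_eq[OF assms(1), of y] assms(2-)
    by (simp del: diff_add_cancel)
qed

lemma ac_primitive_cong:
  assumes "ac_primitive u g a b" "a \<le> b"
    "\<And>x. x \<in> {a..b} \<Longrightarrow> v x = u x" "\<And>x. x \<in> {a..b} \<Longrightarrow> h x = g x"
  shows "ac_primitive v h a b"
  unfolding ac_primitive_def
proof (intro conjI ballI)
  show "h absolutely_integrable_on {a..b}"
    using ac_primitive_ai[OF assms(1)] assms(4)
    by (subst set_integrable_cong[OF refl refl assms(4)])
  fix x assume x: "x \<in> {a..b}"
  have "integral {a..x} h = integral {a..x} g"
    by (rule hk_integral_cong) (use assms(4) x in auto)
  then show "v x = v a + integral {a..x} h"
    using ac_primitive_eq[OF assms(1) x] assms(2) assms(3)[OF x] assms(3)[of a] x by simp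
qed

lemma ac_primitive_integral:
  assumes "g absolutely_integrable_on {a..b}"
  shows "ac_primitive (\<lambda>x. c + integral {a..x} g) g a b"
  unfolding ac_primitive_def using assms by simp

lemma ac_primitive_const: "ac_primitive (\<lambda>x. c) (\<lambda>x. 0) a b"
  by (simp add: ac_primitive_def)

lemma ac_primitive_C1:
  assumes "\<And>x. x \<in> {a..b} \<Longrightarrow> (u has_real_derivative g x) (at x within {a..b})" "continuous_on {a..b} g"
  shows "ac_primitive u g a b"
  unfolding ac_primitive_def
proof (intro conjI ballI)
  show "g absolutely_integrable_on {a..b}"
    by (rule absolutely_integrable_continuous_real[OF assms(2)])
  fix x assume x: "x \<in> {a..b}"
  have "(g has_integral u x - u a) {a..x}"
  proof (rule fundamental_theorem_of_calculus)
    show "a \<le> x" using x by simp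
    fix y assume y: "y \<in> {a..x}"
    have "(u has_real_derivative g y) (at y within {a..x})"
      by (rule DERIV_subset[OF assms(1)]) (use x y in auto)
    then show "(u has_vector_derivative g y) (at y within {a..x})"
      by (simp add: has_real_derivative_iff_has_vector_derivative)
  qed
  then show "u x = u a + integral {a..x} g"
    by (simp add: integral_unique)
qed

lemma ac_primitive_add:
  assumes "ac_primitive u g a b" "ac_primitive v h a b"
  shows "ac_primitive (\<lambda>x. u x + v x) (\<lambda>x. g x + h x) a b"
  unfolding ac_primitive_def
proof (intro conjI ballI)
  show "(\<lambda>x. g x + h x) absolutely_integrable_on {a..b}"
    by (rule set_integral_add(1)[OF ac_primitive_ai[OF assms(1)] ac_primitive_ai[OF assms(2)]])
  fix x assume x: "x \<in> {a..b}"
  have "integral {a..x} (\<lambda>x. g x + h x) = integral {a..x} g + integral {a..x} h"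
    by (rule integral_add; rule ai_integrable; rule ai_subinterval[where a = a and b = b])
      (use assms ac_primitive_ai x in auto)
  then show "u x + v x = u a + v a + integral {a..x} (\<lambda>x. g x + h x)"
    using ac_primitive_eq[OF assms(1) x] ac_primitive_eq[OF assms(2) x] by simp
qed

lemma ac_primitive_cmult:
  assumes "ac_primitive u g a b"
  shows "ac_primitive (\<lambda>x. c * u x) (\<lambda>x. c * g x) a b"
  unfolding ac_primitive_def
proof (intro conjI ballI)
  show "(\<lambda>x. c * g x) absolutely_integrable_on {a..b}"
    using ac_primitive_ai[OF assms] by simp
  fix x assume x: "x \<in> {a..b}"
  show "c * u x = c * u a + integral {a..x} (\<lambda>x. c * g x)"
    using ac_primitive_eq[OF assms x] by (simp add: algebra_simps)
qed

lemma ac_primitive_minus: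
  assumes "ac_primitive u g a b" "ac_primitive v h a b"
  shows "ac_primitive (\<lambda>x. u x - v x) (\<lambda>x. g x - h x) a b"
  using ac_primitive_add[OF assms(1) ac_primitive_cmult[OF assms(2), of "-1"]] by simp

text \<open>Increments of order \<open>o(1)\<close> times those of a fixed function force constancy. This
  replaces a.e. differentiation in the product and chain rules below.\<close>

lemma const_if_small_increments:
  fixes \<phi> W :: "real \<Rightarrow> real"
  assumes "a \<le> b"
    and small: "\<And>e. e > 0 \<Longrightarrow> \<exists>d>0. \<forall>x y. a \<le> x \<longrightarrow> x \<le> y \<longrightarrow> y \<le> b \<longrightarrow> y - x < d \<longrightarrow>
      \<bar>\<phi> y - \<phi> x\<bar> \<le> e * (W y - W x)"
  shows "\<phi> b = \<phi> a"
proof -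
  have le: "\<bar>\<phi> b - \<phi> a\<bar> \<le> e * (W b - W a)" if "e > 0" for e
  proof -
    obtain d where d: "d > 0" "\<And>x y. a \<le> x \<Longrightarrow> x \<le> y \<Longrightarrow> y \<le> b \<Longrightarrow> y - x < d \<Longrightarrow>
      \<bar>\<phi> y - \<phi> x\<bar> \<le> e * (W y - W x)"
      using small[OF \<open>e > 0\<close>] by blast
    obtain N :: nat where N: "(b - a) / d < real N"
      using reals_Archimedean2 by blast
    have "0 \<le> (b - a) / d" using assms(1) d(1) by simp
    then have N0: "N > 0" using N by (cases N) auto
    define h where "h = (b - a) / real N"
    have h: "0 \<le> h" "h < d" "real N * h = b - a"
      using N N0 assms(1) d(1) by (auto simp: h_def field_simps)
    have "i \<le> N \<Longrightarrow> \<bar>\<phi> (a + real i * h) - \<phi> a\<bar> \<le> e * (W (a + real i * h) - W a)" for i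
    proof (induction i)
      case (Suc i)
      have "real (Suc i) * h \<le> real N * h" using Suc.prems h(1) by (intro mult_right_mono) auto
      then have "\<bar>\<phi> (a + real (Suc i) * h) - \<phi> (a + real i * h)\<bar>
          \<le> e * (W (a + real (Suc i) * h) - W (a + real i * h))"
        using h by (intro d(2)) (auto simp: algebra_simps)
      with Suc show ?case by (simp add: algebra_simps)
    qed simp
    from this[of N] show ?thesis using h(3) by simp
  qed
  show ?thesis
  proof (rule ccontr)
    assume "\<phi> b \<noteq> \<phi> a"
    define P where "P = \<bar>\<phi> b - \<phi> a\<bar>"
    have p: "P > 0" using \<open>\<phi> b \<noteq> \<phi> a\<close> by (simp add: P_def)
    \<comment> \<open>The added 1 keeps the divisor positive when \<open>W b = W a\<close>.\<close>
    define w where "w = \<bar>W b - W a\<bar> + 1"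
    have w: "w > 0" "W b - W a \<le> w" by (auto simp: w_def)
    define e where "e = P / (2 * w)"
    have "e > 0" unfolding e_def using p w by (intro divide_pos_pos) auto
    have "e * (W b - W a) \<le> e * w"
      using \<open>e > 0\<close> w by (intro mult_left_mono) auto
    also have "\<dots> = P / 2" using w(1) by (simp add: e_def)
    finally show False using le[OF \<open>e > 0\<close>] p unfolding P_def[symmetric] by linarith
  qed
qed

text \<open>Local test for the integral formula: on short intervals the error against the integral
  of \<open>g\<close> has to be small relative to a fixed weight \<open>w\<close>. Product and chain
  rule then reduce to freezing continuous factors.\<close>

lemma ac_primitiveI:
  assumes g: "g absolutely_integrable_on {a..b}" and w: "w absolutely_integrable_on {a..b}"
    and small: "\<And>e. e > 0 \<Longrightarrow> \<exists>d>0. \<forall>x y. a \<le> x \<longrightarrow> x \<le> y \<longrightarrow> y \<le> b \<longrightarrow> y - x < d \<longrightarrow>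
      \<bar>u y - u x - integral {x..y} g\<bar> \<le> e * integral {x..y} w"
  shows "ac_primitive u g a b"
  unfolding ac_primitive_def
proof (intro conjI ballI)
  fix z assume z: "z \<in> {a..b}"
  have G: "integral {x..y} h = integral {a..y} h - integral {a..x} h"
    if "h absolutely_integrable_on {a..b}" "a \<le> x" "x \<le> y" "y \<le> b" for x y and h :: "real \<Rightarrow> real"
    using ac_primitive_diff[OF ac_primitive_integral[OF that(1), of 0] that(2-)] by simp
  define \<phi> where "\<phi> x = u x - integral {a..x} g" for x
  have "\<phi> z = \<phi> a"
  proof (rule const_if_small_increments[where \<phi> = \<phi> and a = a and b = z and W = "\<lambda>x. integral {a..x} w"])
    fix e :: real assume "e > 0"
    then obtain d where d: "d > 0" "\<And>x y. a \<le> x \<Longrightarrow> x \<le> y \<Longrightarrow> y \<le> b \<Longrightarrow> y - x < d \<Longrightarrow>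
      \<bar>u y - u x - integral {x..y} g\<bar> \<le> e * integral {x..y} w"
      using small by blast
    show "\<exists>d>0. \<forall>x y. a \<le> x \<longrightarrow> x \<le> y \<longrightarrow> y \<le> z \<longrightarrow> y - x < d \<longrightarrow>
      \<bar>\<phi> y - \<phi> x\<bar> \<le> e * (integral {a..y} w - integral {a..x} w)"
    proof (intro exI[of _ d] conjI allI impI d(1))
      fix x y assume xy: "a \<le> x" "x \<le> y" "y \<le> z" "y - x < d"
      then have "y \<le> b" using z by simp
      with d(2)[of x y] G[OF g, of x y] G[OF w, of x y] xy
      show "\<bar>\<phi> y - \<phi> x\<bar> \<le> e * (integral {a..y} w - integral {a..x} w)"
        by (simp add: \<phi>_def algebra_simps)
    qed
  qed (use z in auto)
  then show "u z = u a + integral {a..z} g" by (simp add: \<phi>_def)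
qed (rule g)

lemma uniformly_close_on_interval:
  fixes u :: "real \<Rightarrow> real"
  assumes "continuous_on {a..b} u" "e > 0"
  obtains d where "d > 0" "\<And>x y. x \<in> {a..b} \<Longrightarrow> y \<in> {a..b} \<Longrightarrow> \<bar>x - y\<bar> < d \<Longrightarrow> \<bar>u x - u y\<bar> < e"
proof -
  have "uniformly_continuous_on {a..b} u"
    by (rule compact_uniformly_continuous[OF assms(1)]) simp
  from uniformly_continuous_onE[OF this assms(2)]
  obtain d where "d > 0" "\<And>x x'. x \<in> {a..b} \<Longrightarrow> x' \<in> {a..b} \<Longrightarrow> dist x' x < d \<Longrightarrow> dist (u x') (u x) < e"
    by metis
  then show ?thesis using that[of d] by (auto simp: dist_real_def abs_minus_commute)
qed

lemma ac_primitive_mult: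
  assumes u: "ac_primitive u g a b" and v: "ac_primitive v h a b"
  shows "ac_primitive (\<lambda>x. u x * v x) (\<lambda>x. g x * v x + u x * h x) a b"
proof (rule ac_primitiveI)
  note gi = ac_primitive_ai[OF u] and hi = ac_primitive_ai[OF v]
  note uc = ac_primitive_cont[OF u] and vc = ac_primitive_cont[OF v]
  show gv: "(\<lambda>x. g x * v x + u x * h x) absolutely_integrable_on {a..b}"
    using ai_mult_cont[OF gi vc] ai_mult_cont[OF hi uc] by (intro set_integral_add) (simp_all add: mult.commute)
  show w: "(\<lambda>x. \<bar>g x\<bar> + \<bar>h x\<bar>) absolutely_integrable_on {a..b}"
    using gi hi by (intro set_integral_add ai_abs)
  fix e :: real assume e: "e > 0"
  obtain d1 where d1: "d1 > 0" "\<And>x y. x \<in> {a..b} \<Longrightarrow> y \<in> {a..b} \<Longrightarrow> \<bar>x - y\<bar> < d1 \<Longrightarrow> \<bar>u x - u y\<bar> < e"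
    using uniformly_close_on_interval[OF uc e] by metis
  obtain d2 where d2: "d2 > 0" "\<And>x y. x \<in> {a..b} \<Longrightarrow> y \<in> {a..b} \<Longrightarrow> \<bar>x - y\<bar> < d2 \<Longrightarrow> \<bar>v x - v y\<bar> < e"
    using uniformly_close_on_interval[OF vc e] by metis
  show "\<exists>d>0. \<forall>x y. a \<le> x \<longrightarrow> x \<le> y \<longrightarrow> y \<le> b \<longrightarrow> y - x < d \<longrightarrow>
      \<bar>u y * v y - u x * v x - integral {x..y} (\<lambda>x. g x * v x + u x * h x)\<bar>
      \<le> e * integral {x..y} (\<lambda>x. \<bar>g x\<bar> + \<bar>h x\<bar>)"
  proof (intro exI[of _ "min d1 d2"] conjI allI impI)
    fix x y assume xy: "a \<le> x" "x \<le> y" "y \<le> b" "y - x < min d1 d2"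
    note sub = ai_subinterval[OF _ xy(1) xy(3)]
    have s1: "g absolutely_integrable_on {x..y}" "h absolutely_integrable_on {x..y}"
      "(\<lambda>t. \<bar>g t\<bar> + \<bar>h t\<bar>) absolutely_integrable_on {x..y}"
      "(\<lambda>x. g x * v x + u x * h x) absolutely_integrable_on {x..y}"
      using gi hi w gv by (auto intro: sub)
    \<comment> \<open>Exact splitting with the factors frozen at \<open>v y\<close> and
      \<open>u x\<close>; the error is the oscillation of \<open>u\<close> and \<open>v\<close> over
      the interval, weighted by the two derivatives.\<close>
    have eq: "u y * v y - u x * v x - integral {x..y} (\<lambda>t. g t * v t + u t * h t)
      = integral {x..y} (\<lambda>t. (g t * v y + h t * u x) - (g t * v t + u t * h t))"
    proof -
      have "u y * v y - u x * v x = (u y - u x) * v y + (v y - v x) * u x" by (simp add: algebra_simps)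
      also have "\<dots> = integral {x..y} (\<lambda>t. g t * v y + h t * u x)"
        using s1 by (simp add: ac_primitive_diff[OF u xy(1-3)] ac_primitive_diff[OF v xy(1-3)] ai_integrable
            integral_add integrable_on_mult_left)
      finally show ?thesis
        using s1 by (simp add: ai_integrable integral_diff integrable_add integrable_on_mult_left)
    qed
    have "\<bar>integral {x..y} (\<lambda>t. (g t * v y + h t * u x) - (g t * v t + u t * h t))\<bar>
      \<le> integral {x..y} (\<lambda>t. e * (\<bar>g t\<bar> + \<bar>h t\<bar>))"
    proof (rule integral_abs_le)
      show "(\<lambda>t. (g t * v y + h t * u x) - (g t * v t + u t * h t)) absolutely_integrable_on {x..y}"
        using s1 by (intro set_integral_diff(1)[OF set_integral_add(1)]) auto
      show "(\<lambda>t. e * (\<bar>g t\<bar> + \<bar>h t\<bar>)) absolutely_integrable_on {x..y}"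
        using s1(3) by simp
      fix t assume t: "t \<in> {x..y}"
      have "\<bar>g t * (v y - v t)\<bar> \<le> \<bar>g t\<bar> * e" "\<bar>h t * (u x - u t)\<bar> \<le> \<bar>h t\<bar> * e"
        unfolding abs_mult using d2(2)[of y t] d1(2)[of x t] t xy
        by (auto intro!: mult_left_mono)
      moreover have "(g t * v y + h t * u x) - (g t * v t + u t * h t) = g t * (v y - v t) + h t * (u x - u t)"
        by (simp add: algebra_simps)
      ultimately show "\<bar>(g t * v y + h t * u x) - (g t * v t + u t * h t)\<bar> \<le> e * (\<bar>g t\<bar> + \<bar>h t\<bar>)"
        by (simp add: algebra_simps)
    qed
    then show "\<bar>u y * v y - u x * v x - integral {x..y} (\<lambda>x. g x * v x + u x * h x)\<bar>
      \<le> e * integral {x..y} (\<lambda>x. \<bar>g x\<bar> + \<bar>h x\<bar>)"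
      unfolding eq by simp
  qed (use d1 d2 in auto)
qed

lemma ac_primitive_chain:
  assumes u: "ac_primitive u g a b"
    and F: "\<And>x. (F has_real_derivative F' x) (at x)" and F': "continuous_on UNIV F'"
  shows "ac_primitive (\<lambda>x. F (u x)) (\<lambda>x. F' (u x) * g x) a b"
proof (rule ac_primitiveI)
  note gi = ac_primitive_ai[OF u] and uc = ac_primitive_cont[OF u]
  have Fc: "continuous_on {a..b} (\<lambda>x. F' (u x))"
    by (rule continuous_on_compose2[OF F' uc]) auto
  show fg: "(\<lambda>x. F' (u x) * g x) absolutely_integrable_on {a..b}"
    using ai_mult_cont[OF gi Fc] by (simp add: mult.commute)
  show w: "(\<lambda>x. \<bar>g x\<bar>) absolutely_integrable_on {a..b}"
    using gi by (rule ai_abs)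
  fix e :: real assume e: "e > 0"
  obtain M where M: "\<And>x. x \<in> {a..b} \<Longrightarrow> u x \<in> {-M..M}"
  proof -
    have "bounded (u ` {a..b})"
      by (rule compact_imp_bounded[OF compact_continuous_image[OF uc]]) simp
    then obtain M where "\<forall>y\<in>u ` {a..b}. norm y \<le> M" by (auto simp: bounded_iff)
    then show ?thesis using that[of M] by (force simp: abs_le_iff)
  qed
  obtain d1 where d1: "d1 > 0" "\<And>x y. x \<in> {-M..M} \<Longrightarrow> y \<in> {-M..M} \<Longrightarrow> \<bar>x - y\<bar> < d1 \<Longrightarrow> \<bar>F' x - F' y\<bar> < e"
    using uniformly_close_on_interval[OF continuous_on_subset[OF F' subset_UNIV] e] by metis
  obtain d2 where d2: "d2 > 0" "\<And>x y. x \<in> {a..b} \<Longrightarrow> y \<in> {a..b} \<Longrightarrow> \<bar>x - y\<bar> < d2 \<Longrightarrow> \<bar>u x - u y\<bar> < d1 / 2"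
    using uniformly_close_on_interval[OF uc] d1(1) by (metis half_gt_zero)
  show "\<exists>d>0. \<forall>x y. a \<le> x \<longrightarrow> x \<le> y \<longrightarrow> y \<le> b \<longrightarrow> y - x < d \<longrightarrow>
      \<bar>F (u y) - F (u x) - integral {x..y} (\<lambda>x. F' (u x) * g x)\<bar> \<le> e * integral {x..y} (\<lambda>x. \<bar>g x\<bar>)"
  proof (intro exI[of _ "d2"] conjI allI impI)
    fix x y assume xy: "a \<le> x" "x \<le> y" "y \<le> b" "y - x < d2"
    note sub = ai_subinterval[OF _ xy(1) xy(3)]
    have s1: "g absolutely_integrable_on {x..y}" "(\<lambda>t. \<bar>g t\<bar>) absolutely_integrable_on {x..y}"
      "(\<lambda>x. F' (u x) * g x) absolutely_integrable_on {x..y}"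
      using gi w fg by (auto intro: sub)
    \<comment> \<open>The mean value theorem freezes \<open>F'\<close> at a single point for the
      whole increment. Uniform continuity of \<open>F'\<close> on a compact interval containing the
      range of \<open>u\<close> then compares it with \<open>F' (u t)\<close>.\<close>
    obtain z where z: "F (u y) - F (u x) = (u y - u x) * F' z" "z \<in> {min (u x) (u y)..max (u x) (u y)}"
    proof (cases "u x" "u y" rule: linorder_cases)
      case less
      with MVT2[of "u x" "u y" F F'] F obtain z where "u x < z" "z < u y" "F (u y) - F (u x) = (u y - u x) * F' z"
        by auto
      then show ?thesis using that[of z] less by auto
    next
      case greater
      with MVT2[of "u y" "u x" F F'] F obtain z where "u y < z" "z < u x" "F (u x) - F (u y) = (u x - u y) * F' z"
        by auto
      then show ?thesis using that[of z] greater by (auto simp: algebra_simps)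
    qed (use that in auto)
    have zc: "\<bar>F' z - F' (u t)\<bar> \<le> e" if t: "t \<in> {x..y}" for t
    proof (rule less_imp_le, rule d1(2))
      have "\<bar>u x - u t\<bar> < d1/2" "\<bar>u y - u t\<bar> < d1/2" using d2(2)[of x t] d2(2)[of y t] t xy by auto
      moreover have "min (u x) (u y) \<le> z" "z \<le> max (u x) (u y)" using z(2) by auto
      ultimately show "\<bar>z - u t\<bar> < d1" by linarith
      show "z \<in> {-M..M}" using z(2) M[of x] M[of y] xy by (auto simp: min_def max_def split: if_splits)
      show "u t \<in> {-M..M}" using M t xy by auto
    qed
    have eq: "F (u y) - F (u x) - integral {x..y} (\<lambda>t. F' (u t) * g t)
      = integral {x..y} (\<lambda>t. F' z * g t - F' (u t) * g t)"
      using s1 by (simp add: z(1) ac_primitive_diff[OF u xy(1-3)] integral_diff ai_integrable mult.commute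
        integrable_on_mult_right)
    have "\<bar>integral {x..y} (\<lambda>t. F' z * g t - F' (u t) * g t)\<bar> \<le> integral {x..y} (\<lambda>t. e * \<bar>g t\<bar>)"
    proof (rule integral_abs_le)
      show "(\<lambda>t. F' z * g t - F' (u t) * g t) absolutely_integrable_on {x..y}"
        using s1 by (intro set_integral_diff) auto
      show "(\<lambda>t. e * \<bar>g t\<bar>) absolutely_integrable_on {x..y}" using s1(2) by simp
      fix t assume t: "t \<in> {x..y}"
      have "\<bar>F' z * g t - F' (u t) * g t\<bar> = \<bar>F' z - F' (u t)\<bar> * \<bar>g t\<bar>"
        by (simp add: abs_mult[symmetric] algebra_simps)
      also have "\<dots> \<le> e * \<bar>g t\<bar>" using zc[OF t] by (intro mult_right_mono) auto
      finally show "\<bar>F' z * g t - F' (u t) * g t\<bar> \<le> e * \<bar>g t\<bar>" .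
    qed
    then show "\<bar>F (u y) - F (u x) - integral {x..y} (\<lambda>x. F' (u x) * g x)\<bar> \<le> e * integral {x..y} (\<lambda>x. \<bar>g x\<bar>)"
      unfolding eq by simp
  qed (use d2 in auto)
qed

section \<open>Linear equations and comparison of angles\<close>

text \<open>Variation of constants: after multiplication by the integrating factor
  \<open>exp (- A x)\<close> the terms with \<open>w\<close> cancel in the product rule.\<close>

lemma linear_ode_ac_solution:
  assumes D: "ac_primitive D (\<lambda>x. w x * D x + e x) a b"
    and w: "w absolutely_integrable_on {a..b}"
    and x: "x \<in> {a..b}"
  shows "D x = exp (integral {a..x} w) * (D a + integral {a..x} (\<lambda>t. exp (- integral {a..t} w) * e t))"
proof -
  define A where "A x = integral {a..x} w" for x
  have A: "ac_primitive A w a b"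
    using ac_primitive_integral[OF w, of 0] by (simp add: A_def[abs_def])
  have E: "ac_primitive (\<lambda>x. exp (- A x)) (\<lambda>x. exp (- A x) * (- w x)) a b"
    using ac_primitive_chain[OF ac_primitive_cmult[OF A, of "-1"], of exp exp] by (simp add: DERIV_exp continuous_on_exp)
  have "D x * exp (- A x) = D a * exp (- A a) + integral {a..x} (\<lambda>x. (w x * D x + e x) * exp (- A x) + D x * (exp (- A x) * (- w x)))"
    by (rule ac_primitive_eq[OF ac_primitive_mult[OF D E] x])
  also have "(\<lambda>x. (w x * D x + e x) * exp (- A x) + D x * (exp (- A x) * (- w x))) = (\<lambda>t. exp (- A t) * e t)"
    by (auto simp: algebra_simps)
  also have "A a = 0" by (simp add: A_def)
  finally show ?thesis by (simp add: A_def exp_minus field_simps)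
qed

lemma abs_sin_squared_diff_le: "\<bar>(sin x)^2 - (sin y)^2\<bar> \<le> \<bar>x - y\<bar>" for x y :: real
proof -
  have "(sin x)^2 - (sin y)^2 = sin (x + y) * sin (x - y)"
  proof -
    have "sin (x + y) * sin (x - y) = (sin x)^2 * (cos y)^2 - (cos x)^2 * (sin y)^2"
      by (simp add: sin_add sin_diff power2_eq_square algebra_simps)
    then show ?thesis by (simp add: cos_squared_eq algebra_simps)
  qed
  also have "\<bar>\<dots>\<bar> \<le> 1 * \<bar>x - y\<bar>"
    unfolding abs_mult by (intro mult_mono abs_sin_x_le_abs_x) auto
  finally show ?thesis by simp
qed

text \<open>Linearises the angle equation: the difference quotient of sin^2 is bounded by 1 and
  becomes part of the coefficient of \<open>u - v\<close>. Division by zero sets it to 0 where the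
  arguments agree, and there both sides of the identity vanish.\<close>

lemma sin_squared_quotient:
  fixes u v p :: "real \<Rightarrow> real"
  assumes "continuous_on {a..b} u" "continuous_on {a..b} v" and p: "p absolutely_integrable_on {a..b}"
  obtains w where "w absolutely_integrable_on {a..b}" "\<And>x. \<bar>w x\<bar> \<le> \<bar>p x\<bar>"
    "\<And>x. p x * ((sin (u x))^2 - (sin (v x))^2) = w x * (u x - v x)"
proof -
  define s where "s x = ((sin (u x))^2 - (sin (v x))^2) / (u x - v x)" for x
  have s1: "\<bar>s x\<bar> \<le> 1" for x
    unfolding s_def abs_divide using abs_sin_squared_diff_le[of "u x" "v x"]
    by (cases "u x = v x") (auto simp: divide_le_eq_1)
  have [measurable]: "u \<in> borel_measurable (lebesgue_on {a..b})" "v \<in> borel_measurable (lebesgue_on {a..b})"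
    using assms by (auto intro!: continuous_imp_measurable_on_sets_lebesgue)
  show ?thesis
  proof (rule that[of "\<lambda>x. s x * p x"])
    show "(\<lambda>x. s x * p x) absolutely_integrable_on {a..b}"
    proof (rule absolutely_integrable_bounded_measurable_product_real[OF _ _ _ p])
      show "s \<in> borel_measurable (lebesgue_on {a..b})"
        unfolding s_def[abs_def] by measurable
      show "bounded (s ` {a..b})" using s1 by (auto simp: bounded_iff intro!: exI[of _ 1])
    qed simp
    show "\<bar>s x * p x\<bar> \<le> \<bar>p x\<bar>" for x
      using mult_right_mono[OF s1[of x], of "\<bar>p x\<bar>"] by (simp add: abs_mult)
    show "p x * ((sin (u x))^2 - (sin (v x))^2) = s x * p x * (u x - v x)" for x
      by (cases "u x = v x") (auto simp: s_def)
  qed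
qed

lemma integral_subinterval_abs_le:
  fixes w p :: "real \<Rightarrow> real"
  assumes w: "w absolutely_integrable_on {a..b}" and p: "p absolutely_integrable_on {a..b}"
    and "\<And>x. \<bar>w x\<bar> \<le> \<bar>p x\<bar>" "a \<le> t" "x \<le> b"
  shows "\<bar>integral {t..x} w\<bar> \<le> integral {a..b} (\<lambda>x. \<bar>p x\<bar>)"
proof -
  note pa = ai_subinterval[OF ai_abs[OF p] assms(4,5)]
  have "\<bar>integral {t..x} w\<bar> \<le> integral {t..x} (\<lambda>x. \<bar>p x\<bar>)"
    using assms by (intro integral_abs_le pa ai_subinterval[OF w assms(4,5)]) auto
  also have "\<dots> \<le> integral {a..b} (\<lambda>x. \<bar>p x\<bar>)"
  proof (rule integral_subset_le)
    show "{t..x} \<subseteq> {a..b}" using assms by auto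
    show "(\<lambda>x. \<bar>p x\<bar>) integrable_on {t..x}" "(\<lambda>x. \<bar>p x\<bar>) integrable_on {a..b}"
      by (rule ai_integrable[OF pa]) (rule ai_integrable[OF ai_abs[OF p]])
  qed auto
  finally show ?thesis .
qed

text \<open>Gronwall estimates for two angles whose equations share the coefficient \<open>p\<close>
  up to a defect \<open>e\<close>. The 2 in the exponent collects \<open>exp (B x)\<close> in front
  and \<open>exp (- B t)\<close> under the integral, each controlled by the integral of
  \<open>\<bar>p\<bar>\<close>. The first bound serves continuity in l; the second says that a
  nonnegative defect preserves the order of the angles.\<close>

lemma angle_comparison:
  assumes u: "ac_primitive u g a b" and v: "ac_primitive v h a b"
    and p: "p absolutely_integrable_on {a..b}" and e: "e absolutely_integrable_on {a..b}"
    and gh: "\<And>x. x \<in> {a..b} \<Longrightarrow> g x - h x = p x * ((sin (u x))^2 - (sin (v x))^2) + e x"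
    and x: "x \<in> {a..b}"
  shows "\<bar>u x - v x\<bar> \<le> exp (2 * integral {a..b} (\<lambda>x. \<bar>p x\<bar>)) * (\<bar>u a - v a\<bar> + integral {a..b} (\<lambda>x. \<bar>e x\<bar>))"
    and "(\<And>t. t \<in> {a..b} \<Longrightarrow> 0 \<le> e t) \<Longrightarrow> v a \<le> u a \<Longrightarrow>
      exp (- (2 * integral {a..b} (\<lambda>x. \<bar>p x\<bar>))) * (u a - v a + integral {a..x} e) \<le> u x - v x"
proof -
  define P where "P = integral {a..b} (\<lambda>x. \<bar>p x\<bar>)"
  have ab: "a \<le> b" using x by simp
  obtain w where w: "w absolutely_integrable_on {a..b}" "\<And>x. \<bar>w x\<bar> \<le> \<bar>p x\<bar>"
    "\<And>x. p x * ((sin (u x))^2 - (sin (v x))^2) = w x * (u x - v x)"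
    using sin_squared_quotient[OF ac_primitive_cont[OF u] ac_primitive_cont[OF v] p] by blast
  have D: "ac_primitive (\<lambda>x. u x - v x) (\<lambda>x. w x * (u x - v x) + e x) a b"
    using gh w(3) by (intro ac_primitive_cong[OF ac_primitive_minus[OF u v] ab]) auto
  define B where "B t = integral {a..t} w" for t
  have B: "\<bar>B t\<bar> \<le> P" if "t \<in> {a..b}" for t
    unfolding B_def P_def using w that by (intro integral_subinterval_abs_le[OF _ p]) auto
  have Bc: "continuous_on {a..b} (\<lambda>t. exp (- B t))"
    using ac_primitive_cont[OF ac_primitive_integral[OF w(1), of 0]] unfolding B_def[abs_def]
    by (intro continuous_on_exp continuous_on_minus) simp
  define I where "I = integral {a..x} (\<lambda>t. exp (- B t) * e t)"
  have Iai: "(\<lambda>t. exp (- B t) * e t) absolutely_integrable_on {a..x}"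
    using ai_subinterval[OF ai_mult_cont[OF e Bc], of a x] x by (simp add: mult.commute)
  have eai: "e absolutely_integrable_on {a..x}" using ai_subinterval[OF e, of a x] x by simp
  have eq: "u x - v x = exp (B x) * (u a - v a + I)"
    using linear_ode_ac_solution[OF D w(1) x] unfolding B_def[symmetric] I_def .
  have "\<bar>I\<bar> \<le> integral {a..x} (\<lambda>t. exp P * \<bar>e t\<bar>)"
    unfolding I_def
  proof (rule integral_abs_le[OF Iai])
    show "(\<lambda>t. exp P * \<bar>e t\<bar>) absolutely_integrable_on {a..x}" using ai_abs[OF eai] by simp
    show "\<bar>exp (- B t) * e t\<bar> \<le> exp P * \<bar>e t\<bar>" if "t \<in> {a..x}" for t
      unfolding abs_mult using B[of t] that x by (intro mult_right_mono) auto
  qed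
  also have "\<dots> = exp P * integral {a..x} (\<lambda>t. \<bar>e t\<bar>)" by simp
  also have "\<dots> \<le> exp P * integral {a..b} (\<lambda>t. \<bar>e t\<bar>)"
    using x ai_integrable[OF ai_abs[OF e]] ai_integrable[OF ai_abs[OF eai]]
    by (intro mult_left_mono integral_subset_le) auto
  finally have I1: "\<bar>I\<bar> \<le> exp P * integral {a..b} (\<lambda>t. \<bar>e t\<bar>)" .
  have P0: "P \<ge> 0" unfolding P_def by (rule ai_integral_nonneg[OF ai_abs[OF p]]) auto
  have E2: "exp (2 * P) = exp P * exp P" and E3: "exp (- (2 * P)) = exp (- P) * exp (- P)"
    by (simp_all flip: exp_add)
  have "\<bar>u x - v x\<bar> \<le> exp P * (exp P * \<bar>u a - v a\<bar> + exp P * integral {a..b} (\<lambda>t. \<bar>e t\<bar>))"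
    unfolding eq abs_mult
  proof (intro mult_mono)
    have "\<bar>u a - v a\<bar> \<le> exp P * \<bar>u a - v a\<bar>"
      using mult_right_mono[of 1 "exp P" "\<bar>u a - v a\<bar>"] P0 by simp
    then show "\<bar>u a - v a + I\<bar> \<le> exp P * \<bar>u a - v a\<bar> + exp P * integral {a..b} (\<lambda>t. \<bar>e t\<bar>)"
      using I1 by (smt (verit))
  qed (use B[OF x] in auto)
  then show "\<bar>u x - v x\<bar> \<le> exp (2 * integral {a..b} (\<lambda>x. \<bar>p x\<bar>)) * (\<bar>u a - v a\<bar> + integral {a..b} (\<lambda>x. \<bar>e x\<bar>))"
    unfolding P_def[symmetric] E2 by (simp only: distrib_left mult.assoc)
  assume e0: "\<And>t. t \<in> {a..b} \<Longrightarrow> 0 \<le> e t" and ua: "v a \<le> u a"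
  have "integral {a..x} (\<lambda>t. exp (-P) * e t) \<le> I"
    unfolding I_def
  proof (rule integral_le)
    show "(\<lambda>t. exp (- P) * e t) integrable_on {a..x}" using ai_integrable[OF eai] by (rule integrable_on_mult_right)
    show "(\<lambda>t. exp (- B t) * e t) integrable_on {a..x}" using ai_integrable[OF Iai] .
    show "exp (- P) * e t \<le> exp (- B t) * e t" if "t \<in> {a..x}" for t
      using that x B[of t] e0[of t] by (intro mult_right_mono) auto
  qed
  then have I2: "exp (-P) * integral {a..x} e \<le> I" by simp
  have ix: "0 \<le> integral {a..x} e"
    using e0 x by (intro ai_integral_nonneg[OF eai]) auto
  have "exp (- P) * (exp (- P) * (u a - v a) + exp (- P) * integral {a..x} e) \<le> u x - v x"
    unfolding eq
  proof (intro mult_mono)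
    have "exp (- P) * (u a - v a) \<le> u a - v a"
      using mult_right_mono[of "exp (-P)" 1 "u a - v a"] P0 ua by simp
    then show "exp (- P) * (u a - v a) + exp (- P) * integral {a..x} e \<le> u a - v a + I"
      using I2 by linarith
    show "exp (- P) \<le> exp (B x)" using B[OF x] by auto
  qed (use ua ix in auto)
  then show "exp (- (2 * integral {a..b} (\<lambda>x. \<bar>p x\<bar>))) * (u a - v a + integral {a..x} e) \<le> u x - v x"
    unfolding P_def[symmetric] E3 by (simp only: distrib_left mult.assoc)
qed

text \<open>Picard iteration with an exponential weight. Writing the angle as
  \<open>exp (2 * P x) * w x\<close> makes the integral operator a contraction with constant 1/2 on
  the whole interval at once, because \<open>\<bar>p\<bar>\<close> times the weight is half the
  derivative of the weight.\<close>

lemma angle_ode_exists: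
  fixes p :: "real \<Rightarrow> real"
  assumes ab: "a \<le> b" and p: "p absolutely_integrable_on {a..b}"
  obtains \<theta> where "\<theta> a = \<theta>0" "ac_primitive \<theta> (\<lambda>x. s + p x * (sin (\<theta> x))^2) a b"
proof -
  define P where "P x = integral {a..x} (\<lambda>t. \<bar>p t\<bar>)" for x
  have pa: "(\<lambda>t. \<bar>p t\<bar>) absolutely_integrable_on {a..b}" by (rule ai_abs[OF p])
  have P: "ac_primitive P (\<lambda>t. \<bar>p t\<bar>) a b"
    using ac_primitive_integral[OF pa, of 0] by (simp add: P_def[abs_def])
  note Pc = ac_primitive_cont[OF P]
  have PE: "ac_primitive (\<lambda>x. exp (2 * P x)) (\<lambda>x. exp (2 * P x) * (2 * \<bar>p x\<bar>)) a b"
    using ac_primitive_chain[OF ac_primitive_cmult[OF P, of 2], of exp exp] by (simp add: DERIV_exp continuous_on_exp)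
  have Ec: "continuous_on {a..b} (\<lambda>x. exp (c * P x))" for c
    by (intro continuous_on_exp continuous_on_mult continuous_on_const Pc)
  define N where "N w t = s + p t * (sin (exp (2 * P t) * w t))^2" for w t
  have Nai: "N w absolutely_integrable_on {a..b}" if "continuous_on {a..b} w" for w
    unfolding N_def[abs_def]
    by (intro set_integral_add(1) ai_mult_cont[OF p] continuous_on_power continuous_on_sin continuous_on_mult Ec that
        absolutely_integrable_on_const) simp
  define J where "J w x = exp (-2 * P x) * (\<theta>0 + integral {a..x} (N w))" for w x
  have Jc: "continuous_on {a..b} (J w)" if "continuous_on {a..b} w" for w
    unfolding J_def[abs_def]
    by (intro continuous_on_mult Ec ac_primitive_cont[OF ac_primitive_integral[OF Nai[OF that]]])
  \<comment> \<open>Bounded continuous functions live on the whole line; composing with this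
    retraction extends the operator beyond the interval.\<close>
  define cl where "cl x = max a (min b x)" for x
  have cl: "cl x \<in> {a..b}" "x \<in> {a..b} \<Longrightarrow> cl x = x" for x using ab by (auto simp: cl_def)
  have clc: "continuous_on UNIV cl" unfolding cl_def[abs_def] by (intro continuous_intros)
  have Jb: "(\<lambda>x. J w (cl x)) \<in> bcontfun" if "continuous_on {a..b} w" for w
  proof -
    have "continuous_on UNIV (\<lambda>x. J w (cl x))"
      by (rule continuous_on_compose2[OF Jc[OF that] clc]) (use cl in auto)
    moreover have "bounded (range (\<lambda>x. J w (cl x)))"
      by (rule bounded_subset[OF compact_imp_bounded[OF compact_continuous_image[OF Jc[OF that]]]]) (use cl in auto)
    ultimately show ?thesis by (simp add: bcontfun_def)
  qed
  define S where "S w = Bcontfun (\<lambda>x. J (apply_bcontfun w) (cl x))" for w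
  have S: "apply_bcontfun (S w) x = J (apply_bcontfun w) (cl x)" for w x
    unfolding S_def by (subst Bcontfun_inverse[OF Jb]) auto
  have contr: "\<bar>J (apply_bcontfun w) x - J (apply_bcontfun v) x\<bar> \<le> 1/2 * dist w v"
    if x: "x \<in> {a..b}" for w v :: "real \<Rightarrow>\<^sub>C real" and x
  proof -
    have ax: "a \<le> a" "x \<le> b" using x by auto
    note Nw = ai_subinterval[OF Nai[of "apply_bcontfun w", OF continuous_on_apply_bcontfun] ax]
    note Nv = ai_subinterval[OF Nai[of "apply_bcontfun v", OF continuous_on_apply_bcontfun] ax]
    have "\<bar>integral {a..x} (\<lambda>t. N w t - N v t)\<bar> \<le> integral {a..x} (\<lambda>t. dist w v / 2 * (exp (2 * P t) * (2 * \<bar>p t\<bar>)))"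
    proof (rule integral_abs_le)
      show "(\<lambda>t. N w t - N v t) absolutely_integrable_on {a..x}"
        by (rule set_integral_diff(1)[OF Nw Nv])
      show "(\<lambda>t. dist w v / 2 * (exp (2 * P t) * (2 * \<bar>p t\<bar>))) absolutely_integrable_on {a..x}"
        using ai_subinterval[OF ac_primitive_ai[OF PE] ax] by (rule set_integrable_mult_right)
      fix t assume t: "t \<in> {a..x}"
      have "N w t - N v t = p t * ((sin (exp (2 * P t) * w t))^2 - (sin (exp (2 * P t) * v t))^2)"
        by (simp add: N_def algebra_simps)
      also have "\<bar>\<dots>\<bar> \<le> \<bar>p t\<bar> * \<bar>exp (2 * P t) * w t - exp (2 * P t) * v t\<bar>"
        unfolding abs_mult by (intro mult_left_mono abs_sin_squared_diff_le) auto
      also have "\<dots> = \<bar>p t\<bar> * (exp (2 * P t) * \<bar>w t - v t\<bar>)"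
        by (simp add: abs_mult flip: right_diff_distrib)
      also have "\<dots> \<le> \<bar>p t\<bar> * (exp (2 * P t) * dist w v)"
        using dist_bounded[of w t v] by (intro mult_left_mono) (auto simp: dist_real_def)
      finally show "\<bar>N w t - N v t\<bar> \<le> dist w v / 2 * (exp (2 * P t) * (2 * \<bar>p t\<bar>))"
        by (simp add: algebra_simps)
    qed
    also have "\<dots> = dist w v / 2 * integral {a..x} (\<lambda>t. exp (2 * P t) * (2 * \<bar>p t\<bar>))"
      by (rule integral_mult_right)
    also have "integral {a..x} (\<lambda>t. exp (2 * P t) * (2 * \<bar>p t\<bar>)) = exp (2 * P x) - exp (2 * P a)"
      using ac_primitive_eq[OF PE x] by linarith
    also have "P a = 0" by (simp add: P_def)
    also have "exp (2 * 0 :: real) = 1" by simp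
    finally have *: "\<bar>integral {a..x} (N w) - integral {a..x} (N v)\<bar> \<le> dist w v / 2 * (exp (2 * P x) - 1)"
      using integral_diff[OF ai_integrable[OF Nw] ai_integrable[OF Nv]] by simp
    have "\<bar>J w x - J v x\<bar> = exp (-2 * P x) * \<bar>integral {a..x} (N w) - integral {a..x} (N v)\<bar>"
      by (simp add: J_def abs_mult flip: right_diff_distrib)
    also have "\<dots> \<le> exp (-2 * P x) * (dist w v / 2 * (exp (2 * P x) - 1))"
      using * by (intro mult_left_mono) auto
    also have "\<dots> = dist w v / 2 - dist w v / 2 * exp (-2 * P x)"
      by (simp add: algebra_simps exp_minus)
    also have "\<dots> \<le> dist w v / 2" by simp
    finally show ?thesis by simp
  qed
  have "\<exists>!w. S w = w"
  proof (rule banach_fix_type[of "1/2"])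
    show "\<forall>w v. dist (S w) (S v) \<le> 1/2 * dist w v"
    proof (intro allI dist_bound)
      fix w v x
      show "dist (apply_bcontfun (S w) x) (apply_bcontfun (S v) x) \<le> 1/2 * dist w v"
        unfolding S dist_real_def by (rule contr[OF cl(1)])
    qed
  qed auto
  then obtain w where w: "S w = w" by blast
  have wx: "w x = J w x" if "x \<in> {a..b}" for x
    using S[of w x] cl(2)[OF that] by (simp add: w)
  define \<theta> where "\<theta> x = exp (2 * P x) * w x" for x
  have \<theta>: "\<theta> x = \<theta>0 + integral {a..x} (N w)" if "x \<in> {a..b}" for x
    unfolding \<theta>_def wx[OF that] by (simp add: J_def exp_minus)
  show ?thesis
  proof (rule that[of \<theta>])
    show "\<theta> a = \<theta>0" using \<theta>[of a] ab by simp
    show "ac_primitive \<theta> (\<lambda>x. s + p x * (sin (\<theta> x))^2) a b"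
      by (rule ac_primitive_cong[OF ac_primitive_integral[OF Nai[of w, OF continuous_on_apply_bcontfun], of \<theta>0] ab])
        (use \<theta> in \<open>auto simp: N_def \<theta>_def\<close>)
  qed
qed

section \<open>The Pruefer transformation\<close>

lemma ac_primitive_spike:
  assumes u: "ac_primitive u g a b" and N: "negligible N" "\<And>x. x \<in> {a..b} - N \<Longrightarrow> h x = g x"
  shows "ac_primitive u h a b"
  unfolding ac_primitive_def
proof (intro conjI ballI)
  show "h absolutely_integrable_on {a..b}"
    by (rule absolutely_integrable_spike[OF ac_primitive_ai[OF u] N])
  fix x assume x: "x \<in> {a..b}"
  have "integral {a..x} h = integral {a..x} g"
    by (rule integral_spike[OF N(1)]) (use N(2) x in force)
  then show "u x = u a + integral {a..x} h" using ac_primitive_eq[OF u x] by linarith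
qed

lemma ac_primitive_has_derivative:
  assumes u: "ac_primitive u g a b" and g: "continuous_on {a..b} g" and x: "x \<in> {a..b}"
  shows "(u has_real_derivative g x) (at x within {a..b})"
proof -
  have "((\<lambda>x. integral {a..x} g) has_real_derivative g x) (at x within {a..b})"
    using integral_has_vector_derivative[OF g x] by (simp add: has_real_derivative_iff_has_vector_derivative)
  then have "((\<lambda>x. u a + integral {a..x} g) has_real_derivative g x) (at x within {a..b})"
    by (auto intro!: derivative_eq_intros)
  then show ?thesis
    by (rule has_field_derivative_transform_within[OF _ zero_less_one x]) (rule ac_primitive_eq[OF u, symmetric])
qed

lemma is_solution_ac_primitive:
  fixes y y' :: "real \<Rightarrow> real"
  assumes "is_solution q l y y'"
  shows "ac_primitive y y' 0 pi" and "ac_primitive y' (\<lambda>x. (q x - l) * y x) 0 pi"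
proof -
  from assms obtain y2 where d: "\<And>x. x \<in> {0..pi} \<Longrightarrow> (y has_vector_derivative y' x) (at x within {0..pi})"
    and y2: "y2 absolutely_integrable_on {0..pi}" "\<And>x. x \<in> {0..pi} \<Longrightarrow> y' x = y' 0 + integral {0..x} y2"
    and ae: "AE x in lebesgue. x \<in> {0<..<pi} \<longrightarrow> - y2 x + q x *\<^sub>R y x = l * y x"
    unfolding is_solution_def by blast
  have y'2: "ac_primitive y' y2 0 pi" using y2 unfolding ac_primitive_def by blast
  show "ac_primitive y y' 0 pi"
    using d by (intro ac_primitive_C1 ac_primitive_cont[OF y'2])
      (simp add: has_real_derivative_iff_has_vector_derivative)
  define N where "N = {x. \<not> (x \<in> {0<..<pi} \<longrightarrow> - y2 x + q x *\<^sub>R y x = l * y x)}"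
  have N: "negligible N"
    using ae unfolding completion.AE_iff_null_sets negligible_iff_null_sets N_def by simp
  \<comment> \<open>The equation is required only on the open interval, so the endpoints join the
    exceptional set.\<close>
  have "negligible (N \<union> {0, pi})" using N by (simp add: negligible_Un)
  then show "ac_primitive y' (\<lambda>x. (q x - l) * y x) 0 pi"
  proof (rule ac_primitive_spike[OF y'2])
    fix x assume "x \<in> {0..pi} - (N \<union> {0, pi})"
    then have "- y2 x + q x * y x = l * y x" by (auto simp: N_def)
    then show "(q x - l) * y x = y2 x" by (simp add: algebra_simps)
  qed
qed

definition pruefer_coeff :: "(real \<Rightarrow> real) \<Rightarrow> real \<Rightarrow> real \<Rightarrow> real \<Rightarrow> real" where
  "pruefer_coeff q s l x = (l - s^2 - q x) / s"

text \<open>The angle of a solution \<open>y\<close> in the scaling \<open>y = r sin \<theta>\<close>, \<open>y' = s r cos \<theta>\<close>. The scale \<open>s\<close> is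
  independent of \<open>l\<close>: eigenvalues are counted with \<open>s\<close> fixed, and only then is
  \<open>s^2 = l\<close> chosen for the asymptotics.\<close>

definition pruefer_angle :: "(real \<Rightarrow> real) \<Rightarrow> real \<Rightarrow> real \<Rightarrow> (real \<Rightarrow> real) \<Rightarrow> bool" where
  "pruefer_angle q s l \<theta> \<longleftrightarrow> ac_primitive \<theta> (\<lambda>x. s + pruefer_coeff q s l x * (sin (\<theta> x))^2) 0 pi"

text \<open>Logarithm of r / r(0): inserting the angle equation, with coefficient p, into (r sin
  \<theta>)' = s r cos \<theta> leaves r' / r = - p sin \<theta> cos \<theta>.\<close>

definition log_amplitude :: "(real \<Rightarrow> real) \<Rightarrow> real \<Rightarrow> real \<Rightarrow> (real \<Rightarrow> real) \<Rightarrow> real \<Rightarrow> real" where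
  "log_amplitude q s l \<theta> x = integral {0..x} (\<lambda>t. - (pruefer_coeff q s l t * (sin (\<theta> t) * cos (\<theta> t))))"

lemma pruefer_coeff_ai:
  assumes "q absolutely_integrable_on {0..pi}"
  shows "pruefer_coeff q s l absolutely_integrable_on {0..pi}"
  unfolding pruefer_coeff_def[abs_def]
  by (intro set_integrable_divide set_integral_diff(1) assms absolutely_integrable_on_const) auto

lemma pruefer_angle_exists:
  assumes "q absolutely_integrable_on {0..pi}"
  obtains \<theta> where "\<theta> 0 = \<theta>0" "pruefer_angle q s l \<theta>"
  using angle_ode_exists[OF _ pruefer_coeff_ai[OF assms], of \<theta>0 s s l] unfolding pruefer_angle_def
  by (metis pi_ge_zero)

lemma pruefer_sin_cos:
  assumes "pruefer_angle q s l \<theta>"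
  shows "ac_primitive (\<lambda>x. sin (\<theta> x)) (\<lambda>x. cos (\<theta> x) * (s + pruefer_coeff q s l x * (sin (\<theta> x))^2)) 0 pi"
    and "ac_primitive (\<lambda>x. cos (\<theta> x)) (\<lambda>x. - sin (\<theta> x) * (s + pruefer_coeff q s l x * (sin (\<theta> x))^2)) 0 pi"
proof -
  note th = assms[unfolded pruefer_angle_def]
  show "ac_primitive (\<lambda>x. sin (\<theta> x)) (\<lambda>x. cos (\<theta> x) * (s + pruefer_coeff q s l x * (sin (\<theta> x))^2)) 0 pi"
    by (rule ac_primitive_chain[OF th]) (auto intro: DERIV_sin continuous_intros)
  show "ac_primitive (\<lambda>x. cos (\<theta> x)) (\<lambda>x. - sin (\<theta> x) * (s + pruefer_coeff q s l x * (sin (\<theta> x))^2)) 0 pi"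
    by (rule ac_primitive_chain[OF th, where F' = "\<lambda>x. - sin x"]) (auto intro!: DERIV_cos continuous_on_minus continuous_on_sin continuous_on_id)
qed

lemma log_amplitude_integrand_ai:
  assumes q: "q absolutely_integrable_on {0..pi}" and th: "pruefer_angle q s l \<theta>"
  shows "(\<lambda>t. - (pruefer_coeff q s l t * (sin (\<theta> t) * cos (\<theta> t)))) absolutely_integrable_on {0..pi}"
proof -
  have "(\<lambda>t. pruefer_coeff q s l t * (sin (\<theta> t) * cos (\<theta> t))) absolutely_integrable_on {0..pi}"
    by (intro ai_mult_cont pruefer_coeff_ai q continuous_on_mult ac_primitive_cont[OF pruefer_sin_cos(1)[OF th]]
        ac_primitive_cont[OF pruefer_sin_cos(2)[OF th]])
  from set_integrable_mult_right[of "-1", OF this] show ?thesis by simp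
qed

lemma log_amplitude_ac_primitive:
  assumes q: "q absolutely_integrable_on {0..pi}" and th: "pruefer_angle q s l \<theta>"
  shows "ac_primitive (log_amplitude q s l \<theta>) (\<lambda>t. - (pruefer_coeff q s l t * (sin (\<theta> t) * cos (\<theta> t)))) 0 pi"
  using ac_primitive_integral[OF log_amplitude_integrand_ai[OF assms], of 0]
  unfolding log_amplitude_def[abs_def] by simp

text \<open>The angle is not read off from the solution but given by its own equation.
  \<open>W\<close> measures how far (y, y' / s) is from the direction (sin \<theta>, cos \<theta>);
  it solves a homogeneous linear equation with initial value 0 and hence vanishes.\<close>

lemma pruefer_representation:
  fixes y y' :: "real \<Rightarrow> real"
  assumes q: "q absolutely_integrable_on {0..pi}" and s: "s > 0" and th: "pruefer_angle q s l \<theta>"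
    and y: "is_solution q l y y'" and y0: "y 0 = m * sin (\<theta> 0)" "y' 0 = s * m * cos (\<theta> 0)"
    and x: "x \<in> {0..pi}"
  shows "y x = m * exp (log_amplitude q s l \<theta> x) * sin (\<theta> x)"
    and "y' x = s * m * exp (log_amplitude q s l \<theta> x) * cos (\<theta> x)"
proof -
  define p where "p = pruefer_coeff q s l"
  let ?t = "\<lambda>x. s + p x * (sin (\<theta> x))^2"
  have pq: "(q x - l) = - s * (p x + s)" for x
    using s by (simp add: p_def pruefer_coeff_def field_simps power2_eq_square)
  note yp = is_solution_ac_primitive[OF y] and sc = pruefer_sin_cos[OF th, folded p_def]
  have p: "p absolutely_integrable_on {0..pi}" using pruefer_coeff_ai[OF q] by (simp add: p_def)
  define W where "W x = s * (y x * cos (\<theta> x)) - y' x * sin (\<theta> x)" for x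
  define w where "w x = p x * (sin (\<theta> x) * cos (\<theta> x))" for x
  have w: "w absolutely_integrable_on {0..pi}" unfolding w_def[abs_def]
    by (intro ai_mult_cont p continuous_on_mult ac_primitive_cont[OF sc(1)] ac_primitive_cont[OF sc(2)])
  have "ac_primitive W (\<lambda>x. s * (y' x * cos (\<theta> x) + y x * (- sin (\<theta> x) * ?t x))
      - ((q x - l) * y x * sin (\<theta> x) + y' x * (cos (\<theta> x) * ?t x))) 0 pi"
    unfolding W_def[abs_def]
    by (intro ac_primitive_minus ac_primitive_cmult ac_primitive_mult yp sc)
  then have W: "ac_primitive W (\<lambda>x. w x * W x + 0) 0 pi"
  proof (rule ac_primitive_cong)
    fix x assume "x \<in> {0..pi}"
    show "w x * W x + 0 = s * (y' x * cos (\<theta> x) + y x * (- sin (\<theta> x) * ?t x))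
      - ((q x - l) * y x * sin (\<theta> x) + y' x * (cos (\<theta> x) * ?t x))"
      unfolding pq w_def W_def using sin_cos_squared_add3[of "\<theta> x"] by algebra
  qed auto
  have W0: "W t = 0" if "t \<in> {0..pi}" for t
    using linear_ode_ac_solution[OF W w that] by (simp add: W_def y0)
  \<comment> \<open>Projection onto the direction (sin \<theta>, cos \<theta>): the signed
    amplitude, well defined even where y vanishes.\<close>
  define M where "M x = y x * sin (\<theta> x) + (1/s) * (y' x * cos (\<theta> x))" for x
  have yM: "y t = M t * sin (\<theta> t)" "y' t = s * M t * cos (\<theta> t)" if "t \<in> {0..pi}" for t
  proof -
    have "s * (M t * sin (\<theta> t)) = s * (y t * (sin (\<theta> t))^2) + y' t * sin (\<theta> t) * cos (\<theta> t)"
      using s by (simp add: M_def field_simps power2_eq_square)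
    also have "y' t * sin (\<theta> t) = s * (y t * cos (\<theta> t))" using W0[OF that] by (simp add: W_def)
    also have "s * (y t * (sin (\<theta> t))^2) + s * (y t * cos (\<theta> t)) * cos (\<theta> t) = s * y t * ((sin (\<theta> t))^2 + (cos (\<theta> t))^2)"
      by algebra
    finally show "y t = M t * sin (\<theta> t)" using s by simp
    have "s * M t * cos (\<theta> t) = s * (y t * cos (\<theta> t)) * sin (\<theta> t) + y' t * (cos (\<theta> t))^2"
      using s by (simp add: M_def field_simps power2_eq_square)
    also have "s * (y t * cos (\<theta> t)) = y' t * sin (\<theta> t)" using W0[OF that] by (simp add: W_def)
    also have "y' t * sin (\<theta> t) * sin (\<theta> t) + y' t * (cos (\<theta> t))^2 = y' t * ((sin (\<theta> t))^2 + (cos (\<theta> t))^2)"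
      by algebra
    finally show "y' t = s * M t * cos (\<theta> t)" by simp
  qed
  have "ac_primitive M (\<lambda>x. (y' x * sin (\<theta> x) + y x * (cos (\<theta> x) * ?t x))
      + (1/s) * ((q x - l) * y x * cos (\<theta> x) + y' x * (- sin (\<theta> x) * ?t x))) 0 pi"
    unfolding M_def[abs_def]
    by (intro ac_primitive_add ac_primitive_cmult ac_primitive_mult yp sc)
  then have M: "ac_primitive M (\<lambda>x. - w x * M x + 0) 0 pi"
  proof (rule ac_primitive_cong)
    fix x assume x: "x \<in> {0..pi}"
    show "- w x * M x + 0 = (y' x * sin (\<theta> x) + y x * (cos (\<theta> x) * ?t x))
      + (1/s) * ((q x - l) * y x * cos (\<theta> x) + y' x * (- sin (\<theta> x) * ?t x))"
      unfolding pq w_def yM[OF x] using s by (simp add: field_simps power2_eq_square)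
  qed auto
  have "M x = exp (integral {0..x} (\<lambda>x. - w x)) * M 0"
    using linear_ode_ac_solution[OF M _ x] set_integrable_mult_right[of "-1", OF w] by simp
  also have "M 0 = m"
  proof -
    have "M 0 = m * (sin (\<theta> 0))^2 + m * (cos (\<theta> 0))^2" using s by (simp add: M_def y0 power2_eq_square)
    then show ?thesis by (simp flip: distrib_left)
  qed
  finally have Mx: "M x = m * exp (log_amplitude q s l \<theta> x)"
    unfolding log_amplitude_def w_def p_def by simp
  show "y x = m * exp (log_amplitude q s l \<theta> x) * sin (\<theta> x)"
    and "y' x = s * m * exp (log_amplitude q s l \<theta> x) * cos (\<theta> x)"
    using yM[OF x] Mx by simp_all
qed

text \<open>Existence half of the transformation, which supplies the eigenfunctions; complex valued
  because \<open>is_eigenvalue\<close> speaks of complex solutions.\<close>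

lemma pruefer_solution:
  assumes q: "q absolutely_integrable_on {0..pi}" and s: "s > 0" and th: "pruefer_angle q s l \<theta>"
  defines "y \<equiv> \<lambda>x. exp (log_amplitude q s l \<theta> x) * sin (\<theta> x)"
    and "y' \<equiv> \<lambda>x. s * (exp (log_amplitude q s l \<theta> x) * cos (\<theta> x))"
  shows "is_solution q (complex_of_real l) (\<lambda>x. complex_of_real (y x)) (\<lambda>x. complex_of_real (y' x))"
proof -
  define p where "p = pruefer_coeff q s l"
  have pq: "(q x - l) = - s * (p x + s)" for x
    using s by (simp add: p_def pruefer_coeff_def field_simps power2_eq_square)
  define R where "R = log_amplitude q s l \<theta>"
  have R: "ac_primitive R (\<lambda>t. - (p t * (sin (\<theta> t) * cos (\<theta> t)))) 0 pi"
    unfolding R_def p_def by (rule log_amplitude_ac_primitive[OF q th])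
  note sc = pruefer_sin_cos[OF th, folded p_def]
  have E: "ac_primitive (\<lambda>x. exp (R x)) (\<lambda>x. exp (R x) * - (p x * (sin (\<theta> x) * cos (\<theta> x)))) 0 pi"
    by (rule ac_primitive_chain[OF R]) (auto simp: DERIV_exp intro!: continuous_intros)
  have y: "ac_primitive y y' 0 pi"
    by (rule ac_primitive_cong[OF ac_primitive_mult[OF E sc(1)]])
      (auto simp: y_def y'_def R_def[symmetric] power2_eq_square algebra_simps)
  have y': "ac_primitive y' (\<lambda>x. (q x - l) * y x) 0 pi"
  proof (rule ac_primitive_cong[OF ac_primitive_cmult[OF ac_primitive_mult[OF E sc(2)], of s]])
    fix x assume "x \<in> {0..pi}"
    show "(q x - l) * y x = s * (exp (R x) * - (p x * (sin (\<theta> x) * cos (\<theta> x))) * cos (\<theta> x)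
      + exp (R x) * (- sin (\<theta> x) * (s + p x * (sin (\<theta> x))^2)))"
      unfolding y_def R_def[symmetric] pq using sin_cos_squared_add3[of "\<theta> x"] by algebra
  qed (auto simp: y'_def R_def[symmetric])
  define g where "g x = complex_of_real ((q x - l) * y x)" for x
  have gai: "g absolutely_integrable_on {0..pi}"
    using absolutely_integrable_linear[OF ac_primitive_ai[OF y'] bounded_linear_of_real[where 'a = complex]]
    by (simp add: g_def[abs_def] o_def)
  show ?thesis unfolding is_solution_def
  proof (intro conjI ballI exI[of _ g] gai)
    show "AE x in lebesgue. x \<in> {0<..<pi} \<longrightarrow> - g x + q x *\<^sub>R complex_of_real (y x) = complex_of_real l * complex_of_real (y x)"
      by (auto simp: g_def scaleR_conv_of_real algebra_simps)
    fix x assume x: "x \<in> {0..pi}"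
    have "(y has_vector_derivative y' x) (at x within {0..pi})"
      using ac_primitive_has_derivative[OF y ac_primitive_cont[OF y'] x]
      by (simp add: has_real_derivative_iff_has_vector_derivative)
    then show "((\<lambda>x. complex_of_real (y x)) has_vector_derivative complex_of_real (y' x)) (at x within {0..pi})"
      by (rule bounded_linear.has_vector_derivative[OF bounded_linear_of_real])
    have "integral {0..x} g = complex_of_real (integral {0..x} (\<lambda>x. (q x - l) * y x))"
      unfolding g_def using integral_linear[OF ai_integrable[OF ai_subinterval[OF ac_primitive_ai[OF y'], of 0 x]]
          bounded_linear_of_real[where 'a = complex]] x by (simp add: o_def)
    then show "complex_of_real (y' x) = complex_of_real (y' 0) + integral {0..x} g"
      using ac_primitive_eq[OF y' x] by (simp flip: of_real_add)
  qed
qed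

section \<open>Boundary angles\<close>

definition rat_value :: "real \<Rightarrow> real \<Rightarrow> (real \<times> real) list \<Rightarrow> real \<Rightarrow> real" where
  "rat_value h0 h ps l = h0 * l + h + (\<Sum>k<length ps. snd (ps ! k) / (fst (ps ! k) - l))"

definition poles_upto :: "(real \<times> real) list \<Rightarrow> real \<Rightarrow> nat set" where
  "poles_upto ps l = {k. k < length ps \<and> fst (ps ! k) \<le> l}"

text \<open>The lift of the angle \<open>\<alpha>\<close> with \<open>cot \<alpha> = - f / s\<close> that increases through every pole and
  starts in \<open>(0, \<pi>)\<close> at \<open>- \<infinity>\<close>; a Dirichlet condition has \<open>\<alpha> = 0\<close>.\<close>

fun bc_angle :: "real \<Rightarrow> rfun \<Rightarrow> real \<Rightarrow> real" where
  "bc_angle s Infty l = 0"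
| "bc_angle s (Rat h0 h ps) l = pi * real (card (poles_upto ps l)) +
     (if l \<in> fst ` set ps then 0 else pi / 2 + arctan (rat_value h0 h ps l / s))"

lemma poles_upto_finite [simp]: "finite (poles_upto ps l)"
  by (simp add: poles_upto_def)

lemma pole_iff: "l \<in> fst ` set ps \<longleftrightarrow> (\<exists>k<length ps. fst (ps ! k) = l)"
proof
  assume "l \<in> fst ` set ps"
  then obtain x where "x \<in> set ps" "fst x = l" by blast
  then show "\<exists>k<length ps. fst (ps ! k) = l" by (metis in_set_conv_nth)
next
  assume "\<exists>k<length ps. fst (ps ! k) = l"
  then show "l \<in> fst ` set ps" by (metis nth_mem image_eqI)
qed

lemma in_R_distinct:
  assumes "in_R (Rat h0 h ps)" "j < length ps" "k < length ps" "fst (ps ! j) = fst (ps ! k)"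
  shows "j = k"
proof -
  have s: "sorted_wrt (<) (map fst ps)" using assms(1) by simp
  show ?thesis
  proof (cases j k rule: linorder_cases)
    case less
    with sorted_wrt_nth_less[OF s, of j k] assms show ?thesis by simp
  next
    case greater
    with sorted_wrt_nth_less[OF s, of k j] assms show ?thesis by simp
  qed
qed

lemma in_R_pos: "in_R (Rat h0 h ps) \<Longrightarrow> k < length ps \<Longrightarrow> 0 < snd (ps ! k)"
  by (auto dest!: nth_mem)

lemma lead_pos: "0 < lead h0"
  by (simp add: lead_def)

lemma poly_down_eq_0_iff: "poly (down (Rat h0 h ps)) l = 0 \<longleftrightarrow> l \<in> fst ` set ps"
  using lead_pos[of h0] by (auto simp: poly_prod pole_iff)

text \<open>At a pole only the summand omitting that pole's factor survives. Hence \<open>up\<close>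
  and \<open>down\<close> have no common zero and define a direction.\<close>

lemma poly_up_at_pole:
  assumes "in_R (Rat h0 h ps)" "l \<in> fst ` set ps"
  shows "poly (up (Rat h0 h ps)) l \<noteq> 0"
proof -
  obtain j where j: "j < length ps" "fst (ps ! j) = l" using assms(2) by (auto simp: pole_iff)
  let ?Q = "\<lambda>k. \<Prod>i\<in>{..<length ps} - {k}. fst (ps ! i) - l"
  have "(\<Sum>k<length ps. snd (ps ! k) * ?Q k) = snd (ps ! j) * ?Q j + (\<Sum>k\<in>{..<length ps} - {j}. snd (ps ! k) * ?Q k)"
    using j by (subst sum.remove[of _ j]) auto
  also have "(\<Sum>k\<in>{..<length ps} - {j}. snd (ps ! k) * ?Q k) = 0"
    using j by (intro sum.neutral ballI) auto
  finally have "(\<Sum>k<length ps. snd (ps ! k) * ?Q k) = snd (ps ! j) * ?Q j" by simp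
  moreover have "(\<Prod>k<length ps. fst (ps ! k) - l) = 0" using j by (auto intro!: prod_zero)
  moreover have "poly (up (Rat h0 h ps)) l = lead h0 * ((h + l * h0) * (\<Prod>k<length ps. fst (ps ! k) - l)
      + (\<Sum>k<length ps. snd (ps ! k) * ?Q k))"
    by (simp add: poly_prod poly_sum algebra_simps)
  ultimately have "poly (up (Rat h0 h ps)) l = lead h0 * (snd (ps ! j) * ?Q j)"
    by (simp only: mult_zero_right add_0_left)
  moreover have "?Q j \<noteq> 0" using in_R_distinct[OF assms(1) _ j(1)] j(2) by auto
  ultimately show ?thesis using lead_pos[of h0] in_R_pos[OF assms(1) j(1)] by simp
qed

lemma bc_angle_nonneg: "0 \<le> bc_angle s f l"
proof (cases f)
  case (Rat h0 h ps)
  have "0 \<le> pi / 2 + arctan x" for x using arctan_lbound[of x] by linarith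
  then show ?thesis unfolding Rat by simp
qed simp

lemma sin_cos_shift:
  "sin (pi * real n + x) = (-1) ^ n * sin x" "cos (pi * real n + x) = (-1) ^ n * cos x"
  by (simp_all add: sin_add cos_add mult.commute[of pi])

text \<open>Polar form of the initial data (down, - up) of \<phi> in scale \<open>s\<close>. The
  factor \<rho> may have either sign; only its square enters the norming constants.\<close>

lemma bc_angle_polar:
  assumes R: "in_R f" and s: "s > 0"
  obtains \<rho> where "\<rho> \<noteq> 0" "poly (down f) l = \<rho> * sin (bc_angle s f l)"
    "poly (up f) l = - s * \<rho> * cos (bc_angle s f l)"
proof (cases f)
  case Infty
  then show ?thesis using that[of "1 / s"] s by simp
next
  case (Rat h0 h ps)
  show ?thesis
  proof (cases "l \<in> fst ` set ps")
    case True
    let ?n = "card (poles_upto ps l)"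
    have a: "sin (bc_angle s f l) = 0" "cos (bc_angle s f l) = (-1) ^ ?n"
      using True sin_cos_shift[of ?n 0] by (simp_all add: Rat)
    have d: "poly (down f) l = 0" using True unfolding Rat poly_down_eq_0_iff .
    have u: "poly (up f) l \<noteq> 0" using True R unfolding Rat by (intro poly_up_at_pole)
    show ?thesis
      by (rule that[of "- poly (up f) l / (s * (-1) ^ ?n)"]) (use s u d a in \<open>auto simp: field_simps\<close>)
  next
    case False
    let ?n = "card (poles_upto ps l)" and ?t = "arctan (rat_value h0 h ps l / s)"
    define D where "D = poly (down f) l"
    have D: "D \<noteq> 0" using False unfolding Rat poly_down_eq_0_iff D_def .
    have "bc_angle s f l = pi * real ?n + (pi / 2 + ?t)" using False by (simp add: Rat)
    then have a: "sin (bc_angle s f l) = (-1) ^ ?n * cos ?t" "cos (bc_angle s f l) = - ((-1) ^ ?n * sin ?t)"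
      by (simp_all only: sin_cos_shift) (simp_all add: sin_add cos_add)
    have c: "cos ?t > 0" using arctan_bounded by (intro cos_gt_zero_pi) auto
    have up: "poly (up f) l = rat_value h0 h ps l * D"
      using poly_up[OF False] by (simp add: Rat D_def rat_value_def)
    have "rat_value h0 h ps l / s = sin ?t / cos ?t"
      using tan_arctan[of "rat_value h0 h ps l / s"] unfolding tan_def by simp
    then have v: "rat_value h0 h ps l = s * (sin ?t / cos ?t)" using s by (simp add: field_simps)
    show ?thesis
    proof (rule that[of "D / ((-1) ^ ?n * cos ?t)"])
      show "D / ((-1) ^ ?n * cos ?t) \<noteq> 0" using D c by simp
      show "poly (down f) l = D / ((-1) ^ ?n * cos ?t) * sin (bc_angle s f l)"
        using c by (simp add: D_def[symmetric] a)
      show "poly (up f) l = - s * (D / ((-1) ^ ?n * cos ?t)) * cos (bc_angle s f l)"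
        unfolding up a using c by (subst v) simp
    qed
  qed
qed

text \<open>Equal sets \<open>poles_upto\<close> exclude poles between the two points, so every
  denominator keeps its sign and every summand increases.\<close>

lemma rat_value_mono:
  assumes R: "in_R (Rat h0 h ps)" and "l1 \<le> l2" and same: "poles_upto ps l1 = poles_upto ps l2"
    and np: "l1 \<notin> fst ` set ps" "l2 \<notin> fst ` set ps"
  shows "rat_value h0 h ps l1 \<le> rat_value h0 h ps l2"
  unfolding rat_value_def
proof (intro add_mono sum_mono)
  show "h0 * l1 \<le> h0 * l2" using R assms(2) by (intro mult_left_mono) auto
  fix k assume "k \<in> {..<length ps}"
  then have k: "k < length ps" by simp
  let ?h = "fst (ps ! k)"
  have ne: "?h \<noteq> l1" "?h \<noteq> l2" using np k by (auto simp: pole_iff)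
  have iff: "?h \<le> l1 \<longleftrightarrow> ?h \<le> l2" using same k by (auto simp: poles_upto_def)
  have "0 < (?h - l1) * (?h - l2)"
    using ne iff by (cases "?h \<le> l1") (auto intro: mult_pos_pos mult_neg_neg)
  then have "1 / (?h - l1) \<le> 1 / (?h - l2)" using assms(2)
    by (simp add: divide_simps) (auto simp: zero_less_mult_iff split: if_splits)
  from mult_left_mono[OF this, of "snd (ps ! k)"] in_R_pos[OF R k]
  show "snd (ps ! k) / (?h - l1) \<le> snd (ps ! k) / (?h - l2)" by simp
qed auto

text \<open>Between poles this is the monotonicity of the rational function. If a pole is passed,
  the count rises by at least one, and the gain of pi dominates the remaining part, which stays
  between 0 and pi.\<close>

lemma bc_angle_mono:
  assumes R: "in_R f" and s: "s > 0" and l: "l1 \<le> l2"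
  shows "bc_angle s f l1 \<le> bc_angle s f l2"
proof (cases f)
  case (Rat h0 h ps)
  have sub: "poles_upto ps l1 \<subseteq> poles_upto ps l2" using l by (auto simp: poles_upto_def)
  show ?thesis
  proof (cases "poles_upto ps l1 = poles_upto ps l2")
    case True
    \<comment> \<open>A pole at \<open>l2\<close> would already be counted at \<open>l1\<close>,
      which forces \<open>l1 = l2\<close>.\<close>
    consider "l1 = l2" | "l1 \<in> fst ` set ps" | "l1 \<notin> fst ` set ps" "l2 \<notin> fst ` set ps"
    proof (cases "l2 \<in> fst ` set ps")
      case l2: True
      then obtain k where "k < length ps" "fst (ps ! k) = l2" by (auto simp: pole_iff)
      then have "k \<in> poles_upto ps l1" unfolding True by (simp add: poles_upto_def)
      then show thesis using that(1) \<open>fst (ps ! k) = l2\<close> l by (simp add: poles_upto_def)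
    qed (use that in auto)
    then show ?thesis
    proof cases
      case 2
      have "0 \<le> pi / 2 + arctan x" for x using arctan_lbound[of x] by linarith
      with 2 True show ?thesis by (simp add: Rat)
    next
      case 3
      have "arctan (rat_value h0 h ps l1 / s) \<le> arctan (rat_value h0 h ps l2 / s)"
        using rat_value_mono[OF _ l True 3] R s by (intro arctan_monotone' divide_right_mono) (auto simp: Rat)
      with 3 True show ?thesis by (simp add: Rat)
    qed simp
  next
    case False
    then have "card (poles_upto ps l1) < card (poles_upto ps l2)"
      using sub by (intro psubset_card_mono) auto
    then have "real (card (poles_upto ps l1)) + 1 \<le> real (card (poles_upto ps l2))" by linarith
    from mult_left_mono[OF this, of pi] have c: "pi * real (card (poles_upto ps l1)) + pi \<le> pi * real (card (poles_upto ps l2))"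
      by (simp add: algebra_simps)
    have "(if l1 \<in> fst ` set ps then 0 else pi / 2 + arctan (rat_value h0 h ps l1 / s)) \<le> pi"
      using arctan_ubound[of "rat_value h0 h ps l1 / s"] by auto
    moreover have "0 \<le> (if l2 \<in> fst ` set ps then 0 else pi / 2 + arctan (rat_value h0 h ps l2 / s))"
      using arctan_lbound[of "rat_value h0 h ps l2 / s"] by auto
    ultimately show ?thesis unfolding Rat bc_angle.simps using c by linarith
  qed
qed simp

lemma bc_angle_lt_pi:
  obtains L where "bc_angle s f L < pi"
proof (cases f)
  case Infty
  then show ?thesis using that[of 0] by simp
next
  case (Rat h0 h ps)
  obtain L where L: "\<And>h. h \<in> fst ` set ps \<Longrightarrow> L < h"
  proof (cases "ps = []")
    case False
    then show ?thesis using that[of "Min (fst ` set ps) - 1"]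
      by (smt (verit) List.finite_set Min_le finite_imageI)
  qed (use that in auto)
  have "poles_upto ps L = {}"
    using L by (fastforce simp: poles_upto_def pole_iff not_le[symmetric])
  moreover have "L \<notin> fst ` set ps" using L by blast
  ultimately show ?thesis using that[of L] arctan_ubound[of "rat_value h0 h ps L / s"]
    by (simp add: Rat)
qed

lemma eventually_same_side:
  assumes "c \<noteq> l0" shows "eventually (\<lambda>l. c \<noteq> l \<and> (c \<le> l \<longleftrightarrow> c \<le> l0)) (nhds (l0::real))"
proof (cases "c < l0")
  case True
  then have "eventually (\<lambda>l. l \<in> {c<..}) (nhds l0)" by (intro eventually_nhds_in_open) auto
  then show ?thesis by eventually_elim (use True in auto)
next
  case False
  with assms have "l0 < c" by simp
  then have "eventually (\<lambda>l. l \<in> {..<c}) (nhds l0)" by (intro eventually_nhds_in_open) auto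
  then show ?thesis by eventually_elim (use \<open>l0 < c\<close> in auto)
qed

text \<open>At a pole the two branches are joined through arctan (1 / x): to the left the value is
  large and positive with one pole less counted, to the right large and negative. Both give
  \<open>?G\<close>, which is regular because \<open>up\<close> does not vanish at the pole.\<close>

lemma isCont_bc_angle:
  assumes R: "in_R f" and s: "s > 0"
  shows "isCont (bc_angle s f) l0"
proof (cases f)
  case (Rat h0 h ps)
  let ?v = "rat_value h0 h ps"
  show ?thesis
  proof (cases "l0 \<in> fst ` set ps")
    case False
    have "eventually (\<lambda>l. \<forall>k\<in>{..<length ps}. fst (ps ! k) \<noteq> l \<and> (fst (ps ! k) \<le> l \<longleftrightarrow> fst (ps ! k) \<le> l0)) (nhds l0)"
      by (intro eventually_ball_finite ballI eventually_same_side) (use False in \<open>auto simp: pole_iff\<close>)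
    then have ev: "eventually (\<lambda>l. bc_angle s f l = pi * real (card (poles_upto ps l0)) + (pi / 2 + arctan (?v l / s))) (nhds l0)"
    proof eventually_elim
      case (elim l)
      then have "poles_upto ps l = poles_upto ps l0" by (auto simp: poles_upto_def)
      moreover have "l \<notin> fst ` set ps" using elim by (auto simp: pole_iff)
      ultimately show ?case by (simp add: Rat)
    qed
    have "isCont (\<lambda>l. pi * real (card (poles_upto ps l0)) + (pi / 2 + arctan (?v l / s))) l0"
      unfolding rat_value_def using False s by (intro continuous_intros) (auto simp: pole_iff)
    then show ?thesis by (rule iffD2[OF isCont_cong[OF ev]])
  next
    case True
    obtain j where j: "j < length ps" "fst (ps ! j) = l0" using True by (auto simp: pole_iff)
    define g where "g l = h0 * l + h + (\<Sum>k\<in>{..<length ps} - {j}. snd (ps ! k) / (fst (ps ! k) - l))" for l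
    have vg: "?v l = g l + snd (ps ! j) / (l0 - l)" for l
      unfolding rat_value_def g_def using j by (subst sum.remove[of _ j]) auto
    have others: "fst (ps ! k) \<noteq> l0" if "k \<in> {..<length ps} - {j}" for k
      using in_R_distinct[of h0 h ps k j] R j that by (auto simp: Rat)
    have "isCont g l0"
      unfolding g_def[abs_def] using others by (intro continuous_intros) auto
    then have "isCont (\<lambda>l. \<bar>g l\<bar>) l0" by (rule continuous_rabs)
    then have "(\<lambda>l. \<bar>g l\<bar>) \<midarrow>l0\<rightarrow> \<bar>g l0\<bar>" unfolding isCont_def .
    then have "eventually (\<lambda>l. \<bar>g l\<bar> < \<bar>g l0\<bar> + 1) (at l0)" by (rule order_tendstoD) simp
    then have evg: "eventually (\<lambda>l. \<bar>g l\<bar> < \<bar>g l0\<bar> + 1) (nhds l0)"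
      by (simp add: eventually_at_filter[symmetric] eventually_nhds_conv_at)
    \<comment> \<open>Within this radius the singular summand exceeds the bound for the regular part
      \<open>g\<close> and so decides the sign of the value.\<close>
    define r where "r = snd (ps ! j) / (\<bar>g l0\<bar> + 1)"
    have d: "snd (ps ! j) > 0" using in_R_pos[of h0 h ps j] R j by (simp add: Rat)
    have M: "\<bar>g l0\<bar> + 1 > 0" by (smt (verit))
    have r: "r > 0" using d M unfolding r_def by (rule divide_pos_pos)
    have evr: "eventually (\<lambda>l. l \<in> {l0 - r<..<l0 + r}) (nhds l0)"
      using r by (intro eventually_nhds_in_open) auto
    have evk: "eventually (\<lambda>l. \<forall>k\<in>{..<length ps} - {j}. fst (ps ! k) \<noteq> l \<and> (fst (ps ! k) \<le> l \<longleftrightarrow> fst (ps ! k) \<le> l0)) (nhds l0)"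
      by (intro eventually_ball_finite ballI eventually_same_side others) auto
    define N where "N = card (poles_upto ps l0)"
    let ?G = "\<lambda>l. pi * real N - arctan (s * (poly (down f) l / poly (up f) l))"
    have "eventually (\<lambda>l. bc_angle s f l = ?G l) (nhds l0)"
      using evg evr evk
    proof eventually_elim
      case (elim l)
      show ?case
      proof (cases "l = l0")
        case True
        have "poly (down f) l0 = 0" using j(1) j(2) unfolding Rat poly_down_eq_0_iff by (auto simp: pole_iff)
        then show ?thesis using True \<open>l0 \<in> fst ` set ps\<close> by (simp add: Rat N_def del: down.simps)
      next
        case ne: False
        have np: "l \<notin> fst ` set ps" 
        proof
          assume "l \<in> fst ` set ps"
          then obtain k where k: "k < length ps" "fst (ps ! k) = l" by (auto simp: pole_iff)
          with ne j have "k \<in> {..<length ps} - {j}" by auto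
          with elim(3) k show False by blast
        qed
        have dn: "poly (down f) l \<noteq> 0" using np unfolding Rat poly_down_eq_0_iff .
        have up: "poly (up f) l = ?v l * poly (down f) l"
          using poly_up[OF np] by (simp add: Rat rat_value_def)
        have big: "\<bar>g l0\<bar> + 1 < snd (ps ! j) / \<bar>l0 - l\<bar>"
        proof -
          have "\<bar>l0 - l\<bar> < r" using elim(2) by auto
          then have "\<bar>l0 - l\<bar> * (\<bar>g l0\<bar> + 1) < snd (ps ! j)"
            using M unfolding r_def by (simp add: pos_less_divide_eq)
          then show ?thesis using ne by (simp add: pos_less_divide_eq mult.commute)
        qed
        have quot: "s * (poly (down f) l / poly (up f) l) = 1 / (?v l / s)"
          using dn by (simp add: up)
        show ?thesis
        proof (cases "l < l0")
          case True
          have "poles_upto ps l = poles_upto ps l0 - {j}"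
            using elim(3) j True by (auto simp: poles_upto_def)
          moreover have "j \<in> poles_upto ps l0" using j by (simp add: poles_upto_def)
          ultimately have "card (poles_upto ps l) = N - 1" "N \<ge> 1"
            unfolding N_def by (auto simp: Suc_le_eq card_gt_0_iff)
          then have c: "real (card (poles_upto ps l)) = real N - 1" by simp
          have "?v l > 0" using big True elim(1) unfolding vg by (smt (verit))
          then have "arctan (1 / (?v l / s)) = pi / 2 - arctan (?v l / s)"
            using s arctan_inverse[of "?v l / s"] by (simp add: sgn_if)
          then show ?thesis unfolding quot using np by (simp add: Rat c algebra_simps)
        next
          case False
          then have gt: "l0 < l" using ne by simp
          have c: "poles_upto ps l = poles_upto ps l0"
          proof (rule set_eqI)
            fix k
            show "k \<in> poles_upto ps l \<longleftrightarrow> k \<in> poles_upto ps l0"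
              using elim(3) j gt by (cases "k = j") (auto simp: poles_upto_def)
          qed
          have "snd (ps ! j) / (l0 - l) = - (snd (ps ! j) / \<bar>l0 - l\<bar>)"
            using gt by (simp add: abs_if field_simps)
          then have "?v l < 0" using big elim(1) unfolding vg by (smt (verit))
          then have n: "?v l / s < 0" using s by (rule divide_neg_pos)
          have "arctan (1 / (?v l / s)) = sgn (?v l / s) * pi / 2 - arctan (?v l / s)"
            by (rule Transcendental.arctan_inverse) (use n in linarith)
          then have "arctan (1 / (?v l / s)) = - pi / 2 - arctan (?v l / s)"
            unfolding sgn_neg[OF n] by simp
          then show ?thesis unfolding quot using np by (simp add: Rat c N_def)
        qed
      qed
    qed
    moreover have "isCont ?G l0"
      using poly_up_at_pole[OF R[unfolded Rat] True]
      by (intro continuous_intros) (simp add: Rat del: up.simps)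
    ultimately show ?thesis by (simp add: isCont_cong)
  qed
next
  case Infty
  have "bc_angle s Infty = (\<lambda>l. 0)" by (rule ext) simp
  then show ?thesis unfolding Infty by simp
qed

section \<open>Counting eigenvalues\<close>

text \<open>The chosen angle is used only through the two properties that select it.\<close>

definition phi_angle :: "(real \<Rightarrow> real) \<Rightarrow> rfun \<Rightarrow> real \<Rightarrow> real \<Rightarrow> real \<Rightarrow> real" where
  "phi_angle q f s l = (SOME \<theta>. \<theta> 0 = bc_angle s f l \<and> pruefer_angle q s l \<theta>)"

text \<open>By \<open>bc_angle_polar\<close>, the data (down, up) of \<open>F\<close> at pi have the
  direction pi - \<open>bc_angle s F l\<close>. The total angle is the angle of \<phi> at pi minus
  this one.\<close>

definition total_angle :: "(real \<Rightarrow> real) \<Rightarrow> rfun \<Rightarrow> rfun \<Rightarrow> real \<Rightarrow> real \<Rightarrow> real" where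
  "total_angle q f F s l = phi_angle q f s l pi + bc_angle s F l - pi"

lemma phi_angle:
  assumes "q absolutely_integrable_on {0..pi}"
  shows "phi_angle q f s l 0 = bc_angle s f l" "pruefer_angle q s l (phi_angle q f s l)"
proof -
  obtain \<theta> where "\<theta> 0 = bc_angle s f l \<and> pruefer_angle q s l \<theta>"
    using pruefer_angle_exists[OF assms] by metis
  from someI[of "\<lambda>\<theta>. \<theta> 0 = bc_angle s f l \<and> pruefer_angle q s l \<theta>", OF this]
  show "phi_angle q f s l 0 = bc_angle s f l" "pruefer_angle q s l (phi_angle q f s l)"
    unfolding phi_angle_def by auto
qed

lemma phi_angle_ac_primitive:
  assumes "q absolutely_integrable_on {0..pi}"
  shows "ac_primitive (phi_angle q f s l) (\<lambda>x. s + pruefer_coeff q s l x * (sin (phi_angle q f s l x))^2) 0 pi"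
  using phi_angle(2)[OF assms] unfolding pruefer_angle_def .

lemma phi_angle_cont:
  assumes "q absolutely_integrable_on {0..pi}"
  shows "continuous_on {0..pi} (phi_angle q f s l)"
  by (rule ac_primitive_cont[OF phi_angle_ac_primitive[OF assms]])

section \<open>Monotonicity, range and continuity of the total angle\<close>

lemma pruefer_coeff_shift: "pruefer_coeff q s l x = pruefer_coeff q s l' x + (l - l') / s"
  by (simp add: pruefer_coeff_def flip: add_divide_distrib)

lemma total_angle_mono:
  assumes q: "q absolutely_integrable_on {0..pi}" and R: "in_R f" "in_R F" and s: "s > 0" and l: "l1 \<le> l2"
  shows "total_angle q f F s l1 \<le> total_angle q f F s l2"
proof -
  let ?u = "phi_angle q f s l2" and ?v = "phi_angle q f s l1"
  let ?e = "\<lambda>x. (l2 - l1) / s * (sin (?v x))^2"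
  have e: "?e absolutely_integrable_on {0..pi}"
    by (intro absolutely_integrable_continuous_real continuous_intros phi_angle_cont[OF q])
  have e0: "0 \<le> ?e x" for x using l s by simp
  have b0: "?v 0 \<le> ?u 0" unfolding phi_angle(1)[OF q] by (rule bc_angle_mono[OF R(1) s l])
  have "exp (- (2 * integral {0..pi} (\<lambda>x. \<bar>pruefer_coeff q s l2 x\<bar>))) * (?u 0 - ?v 0 + integral {0..pi} ?e) \<le> ?u pi - ?v pi"
  proof (rule angle_comparison(2)[OF phi_angle_ac_primitive[OF q] phi_angle_ac_primitive[OF q] pruefer_coeff_ai[OF q] e _ _ e0 b0])
    fix x
    show "s + pruefer_coeff q s l2 x * (sin (?u x))^2 - (s + pruefer_coeff q s l1 x * (sin (?v x))^2)
      = pruefer_coeff q s l2 x * ((sin (?u x))^2 - (sin (?v x))^2) + ?e x"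
      unfolding pruefer_coeff_shift[of q s l2 x l1] by (simp add: algebra_simps)
  qed auto
  moreover have "0 \<le> integral {0..pi} ?e"
    by (rule ai_integral_nonneg[OF e]) (rule e0)
  ultimately have "?v pi \<le> ?u pi"
    using b0 by (smt (verit) exp_ge_zero mult_nonneg_nonneg)
  then show ?thesis using bc_angle_mono[OF R(2) s l] by (simp add: total_angle_def)
qed

lemma total_angle_gt:
  assumes q: "q absolutely_integrable_on {0..pi}" and s: "s > 0"
  shows "- pi < total_angle q f F s l"
proof -
  let ?u = "phi_angle q f s l"
  have e: "(\<lambda>x. s) absolutely_integrable_on {0..pi}" by simp
  \<comment> \<open>Comparison with the angle that is constantly 0; its defect is \<open>s\<close>,
    because sin^2 vanishes there.\<close>
  have "exp (- (2 * integral {0..pi} (\<lambda>x. \<bar>pruefer_coeff q s l x\<bar>))) * (?u 0 - 0 + integral {0..pi} (\<lambda>x. s)) \<le> ?u pi - 0"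
    by (rule angle_comparison(2)[OF phi_angle_ac_primitive[OF q] ac_primitive_const pruefer_coeff_ai[OF q] e])
      (use s phi_angle(1)[OF q] bc_angle_nonneg in auto)
  moreover have "0 < ?u 0 - 0 + integral {0..pi} (\<lambda>x. s)"
    using s phi_angle(1)[OF q, of f s l] bc_angle_nonneg[of s f l] by (simp add: add_nonneg_pos)
  ultimately have "0 < ?u pi"
    by (smt (verit) exp_gt_zero mult_pos_pos)
  then show ?thesis using bc_angle_nonneg[of s F l] by (simp add: total_angle_def)
qed

lemma isCont_total_angle:
  assumes q: "q absolutely_integrable_on {0..pi}" and R: "in_R f" "in_R F" and s: "s > 0"
  shows "isCont (total_angle q f F s) l0"
proof -
  let ?v = "phi_angle q f s l0"
  \<comment> \<open>The coefficient is taken at \<open>l0\<close>, so that the constant does not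
    depend on \<open>l\<close>.\<close>
  define C where "C = exp (2 * integral {0..pi} (\<lambda>x. \<bar>pruefer_coeff q s l0 x\<bar>))"
  let ?D = "\<lambda>l. C * (\<bar>bc_angle s f l - bc_angle s f l0\<bar> + \<bar>l - l0\<bar> / s * pi)"
  have bound: "\<bar>phi_angle q f s l pi - ?v pi\<bar> \<le> ?D l" for l
  proof -
    let ?u = "phi_angle q f s l"
    let ?e = "\<lambda>x. (l - l0) / s * (sin (?u x))^2"
    have e: "?e absolutely_integrable_on {0..pi}"
      by (intro absolutely_integrable_continuous_real continuous_intros phi_angle_cont[OF q])
    have i0: "\<bar>?u pi - ?v pi\<bar> \<le> C * (\<bar>?u 0 - ?v 0\<bar> + integral {0..pi} (\<lambda>x. \<bar>?e x\<bar>))"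
      unfolding C_def
    proof (rule angle_comparison(1)[OF phi_angle_ac_primitive[OF q] phi_angle_ac_primitive[OF q] pruefer_coeff_ai[OF q] e])
      fix x
      show "s + pruefer_coeff q s l x * (sin (?u x))^2 - (s + pruefer_coeff q s l0 x * (sin (?v x))^2)
        = pruefer_coeff q s l0 x * ((sin (?u x))^2 - (sin (?v x))^2) + ?e x"
        unfolding pruefer_coeff_shift[of q s l x l0] by (simp add: algebra_simps)
    qed auto
    have "integral {0..pi} (\<lambda>x. \<bar>?e x\<bar>) \<le> integral {0..pi} (\<lambda>x. \<bar>l - l0\<bar> / s)"
    proof (rule integral_le)
      show "(\<lambda>x. \<bar>?e x\<bar>) integrable_on {0..pi}" by (rule ai_integrable[OF ai_abs[OF e]])
      fix x
      have "\<bar>?e x\<bar> = \<bar>l - l0\<bar> / s * (sin (?u x))^2" using s by (simp add: abs_mult)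
      also have "\<dots> \<le> \<bar>l - l0\<bar> / s * 1"
        using s by (intro mult_left_mono) (auto simp: abs_square_le_1)
      finally show "\<bar>?e x\<bar> \<le> \<bar>l - l0\<bar> / s" by simp
    qed auto
    also have "integral {0..pi} (\<lambda>x. \<bar>l - l0\<bar> / s) = \<bar>l - l0\<bar> / s * pi" by simp
    finally have i: "integral {0..pi} (\<lambda>x. \<bar>?e x\<bar>) \<le> \<bar>l - l0\<bar> / s * pi" .
    have "C * (\<bar>?u 0 - ?v 0\<bar> + integral {0..pi} (\<lambda>x. \<bar>?e x\<bar>)) \<le> C * (\<bar>?u 0 - ?v 0\<bar> + \<bar>l - l0\<bar> / s * pi)"
      by (intro mult_left_mono add_left_mono i) (simp add: C_def)
    with i0 show ?thesis unfolding phi_angle(1)[OF q] by (rule order_trans)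
  qed
  have "?D \<midarrow>l0\<rightarrow>
      C * (\<bar>bc_angle s f l0 - bc_angle s f l0\<bar> + \<bar>l0 - l0\<bar> / s * pi)"
    using s by (intro tendsto_intros isContD[OF isCont_bc_angle[OF R(1) s]]) auto
  then have lim0: "?D \<midarrow>l0\<rightarrow> 0"
    by simp
  have "(\<lambda>l. phi_angle q f s l pi - ?v pi) \<midarrow>l0\<rightarrow> 0"
    by (rule Lim_null_comparison[OF _ lim0]) (use bound in \<open>auto intro: always_eventually\<close>)
  then have "isCont (\<lambda>l. phi_angle q f s l pi) l0"
    unfolding isCont_def by (simp add: LIM_zero_iff)
  then show ?thesis unfolding total_angle_def[abs_def]
    by (intro continuous_intros isCont_bc_angle[OF R(2) s])
qed

lemma exists_arctan_gt:
  fixes a :: real assumes "a < pi" obtains K where "a < pi / 2 + arctan K"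
proof -
  define y where "y = max 0 (a / 2)"
  have "arctan (tan y) = y" by (rule arctan_tan) (use assms pi_gt_zero in \<open>auto simp: y_def max_def\<close>)
  moreover have "a < pi / 2 + y" using assms by (auto simp: y_def max_def)
  ultimately show ?thesis using that[of "tan y"] by simp
qed

text \<open>For very negative \<open>l\<close> the angle stays below \<open>\<pi>/2 - arctan w\<close> where \<open>w\<close> is a line plus
  \<open>\<integral> q / s\<close>: this \<open>w\<close> is a subsolution of the Riccati equation of \<open>y' / (s y)\<close> as soon as
  \<open>l \<le> - s (L + s w^2)\<close>.\<close>

lemma total_angle_neg:
  assumes q: "q absolutely_integrable_on {0..pi}" and R: "in_R f" "in_R F" and s: "s > 0"
  obtains l where "total_angle q f F s l < 0"
proof -
  obtain lf lF where lf: "bc_angle s f lf < pi" and lF: "bc_angle s F lF < pi"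
    using bc_angle_lt_pi by metis
  obtain K K' where K: "bc_angle s f lf < pi / 2 + arctan K" and K': "bc_angle s F lF < pi / 2 + arctan K'"
    using exists_arctan_gt[OF lf] exists_arctan_gt[OF lF] by metis
  \<comment> \<open>This slope lets \<open>w\<close> run from \<open>- K\<close> to
    \<open>K'\<close>. The barrier pi/2 - arctan \<open>w\<close> then starts at pi/2 + arctan
    \<open>K\<close>, above the initial angle, and ends at pi/2 - arctan \<open>K'\<close>, leaving
    a total below pi after the boundary angle of \<open>F\<close> is added.\<close>
  define L where "L = (K' + K - integral {0..pi} q / s) / pi"
  define w where "w x = - K + L * x + (1 / s) * integral {0..x} q" for x
  have "ac_primitive (\<lambda>x. - K + L * x) (\<lambda>x. L) 0 pi"
    by (rule ac_primitive_C1) (auto intro!: derivative_eq_intros continuous_intros)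
  then have w: "ac_primitive w (\<lambda>x. L + (1 / s) * q x) 0 pi"
    unfolding w_def[abs_def]
    using ac_primitive_add[OF _ ac_primitive_cmult[OF ac_primitive_integral[OF q, of 0], of "1 / s"],
      of "\<lambda>x. - K + L * x" "\<lambda>x. L"] by (simp only: add_0_left)
  note wc = ac_primitive_cont[OF w]
  obtain B where "\<forall>x\<in>{0..pi}. \<bar>w x\<bar> \<le> B"
    using compact_imp_bounded[OF compact_continuous_image[OF wc]] by (auto simp: bounded_iff)
  then have B: "\<bar>w x\<bar> \<le> B" if "x \<in> {0..pi}" for x using that by blast
  define l where "l = min (min lf lF) (- s * (L + s * B^2))"
  let ?v = "phi_angle q f s l"
  have at: "ac_primitive (\<lambda>x. arctan (w x)) (\<lambda>x. inverse (1 + (w x)^2) * (L + (1 / s) * q x)) 0 pi"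
  proof (rule ac_primitive_chain[OF w])
    show "(arctan has_real_derivative inverse (1 + x^2)) (at x)" for x by (rule DERIV_arctan)
    show "continuous_on UNIV (\<lambda>x::real. inverse (1 + x^2))"
      by (intro continuous_intros) (metis add_nonneg_eq_0_iff zero_le_one zero_le_power2 zero_neq_one ball_UNIV)
  qed
  have u: "ac_primitive (\<lambda>x. pi / 2 - arctan (w x)) (\<lambda>x. 0 - inverse (1 + (w x)^2) * (L + (1 / s) * q x)) 0 pi"
    by (rule ac_primitive_minus[OF ac_primitive_const at])
  have pos: "1 + (w x)^2 > 0" for x by (simp add: add_pos_nonneg)
  have sin2: "(sin (pi / 2 - arctan (w x)))^2 = inverse (1 + (w x)^2)" for x
    using cos_arctan[of "w x"] pos[of x] by (simp add: sin_diff power_divide inverse_eq_divide)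
  \<comment> \<open>Defect of the barrier in the angle equation. The integral of \<open>q\<close>
    inside \<open>w\<close> cancels the potential, so the defect is continuous and its sign can be
    controlled pointwise.\<close>
  define e where "e x = - (L + s * (w x)^2 + l / s) * inverse (1 + (w x)^2)" for x
  have e: "e absolutely_integrable_on {0..pi}"
    unfolding e_def[abs_def]
    by (intro absolutely_integrable_continuous_real continuous_intros wc) (use pos s in \<open>auto simp: less_imp_neq[symmetric]\<close>)
  have e0: "0 \<le> e x" if x: "x \<in> {0..pi}" for x
  proof -
    have "(w x)^2 \<le> B^2" using power_mono[OF B[OF x], of 2] by simp
    then have "s * (w x)^2 \<le> s * B^2" using s by (intro mult_left_mono) auto
    moreover have "l \<le> - s * (L + s * B^2)" by (simp add: l_def)
    then have "l / s \<le> - (L + s * B^2)" using s by (subst pos_divide_le_eq) (auto simp: algebra_simps)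
    ultimately have "0 \<le> - (L + s * (w x)^2 + l / s)" by linarith
    then show ?thesis unfolding e_def using pos[of x] by (intro mult_nonneg_nonneg) auto
  qed
  have b0: "?v 0 \<le> pi / 2 - arctan (w 0)"
  proof -
    have "w 0 = - K" by (simp add: w_def)
    moreover have "?v 0 \<le> bc_angle s f lf"
      unfolding phi_angle(1)[OF q] by (rule bc_angle_mono[OF R(1) s]) (simp add: l_def)
    ultimately show ?thesis using K by (simp add: arctan_minus)
  qed
  have "exp (- (2 * integral {0..pi} (\<lambda>x. \<bar>pruefer_coeff q s l x\<bar>))) * (pi / 2 - arctan (w 0) - ?v 0 + integral {0..pi} e)
      \<le> pi / 2 - arctan (w pi) - ?v pi"
  proof (rule angle_comparison(2)[OF u phi_angle_ac_primitive[OF q] pruefer_coeff_ai[OF q] e _ _ e0 b0])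
    fix x assume "x \<in> {0..pi}"
    have *: "inverse (1 + (w x)^2) * (1 + (w x)^2) = 1" using pos[of x] by simp
    have "0 - inverse (1 + (w x)^2) * (L + (1 / s) * q x) - s
      = pruefer_coeff q s l x * inverse (1 + (w x)^2) + e x"
    proof -
      have "s = s * (inverse (1 + (w x)^2) * (1 + (w x)^2))" unfolding * by simp
      moreover have "pruefer_coeff q s l x = l / s - s - (1 / s) * q x"
        using s by (simp add: pruefer_coeff_def diff_divide_distrib power2_eq_square)
      ultimately show ?thesis unfolding e_def by algebra
    qed
    then show "0 - inverse (1 + (w x)^2) * (L + (1 / s) * q x) - (s + pruefer_coeff q s l x * (sin (?v x))^2)
      = pruefer_coeff q s l x * ((sin (pi / 2 - arctan (w x)))^2 - (sin (?v x))^2) + e x"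
      unfolding sin2 by (simp add: algebra_simps)
  qed auto
  moreover have "0 \<le> integral {0..pi} e"
    by (rule ai_integral_nonneg[OF e]) (rule e0)
  ultimately have "?v pi \<le> pi / 2 - arctan (w pi)"
    using b0 by (smt (verit) exp_ge_zero mult_nonneg_nonneg)
  moreover have "w pi = K'" by (simp add: w_def L_def)
  moreover have "bc_angle s F l \<le> bc_angle s F lF" by (rule bc_angle_mono[OF R(2) s]) (simp add: l_def)
  ultimately have "total_angle q f F s l < 0" using K' by (simp add: total_angle_def)
  then show ?thesis by (rule that)
qed

section \<open>Eigenvalues as zeros of the sine of the total angle\<close>

lemma poly_map_poly_of_real: "poly (map_poly complex_of_real p) (complex_of_real x) = complex_of_real (poly p x)"
  by (induction p) (simp_all add: map_poly_pCons)

lemma is_eigenvalue_if_total_angle: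
  assumes q: "q absolutely_integrable_on {0..pi}" and R: "in_R f" "in_R F" and s: "s > 0"
    and G: "sin (total_angle q f F s l) = 0"
  shows "is_eigenvalue q f F (complex_of_real l)"
proof -
  let ?\<theta> = "phi_angle q f s l"
  define r where "r x = exp (log_amplitude q s l ?\<theta> x)" for x
  define y where "y x = r x * sin (?\<theta> x)" for x
  define y' where "y' x = s * (r x * cos (?\<theta> x))" for x
  have sol: "is_solution q (complex_of_real l) (\<lambda>x. complex_of_real (y x)) (\<lambda>x. complex_of_real (y' x))"
    using pruefer_solution[OF q s phi_angle(2)[OF q]] unfolding y_def y'_def r_def .
  obtain \<rho> where \<rho>: "poly (down f) l = \<rho> * sin (?\<theta> 0)" "poly (up f) l = - s * \<rho> * cos (?\<theta> 0)"
    using bc_angle_polar[OF R(1) s] unfolding phi_angle(1)[OF q] by metis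
  define A where "A = bc_angle s F l"
  obtain \<rho>' where \<rho>': "poly (down F) l = \<rho>' * sin A" "poly (up F) l = - s * \<rho>' * cos A"
    using bc_angle_polar[OF R(2) s] unfolding A_def by metis
  have "sin (?\<theta> pi + A) = 0" using G by (simp add: total_angle_def A_def sin_diff)
  then have sA: "sin (?\<theta> pi) * cos A + cos (?\<theta> pi) * sin A = 0" by (simp add: sin_add)
  have "poly (down f) l * y' 0 + poly (up f) l * y 0 = 0"
    unfolding \<rho> y_def y'_def by (simp add: algebra_simps)
  then have b0: "poly (map_poly complex_of_real (down f)) (complex_of_real l) * complex_of_real (y' 0)
      + poly (map_poly complex_of_real (up f)) (complex_of_real l) * complex_of_real (y 0) = 0"
    by (simp add: poly_map_poly_of_real flip: of_real_mult of_real_add)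
  have "poly (down F) l * y' pi - poly (up F) l * y pi
      = s * \<rho>' * r pi * (sin (?\<theta> pi) * cos A + cos (?\<theta> pi) * sin A)"
    unfolding \<rho>' y_def y'_def by (simp add: algebra_simps)
  then have "poly (down F) l * y' pi - poly (up F) l * y pi = 0" unfolding sA by simp
  then have b1: "poly (map_poly complex_of_real (down F)) (complex_of_real l) * complex_of_real (y' pi)
      - poly (map_poly complex_of_real (up F)) (complex_of_real l) * complex_of_real (y pi) = 0"
    by (simp add: poly_map_poly_of_real flip: of_real_mult of_real_diff)
  \<comment> \<open>If y vanished identically, so would y'(0), and then the sine and cosine of the
    initial angle would both be 0.\<close>
  have "\<exists>x\<in>{0..pi}. complex_of_real (y x) \<noteq> 0"
  proof (rule ccontr)
    assume "\<not> ?thesis"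
    then have z: "y x = 0" if "x \<in> {0..pi}" for x using that by simp
    have "((\<lambda>x. complex_of_real (y x)) has_vector_derivative complex_of_real (y' 0)) (at 0 within {0..pi})"
      using sol unfolding is_solution_def by auto
    then have "((\<lambda>x. 0 :: complex) has_vector_derivative complex_of_real (y' 0)) (at 0 within {0..pi})"
      by (rule has_vector_derivative_transform[rotated -1]) (use z in auto)
    moreover have "((\<lambda>x. 0 :: complex) has_vector_derivative 0) (at 0 within {0..pi})" by simp
    ultimately have "complex_of_real (y' 0) = 0"
      by (rule vector_derivative_unique_within[rotated]) (simp add: at_within_Icc_at_right trivial_limit_at_right_real)
    then have "cos (?\<theta> 0) = 0" using s by (simp add: y'_def r_def)
    moreover have "sin (?\<theta> 0) = 0" using z[of 0] by (simp add: y_def r_def)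
    ultimately show False using sin_cos_squared_add[of "?\<theta> 0"] by simp
  qed
  with sol b0 b1 show ?thesis unfolding is_eigenvalue_def by blast
qed

text \<open>Matching value and derivative of \<psi> = \<beta> \<phi> at pi has two consequences. The
  directions agree, so the sine of the total angle vanishes; and adding the squares gives \<beta>^2
  \<rho>^2 r(pi)^2 = \<rho>'^2 with r(0) = 1, which eliminates \<beta> from the norming
  constant.\<close>

lemma spectral_data_pruefer:
  assumes q: "q absolutely_integrable_on {0..pi}" and R: "in_R f" "in_R F" and s: "s > 0"
    and sd: "spectral_data q f F lam gam"
  defines "\<theta> \<equiv> \<lambda>n. phi_angle q f s (lam n)"
  obtains \<rho> \<rho>' where "\<rho> \<noteq> 0" "\<rho>' \<noteq> 0"
    "poly (down f) (lam n) = \<rho> * sin (bc_angle s f (lam n))"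
    "poly (up f) (lam n) = - s * \<rho> * cos (bc_angle s f (lam n))"
    "poly (down F) (lam n) = \<rho>' * sin (bc_angle s F (lam n))"
    "poly (up F) (lam n) = - s * \<rho>' * cos (bc_angle s F (lam n))"
    "sin (total_angle q f F s (lam n)) = 0"
    "gam n = \<rho>^2 * integral {0..pi} (\<lambda>x. exp (2 * log_amplitude q s (lam n) (\<theta> n) x) * (sin (\<theta> n x))^2)
      + poly (deriv_down2 f) (lam n)
      + \<rho>^2 * exp (2 * log_amplitude q s (lam n) (\<theta> n) pi) / \<rho>'^2 * poly (deriv_down2 F) (lam n)"
proof -
  define l where "l = lam n"
  define t where "t = \<theta> n"
  have t: "t 0 = bc_angle s f l" "pruefer_angle q s l t"
    unfolding t_def \<theta>_def l_def by (rule phi_angle[OF q])+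
  obtain \<phi> \<psi> \<beta> where phi: "is_phi q f l \<phi>" and psi: "is_psi q F l \<psi>" and \<beta>: "\<beta> \<noteq> 0" "\<forall>x\<in>{0..pi}. \<psi> x = \<beta> * \<phi> x"
    and gam: "gam n = integral {0..pi} (\<lambda>x. (\<phi> x)^2) + poly (deriv_down2 f) l + 1 / \<beta>^2 * poly (deriv_down2 F) l"
    using sd unfolding spectral_data_def l_def by blast
  obtain \<phi>' where phi': "is_solution q l \<phi> \<phi>'" "\<phi> 0 = poly (down f) l" "\<phi>' 0 = - poly (up f) l"
    using phi unfolding is_phi_def by blast
  obtain \<psi>' where psi': "is_solution q l \<psi> \<psi>'" "\<psi> pi = poly (down F) l" "\<psi>' pi = poly (up F) l"
    using psi unfolding is_psi_def by blast
  obtain \<rho> where \<rho>: "\<rho> \<noteq> 0" "poly (down f) l = \<rho> * sin (bc_angle s f l)" "poly (up f) l = - s * \<rho> * cos (bc_angle s f l)"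
    using bc_angle_polar[OF R(1) s] by metis
  define A where "A = bc_angle s F l"
  obtain \<rho>' where \<rho>': "\<rho>' \<noteq> 0" "poly (down F) l = \<rho>' * sin A" "poly (up F) l = - s * \<rho>' * cos A"
    using bc_angle_polar[OF R(2) s] unfolding A_def by metis
  define E where "E x = exp (log_amplitude q s l t x)" for x
  have rep: "\<phi> x = \<rho> * E x * sin (t x)" "\<phi>' x = s * \<rho> * E x * cos (t x)" if "x \<in> {0..pi}" for x
    unfolding E_def
    by (rule pruefer_representation[OF q s t(2) phi'(1) _ _ that]; use phi' \<rho> t(1) in simp)+
  \<comment> \<open>The relation between \<psi> and \<phi> concerns values only; it passes to the
    derivatives at pi because one-sided derivatives are unique.\<close>
  have "(\<phi> has_vector_derivative \<phi>' pi) (at pi within {0..pi})"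
    using phi'(1) unfolding is_solution_def by auto
  then have "((\<lambda>x. \<beta> * \<phi> x) has_vector_derivative \<beta> * \<phi>' pi) (at pi within {0..pi})"
    by (auto intro: derivative_eq_intros)
  then have "(\<psi> has_vector_derivative \<beta> * \<phi>' pi) (at pi within {0..pi})"
    by (rule has_vector_derivative_transform[rotated -1]) (use \<beta> in auto)
  moreover have "(\<psi> has_vector_derivative \<psi>' pi) (at pi within {0..pi})"
    using psi'(1) unfolding is_solution_def by auto
  ultimately have "\<beta> * \<phi>' pi = \<psi>' pi"
    by (rule vector_derivative_unique_within[rotated]) (simp add: at_within_Icc_at_left trivial_limit_at_left_real)
  moreover have "\<psi> pi = \<beta> * \<phi> pi" using \<beta>(2) by simp
  ultimately have e1: "\<beta> * (\<rho> * E pi * sin (t pi)) = \<rho>' * sin A" and e2: "\<beta> * (s * \<rho> * E pi * cos (t pi)) = - s * \<rho>' * cos A"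
    using rep[of pi] psi' \<rho>' by auto
  have "s * (\<beta> * \<rho> * E pi * cos (t pi)) = s * (- \<rho>' * cos A)" using e2 by (simp add: algebra_simps)
  from mult_left_cancel[THEN iffD1, OF _ this] s
  have e2: "\<beta> * \<rho> * E pi * cos (t pi) = - \<rho>' * cos A" by blast
  have E: "E pi > 0" by (simp add: E_def)
  have "\<beta> * \<rho> * E pi * sin (t pi + A) = (\<beta> * (\<rho> * E pi * sin (t pi))) * cos A + (\<beta> * \<rho> * E pi * cos (t pi)) * sin A"
    by (simp add: sin_add algebra_simps)
  also have "\<dots> = 0" unfolding e1 e2 by simp
  finally have sA: "sin (t pi + A) = 0" using \<beta>(1) \<rho>(1) E by simp
  have "(\<beta> * \<rho> * E pi)^2 * ((sin (t pi))^2 + (cos (t pi))^2) = (\<beta> * (\<rho> * E pi * sin (t pi)))^2 + (\<beta> * \<rho> * E pi * cos (t pi))^2"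
    by (simp only: power2_eq_square distrib_left mult_ac)
  also have "\<dots> = \<rho>'^2 * ((sin A)^2 + (cos A)^2)" unfolding e1 e2 by (simp only: power2_eq_square distrib_left mult_ac minus_mult_minus minus_mult_left[symmetric] minus_mult_right[symmetric] minus_minus)
  finally have sq: "(\<beta> * \<rho> * E pi)^2 = \<rho>'^2" by simp
  have "1 / \<beta>^2 = \<rho>^2 * (E pi)^2 / \<rho>'^2"
    unfolding sq[symmetric] using \<beta>(1) \<rho>(1) E by (simp add: power_mult_distrib)
  moreover have E2: "(E x)^2 = exp (2 * log_amplitude q s l t x)" for x by (simp add: E_def exp_double)
  moreover have "integral {0..pi} (\<lambda>x. (\<phi> x)^2) = integral {0..pi} (\<lambda>x. \<rho>^2 * (exp (2 * log_amplitude q s l t x) * (sin (t x))^2))"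
    by (rule hk_integral_cong) (simp add: rep E2[symmetric] power_mult_distrib)
  ultimately have "gam n = \<rho>^2 * integral {0..pi} (\<lambda>x. exp (2 * log_amplitude q s l t x) * (sin (t x))^2)
      + poly (deriv_down2 f) l + \<rho>^2 * exp (2 * log_amplitude q s l t pi) / \<rho>'^2 * poly (deriv_down2 F) l"
    unfolding gam by (simp only: integral_mult_right)
  moreover have "sin (total_angle q f F s l) = 0"
    using sA by (simp add: total_angle_def A_def t_def \<theta>_def l_def sin_diff)
  ultimately show ?thesis
    using that[OF \<rho>(1) \<rho>'(1)] \<rho> \<rho>' unfolding l_def t_def A_def by blast
qed

text \<open>The levels are hit without gaps: distinct eigenvalues lie on distinct multiples of pi,
  the lower bound excludes negative multiples, and the intermediate value theorem, started at
  \<open>a\<close>, fills every nonnegative level below an attained one.\<close>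

lemma angle_enumerates:
  fixes G :: "real \<Rightarrow> real" and lam :: "nat \<Rightarrow> real"
  assumes mono: "\<And>x y. x \<le> y \<Longrightarrow> G x \<le> G y" and cont: "\<And>x. isCont G x"
    and gt: "\<And>x. - pi < G x" and neg: "G a < 0" and lam: "strict_mono lam"
    and range: "\<And>l. l \<in> range lam \<longleftrightarrow> sin (G l) = 0"
  shows "G (lam n) = real n * pi"
proof -
  \<comment> \<open>A flat piece at a multiple of pi would put a whole interval into the range of
    \<open>lam\<close>, which is countable.\<close>
  have inj: "G x < G y" if xy: "x < y" and x: "sin (G x) = 0" for x y
  proof (rule ccontr)
    assume "\<not> G x < G y"
    have const: "G z = G x" if "z \<in> {x..y}" for z
    proof -
      have "G x \<le> G z" "G z \<le> G y" using that by (auto intro: mono)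
      then show ?thesis using \<open>\<not> G x < G y\<close> by linarith
    qed
    have "{x..y} \<subseteq> range lam"
    proof
      fix z assume "z \<in> {x..y}"
      from const[OF this] x show "z \<in> range lam" by (simp only: range)
    qed
    then have "countable {x..y}" by (rule countable_subset) auto
    then show False using xy uncountable_closed_interval by blast
  qed
  have "\<exists>k::int. G (lam n) = real_of_int k * pi" for n
    using range[of "lam n"] by (simp add: sin_zero_iff_int2)
  then obtain k :: "nat \<Rightarrow> int" where k: "\<And>n. G (lam n) = real_of_int (k n) * pi" by metis
  have kless: "k m < k n" if "m < n" for m n
  proof -
    have "G (lam m) < G (lam n)" using that lam range[of "lam m"] by (intro inj) (auto simp: strict_mono_def)
    then show ?thesis unfolding k by simp
  qed
  have k0: "0 \<le> k n" for n
  proof -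
    have "real_of_int (-1) * pi < real_of_int (k n) * pi" using gt[of "lam n"] unfolding k by simp
    then have "real_of_int (-1) < real_of_int (k n)" by (simp only: mult_less_cancel_right) auto
    then show ?thesis by linarith
  qed
  have surj: "\<exists>m. k m = j" if j: "0 \<le> j" "j \<le> k n" for j n
  proof -
    have "real_of_int j * pi \<le> G (lam n)" unfolding k using j by simp
    moreover have "G a \<le> real_of_int j * pi" using neg j by (smt (verit) mult_nonneg_nonneg of_int_nonneg pi_ge_zero)
    moreover have "a \<le> lam n"
    proof (rule ccontr)
      assume "\<not> a \<le> lam n"
      then have "G (lam n) \<le> G a" by (intro mono) simp
      moreover have "0 \<le> G (lam n)" unfolding k using k0[of n] by simp
      ultimately show False using neg by simp
    qed
    ultimately obtain l where l: "G l = real_of_int j * pi"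
      using IVT[of G a "real_of_int j * pi" "lam n"] cont by blast
    then have "sin (G l) = 0" by (simp add: sin_zero_iff_int2)
    then obtain m where "l = lam m" using range[of l] by blast
    then show ?thesis using l k[of m] by auto
  qed
  \<comment> \<open>A strictly increasing map onto an initial segment of the nonnegative integers is
    the identity: the index attaining \<open>int n\<close> lies neither below \<open>n\<close>, by
    induction, nor above it, by monotonicity.\<close>
  have "k n = int n"
  proof (induction n rule: less_induct)
    case (less n)
    have "int n \<le> k n"
    proof (cases n)
      case (Suc m)
      then show ?thesis using less[of m] kless[of m n] by simp
    qed (use k0 in simp)
    then obtain m where m: "k m = int n" using surj[of "int n" n] by auto
    have "\<not> m < n" using less[of m] m by auto
    moreover have "\<not> n < m" using kless[of n m] m \<open>int n \<le> k n\<close> by auto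
    ultimately show ?case using m by (metis linorder_neqE_nat)
  qed
  then show ?thesis using k by simp
qed

lemma total_angle_eigenvalue:
  assumes q: "q absolutely_integrable_on {0..pi}" and R: "in_R f" "in_R F" and s: "s > 0"
    and sd: "spectral_data q f F lam gam"
  shows "total_angle q f F s (lam n) = real n * pi"
proof -
  obtain a where a: "total_angle q f F s a < 0" using total_angle_neg[OF q R s] .
  show ?thesis
  proof (rule angle_enumerates[where G = "total_angle q f F s" and a = a and lam = lam])
    show "strict_mono lam" using sd unfolding spectral_data_def by blast
    have r: "{l. is_eigenvalue q f F l} = range (\<lambda>n. complex_of_real (lam n))"
      using sd unfolding spectral_data_def by blast
    show "l \<in> range lam \<longleftrightarrow> sin (total_angle q f F s l) = 0" for l
    proof
      assume "l \<in> range lam"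
      then obtain m where "l = lam m" by blast
      then show "sin (total_angle q f F s l) = 0" using spectral_data_pruefer[OF q R s sd, of m] by metis
    next
      assume "sin (total_angle q f F s l) = 0"
      from is_eigenvalue_if_total_angle[OF q R s this] r
      have "complex_of_real l \<in> range (\<lambda>n. complex_of_real (lam n))" by blast
      then show "l \<in> range lam" by auto
    qed
  qed (use a total_angle_mono[OF q R s] isCont_total_angle[OF q R s] total_angle_gt[OF q s] in auto)
qed

lemma eigenvalues_at_top:
  assumes q: "q absolutely_integrable_on {0..pi}" and R: "in_R f" "in_R F"
    and sd: "spectral_data q f F lam gam"
  shows "filterlim lam at_top sequentially"
  unfolding filterlim_at_top
proof
  fix Z
  \<comment> \<open>The scale is held at 1 here, since monotonicity in l presupposes a scale
    independent of l.\<close>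
  obtain N :: nat where N: "total_angle q f F 1 Z / pi < real N" using reals_Archimedean2 by blast
  show "\<forall>\<^sub>F n in sequentially. Z \<le> lam n"
    using eventually_ge_at_top[of N]
  proof eventually_elim
    case (elim n)
    show ?case
    proof (rule ccontr)
      assume "\<not> Z \<le> lam n"
      then have "real n * pi \<le> total_angle q f F 1 Z"
        using total_angle_mono[OF q R, of 1 "lam n" Z] total_angle_eigenvalue[OF q R _ sd, of 1 n] by simp
      then have "real n \<le> total_angle q f F 1 Z / pi" by (simp add: le_divide_eq)
      then show False using N elim by linarith
    qed
  qed
qed

section \<open>Trigonometric coefficients\<close>

lemma integral_cos_multiple: "integral {0..pi} (\<lambda>x. cos (real_of_int m * x)) = (if m = 0 then pi else 0)"
proof (cases "m = 0")
  case False
  have "((\<lambda>x. cos (real_of_int m * x)) has_integral sin (real_of_int m * pi) / m - sin (real_of_int m * 0) / m) {0..pi}"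
    by (rule fundamental_theorem_of_calculus)
      (use False in \<open>auto intro!: derivative_eq_intros simp flip: has_real_derivative_iff_has_vector_derivative\<close>)
  then show ?thesis using False by (simp add: integral_unique sin_zero_iff_int2)
qed simp

text \<open>On the half period [0, pi] each of the two families is orthogonal in itself, but cosines
  and sines are not mutually orthogonal. Bessel's inequality is therefore applied to each family
  separately.\<close>

lemma trig_orthogonal:
  fixes i j :: nat
  assumes "i > 0" "j > 0"
  shows "integral {0..pi} (\<lambda>x. cos (real i * x) * cos (real j * x)) = (if i = j then pi / 2 else 0)"
    and "integral {0..pi} (\<lambda>x. sin (real i * x) * sin (real j * x)) = (if i = j then pi / 2 else 0)"
proof -
  define d s where "d = int i - int j" and "s = int i + int j"
  have i: "(\<lambda>x. cos (real_of_int m * x)) integrable_on {0..pi}" for m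
    by (intro integrable_continuous_interval continuous_intros)
  have d: "real i * x - real j * x = real_of_int d * x" and s: "real i * x + real j * x = real_of_int s * x" for x
    by (simp_all add: d_def s_def algebra_simps)
  have s0: "s \<noteq> 0" using assms by (simp add: s_def)
  have d0: "d = 0 \<longleftrightarrow> i = j" by (simp add: d_def)
  show "integral {0..pi} (\<lambda>x. cos (real i * x) * cos (real j * x)) = (if i = j then pi / 2 else 0)"
    unfolding cos_times_cos d s using integral_add[OF i i, of d s] s0 d0
    by (simp add: integral_cos_multiple)
  show "integral {0..pi} (\<lambda>x. sin (real i * x) * sin (real j * x)) = (if i = j then pi / 2 else 0)"
    unfolding sin_times_sin d s using integral_diff[OF i i, of d s] s0 d0
    by (simp add: integral_cos_multiple)
qed

text \<open>Expands the squared distance between \<open>g\<close> and its projection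
  \<open>T / c\<close>, where \<open>c\<close> is the common squared norm of the
  \<open>e i\<close>.\<close>

lemma bessel_inequality:
  fixes e :: "nat \<Rightarrow> real \<Rightarrow> real"
  assumes A: "finite A" and c: "c > 0" and ec: "\<And>i. continuous_on {a..b} (e i)"
    and orth: "\<And>i j. i \<in> A \<Longrightarrow> j \<in> A \<Longrightarrow> integral {a..b} (\<lambda>x. e i x * e j x) = (if i = j then c else 0)"
    and g: "g absolutely_integrable_on {a..b}" and g2: "(\<lambda>x. (g x)^2) absolutely_integrable_on {a..b}"
  shows "(\<Sum>i\<in>A. (integral {a..b} (\<lambda>x. g x * e i x))^2) \<le> c * integral {a..b} (\<lambda>x. (g x)^2)"
proof -
  define r where "r i = integral {a..b} (\<lambda>x. g x * e i x)" for i
  define T where "T x = (\<Sum>i\<in>A. r i * e i x)" for x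
  have Tc: "continuous_on {a..b} T" unfolding T_def[abs_def] by (intro continuous_intros ec)
  have gT: "(\<lambda>x. g x * T x) integrable_on {a..b}" by (rule ai_integrable[OF ai_mult_cont[OF g Tc]])
  have T2: "(\<lambda>x. (T x)^2) integrable_on {a..b}" by (intro integrable_continuous_interval continuous_intros Tc)
  have ge: "(\<lambda>x. r i * (g x * e i x)) integrable_on {a..b}" for i
    by (intro integrable_on_mult_right ai_integrable[OF ai_mult_cont[OF g ec]])
  have "integral {a..b} (\<lambda>x. g x * T x) = integral {a..b} (\<lambda>x. \<Sum>i\<in>A. r i * (g x * e i x))"
    by (simp add: T_def sum_distrib_left mult_ac)
  also have "\<dots> = (\<Sum>i\<in>A. (r i)^2)"
    by (subst integral_sum[OF A ge]) (simp add: r_def power2_eq_square)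
  finally have IgT: "integral {a..b} (\<lambda>x. g x * T x) = (\<Sum>i\<in>A. (r i)^2)" .
  have ee: "(\<lambda>x. r i * r j * (e i x * e j x)) integrable_on {a..b}" for i j
    by (intro integrable_continuous_interval continuous_intros ec)
  have "integral {a..b} (\<lambda>x. (T x)^2) = integral {a..b} (\<lambda>x. \<Sum>i\<in>A. \<Sum>j\<in>A. r i * r j * (e i x * e j x))"
    by (simp add: T_def power2_eq_square sum_product mult_ac)
  also have "\<dots> = (\<Sum>i\<in>A. \<Sum>j\<in>A. r i * r j * (if i = j then c else 0))"
    by (subst integral_sum[OF A integrable_sum[OF A ee]], intro sum.cong refl, subst integral_sum[OF A ee])
      (auto intro!: sum.cong simp: orth)
  also have "\<dots> = c * (\<Sum>i\<in>A. (r i)^2)"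
    using A by (simp add: sum_distrib_left power2_eq_square mult_ac if_distrib[where f = "\<lambda>x. _ * x"] cong: if_cong)
  finally have IT: "integral {a..b} (\<lambda>x. (T x)^2) = c * (\<Sum>i\<in>A. (r i)^2)" .
  have "0 \<le> integral {a..b} (\<lambda>x. (g x)^2 - 2 / c * (g x * T x) + 1 / c^2 * (T x)^2)"
  proof (rule Henstock_Kurzweil_Integration.integral_nonneg)
    show "(\<lambda>x. (g x)^2 - 2 / c * (g x * T x) + 1 / c^2 * (T x)^2) integrable_on {a..b}"
      by (intro integrable_add integrable_diff integrable_on_mult_right gT T2 ai_integrable[OF g2])
    fix x
    have "(g x)^2 - 2 / c * (g x * T x) + 1 / c^2 * (T x)^2 = (g x - T x / c)^2"
      using c by (simp add: power2_diff power_divide)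
    then show "0 \<le> (g x)^2 - 2 / c * (g x * T x) + 1 / c^2 * (T x)^2" by simp
  qed
  also have "\<dots> = integral {a..b} (\<lambda>x. (g x)^2) - 2 / c * (\<Sum>i\<in>A. (r i)^2) + 1 / c^2 * (c * (\<Sum>i\<in>A. (r i)^2))"
    by (subst integral_add integral_diff; (intro integrable_diff integrable_on_mult_right gT T2 ai_integrable[OF g2])?)+
      (simp only: integral_mult_right IgT IT)
  also have "\<dots> = integral {a..b} (\<lambda>x. (g x)^2) - (\<Sum>i\<in>A. (r i)^2) / c"
    using c by (simp add: power2_eq_square field_simps)
  finally show ?thesis using c unfolding r_def by (simp add: field_simps)
qed

lemma bessel_summable:
  fixes e :: "nat \<Rightarrow> real \<Rightarrow> real"
  assumes c: "c > 0" and ec: "\<And>i. continuous_on {a..b} (e i)"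
    and orth: "\<And>i j. i > 0 \<Longrightarrow> j > 0 \<Longrightarrow> integral {a..b} (\<lambda>x. e i x * e j x) = (if i = j then c else 0)"
    and g: "g absolutely_integrable_on {a..b}" and g2: "(\<lambda>x. (g x)^2) absolutely_integrable_on {a..b}"
  shows "summable (\<lambda>i. (integral {a..b} (\<lambda>x. g x * e i x))^2)"
proof -
  let ?r = "\<lambda>i. integral {a..b} (\<lambda>x. g x * e i x)"
  \<comment> \<open>Index 0 is set aside: there the cosine has squared norm pi and the sine is
    zero.\<close>
  have "summable (\<lambda>i. (?r (Suc i))^2)"
  proof (rule summableI_nonneg_bounded)
    fix n
    have "(\<Sum>i<n. (?r (Suc i))^2) = (\<Sum>i\<in>Suc ` {..<n}. (?r i)^2)"
      by (subst sum.reindex) auto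
    also have "\<dots> \<le> c * integral {a..b} (\<lambda>x. (g x)^2)"
      by (rule bessel_inequality[OF _ c ec orth g g2]) auto
    finally show "(\<Sum>i<n. (?r (Suc i))^2) \<le> c * integral {a..b} (\<lambda>x. (g x)^2)" .
  qed simp
  then show ?thesis by (subst (asm) summable_Suc_iff)
qed

section \<open>Truncation, Riemann-Lebesgue and null sequences\<close>

lemma truncation_L1:
  fixes g :: "real \<Rightarrow> real"
  assumes g: "g absolutely_integrable_on {a..b}"
  defines "t \<equiv> \<lambda>M x. max (- real M) (min (real M) (g x))"
  shows "t M absolutely_integrable_on {a..b}" and "(\<lambda>x. (t M x)^2) absolutely_integrable_on {a..b}"
    and "(\<lambda>M. integral {a..b} (\<lambda>x. \<bar>g x - t M x\<bar>)) \<longlonglongrightarrow> 0"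
proof -
  show tM: "t M absolutely_integrable_on {a..b}" for M
    unfolding t_def by (intro absolutely_integrable_max_1 absolutely_integrable_min_1 g absolutely_integrable_on_const) auto
  have bd: "\<bar>t M x\<bar> \<le> real M" for M x by (auto simp: t_def abs_le_iff)
  have "(\<lambda>x. t M x * t M x) absolutely_integrable_on {a..b}"
  proof (rule absolutely_integrable_bounded_measurable_product_real[OF _ _ _ tM])
    show "t M \<in> borel_measurable (lebesgue_on {a..b})"
      by (rule absolutely_integrable_imp_borel_measurable[OF tM]) simp
    show "bounded (t M ` {a..b})" using bd by (auto simp: bounded_iff)
  qed simp
  then show "(\<lambda>x. (t M x)^2) absolutely_integrable_on {a..b}" by (simp add: power2_eq_square)
  have "(\<lambda>M. integral {a..b} (\<lambda>x. \<bar>g x - t M x\<bar>)) \<longlonglongrightarrow> integral {a..b} (\<lambda>x. 0)"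
  proof (rule dominated_convergence(2)[where h = "\<lambda>x. \<bar>g x\<bar>"])
    show "(\<lambda>x. \<bar>g x - t M x\<bar>) integrable_on {a..b}" for M
      by (rule ai_integrable[OF ai_abs[OF set_integral_diff(1)[OF g tM]]])
    show "(\<lambda>x. \<bar>g x\<bar>) integrable_on {a..b}" by (rule ai_integrable[OF ai_abs[OF g]])
    show "norm \<bar>g x - t M x\<bar> \<le> \<bar>g x\<bar>" for M x by (auto simp: t_def max_def min_def)
    fix x
    obtain N :: nat where N: "\<bar>g x\<bar> < real N" using reals_Archimedean2 by blast
    have "\<forall>\<^sub>F M in sequentially. \<bar>g x - t M x\<bar> = 0"
      using eventually_ge_at_top[of N]
    proof eventually_elim
      case (elim M)
      then have "\<bar>g x\<bar> < real M" using N by linarith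
      then show ?case by (auto simp: t_def)
    qed
    then show "(\<lambda>M. \<bar>g x - t M x\<bar>) \<longlonglongrightarrow> 0" by (rule tendsto_eventually)
  qed
  then show "(\<lambda>M. integral {a..b} (\<lambda>x. \<bar>g x - t M x\<bar>)) \<longlonglongrightarrow> 0" by simp
qed

text \<open>A bounded truncation is square integrable, so its coefficients tend to 0 by Bessel; the
  rest has small integral and the \<open>e i\<close> are bounded by 1.\<close>

lemma riemann_lebesgue_orthogonal:
  fixes e :: "nat \<Rightarrow> real \<Rightarrow> real"
  assumes c: "c > 0" and ec: "\<And>i. continuous_on {a..b} (e i)" and e1: "\<And>i x. \<bar>e i x\<bar> \<le> 1"
    and orth: "\<And>i j. i > 0 \<Longrightarrow> j > 0 \<Longrightarrow> integral {a..b} (\<lambda>x. e i x * e j x) = (if i = j then c else 0)"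
    and g: "g absolutely_integrable_on {a..b}"
  shows "(\<lambda>i. integral {a..b} (\<lambda>x. g x * e i x)) \<longlonglongrightarrow> 0"
proof (rule LIMSEQ_I)
  fix r :: real assume r: "r > 0"
  define t where "t M x = max (- real M) (min (real M) (g x))" for M x
  note t = truncation_L1[OF g, folded t_def]
  obtain M where M: "integral {a..b} (\<lambda>x. \<bar>g x - t M x\<bar>) < r / 2"
    using order_tendstoD(2)[OF t(3), of "r / 2"] r eventually_happens by force
  have "(\<lambda>i. (integral {a..b} (\<lambda>x. t M x * e i x))^2) \<longlonglongrightarrow> 0"
    by (rule summable_LIMSEQ_zero[OF bessel_summable[OF c ec orth t(1,2)]])
  then have "(\<lambda>i. integral {a..b} (\<lambda>x. t M x * e i x)) \<longlonglongrightarrow> 0" by simp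
  from LIMSEQ_D[OF this, of "r / 2"] r obtain N where N: "\<And>i. i \<ge> N \<Longrightarrow> \<bar>integral {a..b} (\<lambda>x. t M x * e i x)\<bar> < r / 2"
    by auto
  have "\<bar>integral {a..b} (\<lambda>x. g x * e i x)\<bar> < r" if "i \<ge> N" for i
  proof -
    note gt = set_integral_diff(1)[OF g t(1)[of M]]
    have "integral {a..b} (\<lambda>x. g x * e i x) = integral {a..b} (\<lambda>x. (g x - t M x) * e i x) + integral {a..b} (\<lambda>x. t M x * e i x)"
      using integral_add[OF ai_integrable[OF ai_mult_cont[OF gt ec]] ai_integrable[OF ai_mult_cont[OF t(1) ec]], of i M i]
      by (simp add: algebra_simps)
    moreover have "\<bar>integral {a..b} (\<lambda>x. (g x - t M x) * e i x)\<bar> \<le> integral {a..b} (\<lambda>x. \<bar>g x - t M x\<bar>)"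
      using e1 by (intro integral_abs_le ai_mult_cont ai_abs gt ec) (auto simp: abs_mult intro: mult_left_le)
    ultimately show ?thesis using M N[OF that] by linarith
  qed
  then show "\<exists>N. \<forall>i\<ge>N. norm (integral {a..b} (\<lambda>x. g x * e i x) - 0) < r" by auto
qed

text \<open>The flag \<open>L\<close> will be the square integrability of \<open>q\<close>, so that
  both cases of the theorem go through a single chain of lemmas.\<close>

definition l2_null :: "bool \<Rightarrow> (nat \<Rightarrow> real) \<Rightarrow> bool" where
  "l2_null L e \<longleftrightarrow> e \<longlonglongrightarrow> 0 \<and> (L \<longrightarrow> summable (\<lambda>n. (e n)^2))"

lemma l2_null_add:
  assumes "l2_null L e" "l2_null L d"
  shows "l2_null L (\<lambda>n. e n + d n)"
  unfolding l2_null_def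
proof (intro conjI impI)
  show "(\<lambda>n. e n + d n) \<longlonglongrightarrow> 0" using assms tendsto_add_zero unfolding l2_null_def by blast
  assume L
  then have "summable (\<lambda>n. 2 * (e n)^2 + 2 * (d n)^2)"
    using assms unfolding l2_null_def by (intro summable_add summable_mult) auto
  then show "summable (\<lambda>n. (e n + d n)^2)"
  proof (rule summable_comparison_test'[where N = 0])
    fix n
    have "0 \<le> (e n - d n)^2" by simp
    then have "(e n + d n)^2 \<le> 2 * (e n)^2 + 2 * (d n)^2"
      by (simp add: power2_eq_square algebra_simps)
    then show "norm ((e n + d n)^2) \<le> 2 * (e n)^2 + 2 * (d n)^2" by simp
  qed
qed

lemma l2_null_bigo:
  assumes e: "l2_null L e" and d: "d \<in> O(e)"
  shows "l2_null L d"
  unfolding l2_null_def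
proof (intro conjI impI)
  from landau_o.bigE[OF d] obtain c where c: "c > 0" "\<forall>\<^sub>F n in sequentially. norm (d n) \<le> c * norm (e n)" by blast
  have "(\<lambda>n. c * norm (e n)) \<longlonglongrightarrow> 0"
    using e unfolding l2_null_def by (intro tendsto_mult_right_zero tendsto_norm_zero) simp
  then show "d \<longlonglongrightarrow> 0" by (rule Lim_null_comparison[OF c(2)])
  assume L
  then have "summable (\<lambda>n. c^2 * (e n)^2)" using e unfolding l2_null_def by (intro summable_mult) auto
  moreover have "\<forall>\<^sub>F n in sequentially. norm ((d n)^2) \<le> c^2 * (e n)^2"
    using c(2) by eventually_elim (use power_mono[of "\<bar>d _\<bar>" "c * \<bar>e _\<bar>" 2] in \<open>force simp: power_mult_distrib\<close>)
  ultimately show "summable (\<lambda>n. (d n)^2)"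
    by (rule summable_comparison_test_ev[rotated])
qed

text \<open>Errors of order 1/n are harmless in both cases, because 1/n^2 is summable. This fixes
  the accuracy demanded of all later expansions.\<close>

lemma l2_null_bigo_add:
  assumes "l2_null L e" and "(\<lambda>n. d n - e n) \<in> O(\<lambda>n. 1 / real n)"
  shows "l2_null L d"
proof -
  have "l2_null L (\<lambda>n. 1 / real n)"
    unfolding l2_null_def using inverse_power_summable[of 2, where 'a = real] lim_1_over_n[where 'a = real]
    by (simp add: power_divide inverse_eq_divide)
  from l2_null_add[OF assms(1) l2_null_bigo[OF this assms(2)]] show ?thesis by simp
qed

lemma l2_null_subseq:
  assumes "l2_null L e" and "strict_mono g"
  shows "l2_null L (\<lambda>n. e (g n))"
proof -
  have "summable (\<lambda>n. (e (g n))^2)" if "summable (\<lambda>n. (e n)^2)"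
    using summable_reindex[OF that strict_mono_imp_inj_on[OF assms(2)]] by (simp add: o_def)
  then show ?thesis
    using assms LIMSEQ_subseq_LIMSEQ[of e 0 g] by (auto simp: l2_null_def o_def)
qed

lemma l2_null_shift: "l2_null L (\<lambda>n. e (n + k)) \<longleftrightarrow> l2_null L e"
  unfolding l2_null_def using LIMSEQ_ignore_initial_segment[of e 0 k] LIMSEQ_offset[of e k 0]
    summable_iff_shift[of "\<lambda>n. (e n)^2" k] by blast

lemma l2_null_trig_coefficients:
  fixes m :: int
  assumes g: "g absolutely_integrable_on {0..pi}"
    and g2: "L \<Longrightarrow> (\<lambda>x. (g x)^2) absolutely_integrable_on {0..pi}"
  shows "l2_null L (\<lambda>n. integral {0..pi} (\<lambda>x. g x * cos (of_int (2 * int n - m) * x)))"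
    and "l2_null L (\<lambda>n. integral {0..pi} (\<lambda>x. g x * sin (of_int (2 * int n - m) * x)))"
proof -
  \<comment> \<open>After a shift by \<open>\<bar>m\<bar>\<close> the frequencies 2n - m become 2n +
    r with r nonnegative, a subsequence of the natural frequencies.\<close>
  define r where "r = nat (2 * int (nat \<bar>m\<bar>) - m)"
  have r: "2 * int (n + nat \<bar>m\<bar>) - m = int (2 * n + r)" for n by (simp add: r_def)
  have sm: "strict_mono (\<lambda>n. 2 * n + r)" by (simp add: strict_mono_def)
  have p: "pi / 2 > 0" by simp
  have "l2_null L (\<lambda>i. integral {0..pi} (\<lambda>x. g x * cos (real i * x)))"
    unfolding l2_null_def
    by (intro conjI impI riemann_lebesgue_orthogonal[where e = "\<lambda>i x. cos (real i * x)", OF p _ _ trig_orthogonal(1) g]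
      bessel_summable[where e = "\<lambda>i x. cos (real i * x)", OF p _ trig_orthogonal(1) g g2] continuous_intros) auto
  from l2_null_subseq[OF this sm] show "l2_null L (\<lambda>n. integral {0..pi} (\<lambda>x. g x * cos (of_int (2 * int n - m) * x)))"
    by (subst l2_null_shift[symmetric, of _ _ "nat \<bar>m\<bar>"]) (simp only: r of_int_of_nat_eq)
  have "l2_null L (\<lambda>i. integral {0..pi} (\<lambda>x. g x * sin (real i * x)))"
    unfolding l2_null_def
    by (intro conjI impI riemann_lebesgue_orthogonal[where e = "\<lambda>i x. sin (real i * x)", OF p _ _ trig_orthogonal(2) g]
      bessel_summable[where e = "\<lambda>i x. sin (real i * x)", OF p _ trig_orthogonal(2) g g2] continuous_intros) auto
  from l2_null_subseq[OF this sm] show "l2_null L (\<lambda>n. integral {0..pi} (\<lambda>x. g x * sin (of_int (2 * int n - m) * x)))"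
    by (subst l2_null_shift[symmetric, of _ _ "nat \<bar>m\<bar>"]) (simp only: r of_int_of_nat_eq)
qed

section \<open>Boundary functions for large spectral parameter\<close>

lemma power_bigo_at_top: "i \<le> n \<Longrightarrow> (\<lambda>x::real. x ^ i) \<in> O(\<lambda>x. x ^ n)"
proof (rule landau_o.bigI[of 1])
  assume "i \<le> n"
  show "\<forall>\<^sub>F x::real in at_top. norm (x ^ i) \<le> 1 * norm (x ^ n)"
    using eventually_ge_at_top[of 1] by eventually_elim (use \<open>i \<le> n\<close> in \<open>simp add: power_increasing\<close>)
qed simp

lemma poly_bigo_at_top:
  fixes p :: "real poly"
  assumes "\<And>i. i > n \<Longrightarrow> coeff p i = 0"
  shows "poly p \<in> O(\<lambda>x. x ^ n)"
proof -
  have "degree p \<le> n" using assms by (intro degree_le) auto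
  then have "(\<lambda>x. \<Sum>i\<le>degree p. coeff p i * x ^ i) \<in> O(\<lambda>x. x ^ n)"
    by (intro big_sum_in_bigo) (auto intro: power_bigo_at_top)
  then show ?thesis by (simp add: poly_altdef[abs_def])
qed

text \<open>The bound is written \<open>x ^ n / x\<close> so that \<open>n = 0\<close>, where the
  polynomial is zero, is covered without a truncated subtraction in the exponent.\<close>

lemma poly_bigo_at_top_less:
  fixes p :: "real poly"
  assumes "\<And>i. i \<ge> n \<Longrightarrow> coeff p i = 0"
  shows "poly p \<in> O(\<lambda>x. x ^ n / x)"
proof (cases n)
  case 0
  then have "p = 0" using assms by (intro poly_eqI) auto
  then have "poly p = (\<lambda>x. 0)" by auto
  then show ?thesis by simp
next
  case (Suc m)
  have "poly p \<in> O(\<lambda>x. x ^ m)" using assms by (intro poly_bigo_at_top) (simp add: Suc)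
  also have "\<forall>\<^sub>F x::real in at_top. x ^ m = x ^ n / x"
    using eventually_gt_at_top[of 0] by eventually_elim (simp add: Suc)
  then have "(\<lambda>x::real. x ^ m) \<in> \<Theta>(\<lambda>x. x ^ n / x)" by (rule bigthetaI_cong)
  finally show ?thesis .
qed

lemma power_double:
  "(\<lambda>x::real. x ^ (2 * n)) = (\<lambda>x. x ^ n * x ^ n)"
  "(\<lambda>x::real. x ^ (2 * n) / x) = (\<lambda>x. x ^ n * (x ^ n / x))"
  "(\<lambda>x::real. x ^ (2 * n) / x) = (\<lambda>x. x ^ n / x * x ^ n)"
  "(\<lambda>x::real. x ^ (2 * n) / x) = (\<lambda>x. x ^ n * x ^ n * (1 / x))"
  by (simp_all add: mult_2 power_add)

text \<open>Only the square of the leading coefficient is prescribed, since in the applications this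
  coefficient is 1 or -1 depending on the number of poles.\<close>

lemma poly_square_asymp:
  fixes p :: "real poly"
  assumes "\<And>i. i > n \<Longrightarrow> coeff p i = 0" and "(coeff p n)^2 = 1"
  shows "(\<lambda>x. (poly p x)^2 - x ^ (2 * n)) \<in> O(\<lambda>x. x ^ (2 * n) / x)"
proof -
  define r where "r = p - monom (coeff p n) n"
  have r: "poly r \<in> O(\<lambda>x. x ^ n / x)"
    by (rule poly_bigo_at_top_less) (use assms(1) in \<open>auto simp: r_def le_less\<close>)
  have "(\<lambda>x. (poly p x)^2 - x ^ (2 * n)) = (\<lambda>x. 2 * coeff p n * x ^ n * poly r x + poly r x * poly r x)"
  proof
    fix x
    have p: "poly p x = coeff p n * x ^ n + poly r x" by (simp add: r_def poly_monom)
    have X: "x ^ (2 * n) = (x ^ n)^2" by (simp add: power_mult mult.commute)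
    have "(poly p x)^2 = (coeff p n)^2 * x ^ (2 * n) + (2 * coeff p n * x ^ n * poly r x + poly r x * poly r x)"
      unfolding p X by (simp add: power2_eq_square algebra_simps)
    then show "(poly p x)^2 - x ^ (2 * n) = 2 * coeff p n * x ^ n * poly r x + poly r x * poly r x"
      by (simp add: assms(2))
  qed
  also have "\<dots> \<in> O(\<lambda>x. x ^ (2 * n) / x)"
  proof (rule sum_in_bigo(1))
    have "(\<lambda>x. x ^ n * poly r x) \<in> O(\<lambda>x. x ^ n * (x ^ n / x))"
      by (intro landau_o.big.mult r) simp
    then show "(\<lambda>x. 2 * coeff p n * x ^ n * poly r x) \<in> O(\<lambda>x. x ^ (2 * n) / x)"
      unfolding power_double(2) using assms(2) by (simp add: mult.assoc)
    have "poly r \<in> O(\<lambda>x. x ^ n)" by (rule poly_bigo_at_top) (use assms(1) in \<open>simp add: r_def\<close>)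
    from landau_o.big.mult[OF this r]
    show "(\<lambda>x. poly r x * poly r x) \<in> O(\<lambda>x. x ^ (2 * n) / x)"
      unfolding power_double(2) .
  qed
  finally show ?thesis .
qed

lemma linear_prod_coeff:
  fixes c :: "'b \<Rightarrow> real"
  assumes "finite A"
  shows "i > card A \<Longrightarrow> coeff (\<Prod>k\<in>A. [:c k, -1:]) i = 0" and "coeff (\<Prod>k\<in>A. [:c k, -1:]) (card A) = (-1) ^ card A"
proof -
  have d: "degree (\<Prod>k\<in>A. [:c k, -1:]) = card A"
    by (subst degree_prod_eq_sum_degree) auto
  then show "i > card A \<Longrightarrow> coeff (\<Prod>k\<in>A. [:c k, -1:]) i = 0" by (simp add: coeff_eq_0)
  show "coeff (\<Prod>k\<in>A. [:c k, -1:]) (card A) = (-1) ^ card A"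
    using lead_coeff_prod[of "\<lambda>k. [:c k, -1:]" A] by (simp add: d)
qed

lemma down_coeff:
  fixes ps :: "(real \<times> real) list"
  defines "d \<equiv> length ps"
  shows "i > d \<Longrightarrow> coeff (down (Rat h0 h ps)) i = 0" and "coeff (down (Rat h0 h ps)) d = lead h0 * (-1) ^ d"
  using linear_prod_coeff[where A = "{..<length ps}" and c = "\<lambda>k. fst (ps ! k)"] by (simp_all add: d_def)

lemma up_coeff:
  fixes ps :: "(real \<times> real) list"
  defines "d \<equiv> length ps"
  shows "i > Suc d \<Longrightarrow> coeff (up (Rat h0 h ps)) i = 0"
    and "coeff (up (Rat h0 h ps)) (Suc d) = lead h0 * h0 * (-1) ^ d"
    and "h0 = 0 \<Longrightarrow> coeff (up (Rat h0 h ps)) d = h * (-1) ^ d"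
proof -
  let ?P = "\<Prod>k<length ps. [:fst (ps ! k), -1:]"
  let ?S = "\<Sum>k<length ps. smult (snd (ps ! k)) (\<Prod>j\<in>{..<length ps} - {k}. [:fst (ps ! j), -1:])"
  have P: "coeff ?P i = 0" if "i > d" for i
    using linear_prod_coeff(1)[of "{..<length ps}" i] that by (simp add: d_def)
  have Pd: "coeff ?P d = (-1) ^ d"
    using linear_prod_coeff(2)[of "{..<length ps}"] by (simp add: d_def)
  have S: "coeff ?S i = 0" if "i \<ge> d" for i
    unfolding coeff_sum coeff_smult
  proof (intro sum.neutral ballI)
    fix k assume "k \<in> {..<length ps}"
    then have "card ({..<length ps} - {k}) < i" using that by (auto simp: d_def)
    from linear_prod_coeff(1)[OF _ this] show "snd (ps ! k) * coeff (\<Prod>j\<in>{..<length ps} - {k}. [:fst (ps ! j), -1:]) i = 0"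
      by simp
  qed
  have u: "coeff (up (Rat h0 h ps)) i = lead h0 * (h * coeff ?P i + h0 * coeff (pCons 0 ?P) i + coeff ?S i)" for i
    by (simp add: mult_pCons_left coeff_pCons split: nat.splits)
  show "i > Suc d \<Longrightarrow> coeff (up (Rat h0 h ps)) i = 0" unfolding u using P S by (cases i) auto
  show "coeff (up (Rat h0 h ps)) (Suc d) = lead h0 * h0 * (-1) ^ d" unfolding u using P[of "Suc d"] Pd S[of "Suc d"] by simp
  show "coeff (up (Rat h0 h ps)) d = h * (-1) ^ d" if "h0 = 0"
    unfolding u using Pd S[of d] that by (simp add: lead_def)
qed

lemma coeff_pcompose_square:
  fixes p :: "real poly"
  shows "coeff (pcompose p [:0, 0, 1:]) n = (if even n then coeff p (n div 2) else 0)"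
proof (induction p arbitrary: n)
  case (pCons a p)
  have "pcompose (pCons a p) [:0, 0, 1:] = [:a:] + pCons 0 (pCons 0 (pcompose p [:0, 0, 1:]))"
    by (simp add: pcompose_pCons)
  then show ?case
    using pCons.IH by (cases n; cases "n - 1") (auto simp: coeff_pCons split: nat.splits)
qed simp

text \<open>By parity only one summand of \<open>omega\<close> contributes in degree
  \<open>ind f\<close>: the odd one, with the leading coefficient of \<open>down\<close>, if
  \<open>h0 > 0\<close>, and the even one, with the constant \<open>h\<close>, otherwise.\<close>

lemma omega1_eq:
  assumes "in_R (Rat h0 h ps)"
  shows "omega1 (Rat h0 h ps) = (if h0 > 0 then 1 / h0 else - h)"
proof (cases "h0 > 0")
  case True
  let ?d = "length ps"
  have f: "\<lfloor>(2 * real ?d + 1) / 2\<rfloor> = int ?d" by (rule floor_unique) simp_all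
  have n: "nat (2 * int ?d + 1) = Suc (2 * ?d)" by linarith
  have "omega1 (Rat h0 h ps) = (-1) ^ ?d * (lead h0 * (-1) ^ ?d)"
    using True by (simp add: omega1_def omega_def f n coeff_pcompose_square down_coeff(2) del: down.simps up.simps)
  then show ?thesis using True by (simp add: lead_def flip: power_mult_distrib)
next
  case False
  then have h0: "h0 = 0" using assms by simp
  let ?d = "length ps"
  have f: "\<lceil>real_of_int (2 * int ?d) / 2\<rceil> = int ?d" "\<lfloor>real_of_int (2 * int ?d) / 2\<rfloor> = int ?d" by simp_all
  have n: "nat (2 * int ?d) = 2 * ?d" by linarith
  have o: "coeff (pCons 0 (smult c (pcompose p [:0, 0, 1:]))) (2 * ?d) = 0" for p :: "real poly" and c
    by (cases ?d) (simp_all add: coeff_pcompose_square)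
  have "omega1 (Rat h0 h ps) = - ((-1) ^ ?d * (h * (-1) ^ ?d))"
    using up_coeff(3)[where ?h0.0 = h0 and h = h and ps = ps] h0
    by (simp add: omega1_def omega_def f n coeff_pcompose_square o del: down.simps up.simps)
  then show ?thesis using False by (simp flip: power_mult_distrib)
qed

lemma arctan_lipschitz: "\<bar>arctan x - arctan y\<bar> \<le> \<bar>x - y\<bar>"
proof -
  have *: "\<bar>arctan b - arctan a\<bar> \<le> \<bar>b - a\<bar>" if "a < b" for a b
  proof -
    have "\<exists>z>a. z < b \<and> arctan b - arctan a = (b - a) * inverse (1 + z^2)"
      by (rule MVT2[OF that]) (rule DERIV_arctan)
    then obtain z where "arctan b - arctan a = (b - a) * inverse (1 + z^2)" by blast
    moreover have "0 \<le> inverse (1 + z^2)" "inverse (1 + z^2) \<le> 1"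
      by (simp_all add: inverse_le_1_iff)
    ultimately show ?thesis using that by (simp add: abs_mult mult_left_le)
  qed
  show ?thesis using *[of x y] *[of y x] by (cases x y rule: linorder_cases) (auto simp: abs_minus_commute)
qed

text \<open>For large l all poles are passed and the function is h0 l + h + O(1/l). If
  \<open>h0 > 0\<close> the arctan tends to pi/2, which is the half step by which \<open>ind\<close>
  grows; if \<open>h0 = 0\<close> it tends to 0. The next term gives \<open>omega1\<close>. The
  error O(1/l) still leaves O(1/n) after multiplication by n.\<close>

lemma bc_angle_asymp:
  assumes R: "in_R f"
  shows "(\<lambda>l. bc_angle (sqrt l) f l - (pi * real_of_int (ind f + 1) / 2 - omega1 f / sqrt l)) \<in> O(\<lambda>l. 1 / l)"
proof (cases f)
  case Infty
  then show ?thesis by (simp add: omega1_def)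
next
  case (Rat h0 h ps)
  let ?d = "length ps"
  let ?A = "\<lambda>l. arctan (rat_value h0 h ps l / sqrt l) - arctan ((h0 * l + h) / sqrt l)"
  let ?B = "\<lambda>l. pi * real ?d + pi / 2 + arctan ((h0 * l + h) / sqrt l) - (pi * real_of_int (ind f + 1) / 2 - omega1 f / sqrt l)"
  have "\<forall>\<^sub>F l in at_top. \<forall>k\<in>{..<?d}. fst (ps ! k) < l"
    by (intro eventually_ball_finite) (auto intro: eventually_gt_at_top)
  then have ev: "\<forall>\<^sub>F l in at_top. bc_angle (sqrt l) f l = pi * real ?d + pi / 2 + arctan (rat_value h0 h ps l / sqrt l)"
  proof eventually_elim
    case (elim l)
    then have "poles_upto ps l = {..<?d}" "l \<notin> fst ` set ps" by (auto simp: poles_upto_def pole_iff less_imp_le)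
    then show ?case by (simp add: Rat)
  qed
  have "(\<lambda>l. snd (ps ! k) / (fst (ps ! k) - l)) \<in> O(\<lambda>l. 1 / l)" for k
  proof -
    have "(\<lambda>l. 1 / (fst (ps ! k) - l)) \<in> O(\<lambda>l. 1 / l)" by real_asymp
    from landau_o.big.mult[OF bigo_const this, of "snd (ps ! k)"] show ?thesis
      by (cases "snd (ps ! k) = 0") (auto simp: landau_o.big.cmult)
  qed
  then have "(\<lambda>l. \<Sum>k<?d. snd (ps ! k) / (fst (ps ! k) - l)) \<in> O(\<lambda>l. 1 / l)"
    by (intro big_sum_in_bigo)
  then have v: "(\<lambda>l. rat_value h0 h ps l - (h0 * l + h)) \<in> O(\<lambda>l. 1 / l)" by (simp add: rat_value_def)
  have "?A \<in> O(\<lambda>l. rat_value h0 h ps l - (h0 * l + h))"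
  proof (rule landau_o.bigI[of 1])
    show "\<forall>\<^sub>F l in at_top. norm (?A l) \<le> 1 * norm (rat_value h0 h ps l - (h0 * l + h))"
      using eventually_ge_at_top[of 1]
    proof eventually_elim
      case (elim l)
      have "\<bar>?A l\<bar> \<le> \<bar>(rat_value h0 h ps l - (h0 * l + h)) / sqrt l\<bar>"
        using arctan_lipschitz[of "rat_value h0 h ps l / sqrt l" "(h0 * l + h) / sqrt l"] by (simp add: diff_divide_distrib)
      also have "\<dots> \<le> \<bar>rat_value h0 h ps l - (h0 * l + h)\<bar> / 1"
        unfolding abs_divide using elim by (intro divide_left_mono) auto
      finally show ?case by simp
    qed
  qed simp
  then have a: "?A \<in> O(\<lambda>l. 1 / l)"
    using v by (rule landau_o.big_trans)
  have b: "?B \<in> O(\<lambda>l. 1 / l)"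
  proof (cases "h0 > 0")
    case True
    have "(\<lambda>l. arctan ((h0 * l + h) / sqrt l) - pi / 2 + 1 / (h0 * sqrt l)) \<in> O(\<lambda>l. 1 / l)"
      using True by real_asymp
    moreover have e: "?B l
      = arctan ((h0 * l + h) / sqrt l) - pi / 2 + 1 / (h0 * sqrt l)" for l
    proof -
      have o: "omega1 f = 1 / h0" using omega1_eq[OF R[unfolded Rat]] True by (simp add: Rat)
      have "real_of_int (ind f + 1) = 2 * (real ?d + 1)" using True by (simp add: Rat)
      then have i: "pi * real_of_int (ind f + 1) / 2 = pi * real ?d + pi" by (simp add: algebra_simps)
      show ?thesis unfolding i o by simp
    qed
    ultimately show ?thesis by (simp only: e)
  next
    case False
    then have h0: "h0 = 0" using R by (simp add: Rat)
    have "(\<lambda>l. arctan (h / sqrt l) - h / sqrt l) \<in> O(\<lambda>l. 1 / l)"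
      by (cases h "0 :: real" rule: linorder_cases) (simp_all, real_asymp+)
    moreover have e: "?B l
      = arctan (h / sqrt l) - h / sqrt l" for l
    proof -
      have o: "omega1 f = - h" using omega1_eq[OF R[unfolded Rat]] h0 by (simp add: Rat)
      have "real_of_int (ind f + 1) = 2 * real ?d + 1" using h0 by (simp add: Rat)
      then have i: "pi * real_of_int (ind f + 1) / 2 = pi * real ?d + pi / 2" by (simp add: algebra_simps)
      show ?thesis unfolding i o using h0 by simp
    qed
    ultimately show ?thesis by (simp only: e)
  qed
  have "(\<lambda>l. bc_angle (sqrt l) f l - (pi * real_of_int (ind f + 1) / 2 - omega1 f / sqrt l)) \<in>
    \<Theta>(\<lambda>l. (?A l) +
      (?B l))"
    by (rule bigthetaI_cong) (use ev in eventually_elim, simp)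
  also have "(\<lambda>l. (?A l) +
      (?B l)) \<in> O(\<lambda>l. 1 / l)"
    by (rule sum_in_bigo(1)[OF a b])
  finally show ?thesis .
qed

text \<open>This is the square of the factor \<rho> of \<open>bc_angle_polar\<close> for the scale
  \<open>sqrt l\<close>.\<close>

definition amplitude_sq :: "rfun \<Rightarrow> real \<Rightarrow> real" where
  "amplitude_sq f l = (poly (down f) l)^2 + (poly (up f) l)^2 / l"

text \<open>The normalisation by \<open>lead\<close> gives the dominating polynomial the leading
  coefficient 1 or -1. With d poles it is \<open>up\<close>, of degree d + 1 and divided by l after
  squaring, if \<open>h0 > 0\<close>, and \<open>down\<close>, of degree d, if
  \<open>h0 = 0\<close>. The other square is smaller by at least a factor l. A Dirichlet condition
  gives 1/l exactly.\<close>

lemma amplitude_sq_asymp_aux: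
  assumes R: "in_R f"
  shows "(\<lambda>l. amplitude_sq f l - l powi ind f) \<in> O(\<lambda>l. l powi ind f / l)"
    and "(\<lambda>l. poly (deriv_down2 f) l) \<in> O(\<lambda>l. l powi ind f / l)"
proof -
  have "(\<lambda>l. amplitude_sq f l - l powi ind f) \<in> O(\<lambda>l. l powi ind f / l) \<and>
    (\<lambda>l. poly (deriv_down2 f) l) \<in> O(\<lambda>l. l powi ind f / l)"
  proof (cases f)
    case Infty
    then show ?thesis by (simp add: amplitude_sq_def deriv_down2_def power_int_minus inverse_eq_divide)
  next
    case (Rat h0 h ps)
    let ?d = "length ps"
    let ?V = "\<lambda>x::real. x ^ (2 * ?d)" and ?W = "\<lambda>x::real. x ^ (2 * ?d) / x"
      and ?U = "\<lambda>x. ((poly (up f) x)^2 - x ^ (2 * Suc ?d)) * (1 / x)"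
    note dc = down_coeff[where ps = ps and ?h0.0 = h0 and h = h, folded Rat]
      and uc = up_coeff[where ps = ps and ?h0.0 = h0 and h = h, folded Rat]
    have down: "poly (down f) \<in> O(\<lambda>x. x ^ ?d)" by (rule poly_bigo_at_top[OF dc(1)])
    have pdown: "poly (pderiv (down f)) \<in> O(\<lambda>x. x ^ ?d / x)"
      by (rule poly_bigo_at_top_less) (simp add: coeff_pderiv dc(1))
    have dd: "poly (deriv_down2 f) = (\<lambda>l. poly (pderiv (up f)) l * poly (down f) l - poly (up f) l * poly (pderiv (down f)) l)"
      by (auto simp: deriv_down2_def)
    show ?thesis
    proof (cases "h0 > 0")
      case True
      have ind: "ind f = int (2 * ?d + 1)" using True by (simp add: Rat)
      have pw: "l powi ind f = l ^ (2 * ?d) * l" for l :: real unfolding ind power_int_of_nat by simp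
      have ev: "(\<lambda>l::real. l ^ (2 * ?d)) \<in> \<Theta>(\<lambda>l. l powi ind f / l)"
        by (rule bigthetaI_cong) (use eventually_gt_at_top[of 0] in eventually_elim, simp add: pw)
      have up: "poly (up f) \<in> O(\<lambda>x. x ^ Suc ?d)" by (rule poly_bigo_at_top[OF uc(1)])
      have pup: "poly (pderiv (up f)) \<in> O(\<lambda>x. x ^ ?d)"
        by (rule poly_bigo_at_top) (simp add: coeff_pderiv uc(1))
      have one: "(coeff (up f) (Suc ?d))^2 = 1" using True
        by (simp add: uc(2) lead_def power_mult_distrib flip: power_mult)
      have "(\<lambda>x. (poly (up f) x)^2 - x ^ (2 * Suc ?d)) \<in> O(\<lambda>x. x ^ (2 * Suc ?d) / x)"
        by (rule poly_square_asymp[OF uc(1) one])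
      from landau_o.big.mult[OF this landau_o.big_refl[of "\<lambda>x. 1 / x"]]
      have "?U \<in> O(\<lambda>x. x ^ (2 * Suc ?d) / x * (1 / x))" .
      also have "(\<lambda>x::real. x ^ (2 * Suc ?d) / x * (1 / x)) \<in> \<Theta>(?V)"
        by (rule bigthetaI_cong) (use eventually_gt_at_top[of 0] in eventually_elim, simp)
      finally have 1: "?U \<in> O(?V)" .
      have 2: "(\<lambda>x. (poly (down f) x)^2) \<in> O(?V)"
        using landau_o.big.mult[OF down down] unfolding power_double(1) power2_eq_square .
      have "(\<lambda>l. amplitude_sq f l - l powi ind f) \<in> \<Theta>(\<lambda>x. (poly (down f) x)^2 + ?U x)"
        by (rule bigthetaI_cong) (use eventually_gt_at_top[of 0] in eventually_elim, simp add: amplitude_sq_def pw field_simps)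
      also have "(\<lambda>x. (poly (down f) x)^2 + ?U x) \<in> O(?V)"
        by (rule sum_in_bigo(1)[OF 2 1])
      also note ev
      finally have A: "(\<lambda>l. amplitude_sq f l - l powi ind f) \<in> O(\<lambda>l. l powi ind f / l)" .
      have "poly (deriv_down2 f) \<in> O(?V)"
        unfolding dd
      proof (rule sum_in_bigo(2))
        show "(\<lambda>l. poly (pderiv (up f)) l * poly (down f) l) \<in> O(?V)"
          unfolding power_double(1) by (rule landau_o.big.mult[OF pup down])
        have "(\<lambda>l. poly (up f) l * poly (pderiv (down f)) l) \<in> O(\<lambda>x. x ^ Suc ?d * (x ^ ?d / x))"
          by (rule landau_o.big.mult[OF up pdown])
        also have "(\<lambda>x::real. x ^ Suc ?d * (x ^ ?d / x)) \<in> \<Theta>(?V)"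
          by (rule bigthetaI_cong) (use eventually_gt_at_top[of 0] in eventually_elim, simp add: mult_2 power_add)
        finally show "(\<lambda>l. poly (up f) l * poly (pderiv (down f)) l) \<in> O(?V)" .
      qed
      also note ev
      finally show ?thesis using A by simp
    next
      case False
      then have h0: "h0 = 0" using R by (simp add: Rat)
      have ind: "ind f = int (2 * ?d)" using False by (simp add: Rat)
      have pw: "l powi ind f = l ^ (2 * ?d)" for l :: real unfolding ind power_int_of_nat by simp
      have uc1: "coeff (up f) i = 0" if "i > ?d" for i
        using uc(1)[of i] uc(2) that h0 by (cases "i = Suc ?d") auto
      have up: "poly (up f) \<in> O(\<lambda>x. x ^ ?d)" by (rule poly_bigo_at_top[OF uc1])
      have pup: "poly (pderiv (up f)) \<in> O(\<lambda>x. x ^ ?d / x)"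
        by (rule poly_bigo_at_top_less) (simp add: coeff_pderiv uc1)
      have one: "(coeff (down f) ?d)^2 = 1" using False
        by (simp add: dc(2) lead_def flip: power_mult)
      have 1: "(\<lambda>x. (poly (down f) x)^2 - x ^ (2 * ?d)) \<in> O(?W)"
        by (rule poly_square_asymp[OF dc(1) one])
      have 2: "(\<lambda>x. (poly (up f) x)^2 * (1 / x)) \<in> O(?W)"
        unfolding power_double(4) power2_eq_square by (intro landau_o.big.mult up landau_o.big_refl)
      have "(\<lambda>l. amplitude_sq f l - l powi ind f) = (\<lambda>x. ((poly (down f) x)^2 - x ^ (2 * ?d)) + (poly (up f) x)^2 * (1 / x))"
        by (rule ext) (simp add: amplitude_sq_def pw)
      also have "\<dots> \<in> O(?W)" by (rule sum_in_bigo(1)[OF 1 2])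
      finally have A: "(\<lambda>l. amplitude_sq f l - l powi ind f) \<in> O(?W)" .
      have "poly (deriv_down2 f) \<in> O(?W)"
        unfolding dd
      proof (rule sum_in_bigo(2))
        show "(\<lambda>l. poly (pderiv (up f)) l * poly (down f) l) \<in> O(?W)"
          unfolding power_double(3) by (rule landau_o.big.mult[OF pup down])
        show "(\<lambda>l. poly (up f) l * poly (pderiv (down f)) l) \<in> O(?W)"
          unfolding power_double(2) by (rule landau_o.big.mult[OF up pdown])
      qed
      with A show ?thesis unfolding pw by simp
    qed
  qed
  then show "(\<lambda>l. amplitude_sq f l - l powi ind f) \<in> O(\<lambda>l. l powi ind f / l)"
    and "(\<lambda>l. poly (deriv_down2 f) l) \<in> O(\<lambda>l. l powi ind f / l)" by blast+
qed

lemma amplitude_sq_asymp: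
  assumes R: "in_R f"
  shows "(\<lambda>l. amplitude_sq f l / l powi ind f - 1) \<in> O(\<lambda>l. 1 / l)"
proof -
  have "(\<lambda>l. amplitude_sq f l / l powi ind f - 1) \<in> \<Theta>(\<lambda>l. (amplitude_sq f l - l powi ind f) * (1 / l powi ind f))"
    by (rule bigthetaI_cong) (use eventually_gt_at_top[of 0] in eventually_elim, simp add: field_simps)
  also have "(\<lambda>l. (amplitude_sq f l - l powi ind f) * (1 / l powi ind f)) \<in> O(\<lambda>l. l powi ind f / l * (1 / l powi ind f))"
    by (intro landau_o.big.mult amplitude_sq_asymp_aux(1)[OF R] landau_o.big_refl)
  also have "(\<lambda>l::real. l powi ind f / l * (1 / l powi ind f)) \<in> \<Theta>(\<lambda>l. 1 / l)"
    by (rule bigthetaI_cong) (use eventually_gt_at_top[of 0] in eventually_elim, simp)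
  finally show ?thesis .
qed

lemma deriv_down2_asymp:
  assumes R: "in_R f"
  shows "(\<lambda>l. poly (deriv_down2 f) l / amplitude_sq f l) \<in> O(\<lambda>l. 1 / l)"
proof -
  have "(\<lambda>l. 1 / l) \<in> o(\<lambda>_. 1 :: real)" by real_asymp
  from landau_o.big_small_trans[OF amplitude_sq_asymp[OF R] this]
  have "((\<lambda>l. amplitude_sq f l / l powi ind f - 1) \<longlongrightarrow> 0) at_top" by (auto dest: smalloD_tendsto)
  then have "\<forall>\<^sub>F l in at_top. -1/2 < amplitude_sq f l / l powi ind f - 1" by (rule order_tendstoD) simp
  then have "\<forall>\<^sub>F l in at_top. norm (1 / amplitude_sq f l) \<le> 2 * norm (1 / l powi ind f)"
    using eventually_gt_at_top[of 0]
  proof eventually_elim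
    case (elim l)
    have p: "l powi ind f > 0" using elim(2) by simp
    then have "l powi ind f \<le> 2 * amplitude_sq f l" using elim(1) by (simp add: field_simps)
    then show ?case using p by (simp add: field_simps)
  qed
  then have "(\<lambda>l. 1 / amplitude_sq f l) \<in> O(\<lambda>l. 1 / l powi ind f)" by (rule landau_o.bigI[rotated]) simp
  from landau_o.big.mult[OF amplitude_sq_asymp_aux(2)[OF R] this]
  have "(\<lambda>l. poly (deriv_down2 f) l / amplitude_sq f l) \<in> O(\<lambda>l. l powi ind f / l * (1 / l powi ind f))" by simp
  also have "(\<lambda>l::real. l powi ind f / l * (1 / l powi ind f)) \<in> \<Theta>(\<lambda>l. 1 / l)"
    by (rule bigthetaI_cong) (use eventually_gt_at_top[of 0] in eventually_elim, simp)
  finally show ?thesis .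
qed

section \<open>Asymptotics\<close>

lemma filterlim_sqrt_comp: "filterlim g at_top F \<Longrightarrow> filterlim (\<lambda>n. sqrt (g n)) at_top F"
  by (rule filterlim_compose[OF sqrt_at_top])

lemma cos_lipschitz: "\<bar>cos x - cos y\<bar> \<le> \<bar>x - y\<bar>" for x y :: real
proof -
  have "\<bar>cos x - cos y\<bar> = 2 * (\<bar>sin ((x + y) / 2)\<bar> * \<bar>sin ((y - x) / 2)\<bar>)"
    by (simp add: cos_diff_cos abs_mult)
  also have "\<dots> \<le> 2 * (1 * \<bar>(y - x) / 2\<bar>)"
    by (intro mult_left_mono mult_mono abs_sin_x_le_abs_x) auto
  finally show ?thesis by (simp add: abs_minus_commute)
qed

lemma sin_lipschitz: "\<bar>sin x - sin y\<bar> \<le> \<bar>x - y\<bar>" for x y :: real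
  using cos_lipschitz[of "pi / 2 - x" "pi / 2 - y"] by (simp add: cos_diff abs_minus_commute)

lemma abs_sin_double_le:
  fixes x y :: real
  assumes "sin (2 * y) = 0"
  shows "\<bar>sin (2 * x)\<bar> \<le> 2 * \<bar>x - y\<bar>"
proof -
  have "\<bar>sin (2 * x)\<bar> \<le> \<bar>2 * x - 2 * y\<bar>" using sin_lipschitz[of "2 * x" "2 * y"] assms by simp
  also have "2 * x - 2 * y = 2 * (x - y)" by (rule right_diff_distrib[symmetric])
  finally show ?thesis by (simp only: abs_mult abs_numeral)
qed

lemma exp_remainder_le:
  fixes x :: real
  assumes "\<bar>x\<bar> \<le> 1"
  shows "\<bar>exp x - 1 - x\<bar> \<le> x^2"
proof -
  have "exp x \<le> 1 + x + x^2"
  proof (cases "x \<ge> 0")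
    case True
    then show ?thesis using exp_bound[of x] assms by simp
  next
    case False
    then have "exp x \<le> 1 / (1 - x)"
      using exp_ge_add_one_self[of "- x"] by (simp add: exp_minus field_simps)
    also have "\<dots> \<le> 1 + x + x^2"
    proof -
      have "(1 + x + x^2) * (1 - x) = 1 - x * x^2" by (simp add: power2_eq_square algebra_simps)
      moreover have "x * x^2 \<le> 0" using False by (simp add: mult_nonpos_nonneg)
      ultimately show ?thesis using False by (simp add: pos_divide_le_eq)
    qed
    finally show ?thesis .
  qed
  then show ?thesis using exp_ge_add_one_self[of x] by linarith
qed

lemma weighted_integral_bound:
  fixes g h :: "real \<Rightarrow> real"
  assumes g: "g absolutely_integrable_on {a..b}" and h: "continuous_on {a..b} h"
    and bd: "\<And>x. x \<in> {a..b} \<Longrightarrow> \<bar>h x\<bar> \<le> B"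
  shows "\<bar>integral {a..b} (\<lambda>x. g x * h x)\<bar> \<le> B * integral {a..b} (\<lambda>x. \<bar>g x\<bar>)"
proof -
  have "\<bar>integral {a..b} (\<lambda>x. g x * h x)\<bar> \<le> integral {a..b} (\<lambda>x. B * \<bar>g x\<bar>)"
  proof (rule integral_abs_le[OF ai_mult_cont[OF g h]])
    show "(\<lambda>x. B * \<bar>g x\<bar>) absolutely_integrable_on {a..b}" using ai_abs[OF g] by simp
    show "\<bar>g t * h t\<bar> \<le> B * \<bar>g t\<bar>" if "t \<in> {a..b}" for t
      using mult_right_mono[OF bd[OF that], of "\<bar>g t\<bar>"] by (simp add: abs_mult mult.commute)
  qed
  then show ?thesis by simp
qed

section \<open>Products and powers of quantities close to one\<close>

lemma near_one_mult:
  fixes u v h :: "'a \<Rightarrow> real"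
  assumes u: "(\<lambda>n. u n - 1) \<in> O[A](h)" and v: "(\<lambda>n. v n - 1) \<in> O[A](h)" and h: "h \<in> O[A](\<lambda>_. 1)"
  shows "(\<lambda>n. u n * v n - 1) \<in> O[A](h)"
proof -
  have "(\<lambda>n. (u n - 1) * (v n - 1)) \<in> O[A](\<lambda>n. h n * 1)"
    by (rule landau_o.big.mult[OF u landau_o.big_trans[OF v h]])
  then have "(\<lambda>n. (u n - 1) * (v n - 1) + (u n - 1) + (v n - 1)) \<in> O[A](h)"
    by (intro sum_in_bigo u v) simp
  then show ?thesis by (simp add: algebra_simps)
qed

lemma near_one_inverse:
  fixes u h :: "'a \<Rightarrow> real"
  assumes u: "(\<lambda>n. u n - 1) \<in> O[A](h)" and h: "h \<in> o[A](\<lambda>_. 1)"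
  shows "(\<lambda>n. inverse (u n) - 1) \<in> O[A](h)"
proof -
  have "((\<lambda>n. u n - 1) \<longlongrightarrow> 0) A"
    using smalloD_tendsto[OF landau_o.big_small_trans[OF u h]] by simp
  then have "\<forall>\<^sub>F n in A. - 1 / 2 < u n - 1" by (rule order_tendstoD) simp
  then have "\<forall>\<^sub>F n in A. norm (inverse (u n) - 1) \<le> 2 * norm (u n - 1)"
  proof eventually_elim
    case (elim n)
    then have p: "u n > 1 / 2" by simp
    have "inverse (u n) - 1 = - (inverse (u n) * (u n - 1))" using p by (simp add: algebra_simps)
    moreover have "inverse (u n) \<le> 2" using p by (simp add: field_simps)
    ultimately show ?case using p by (simp add: abs_mult mult_right_mono)
  qed
  then have "(\<lambda>n. inverse (u n) - 1) \<in> O[A](\<lambda>n. u n - 1)" by (rule landau_o.bigI[rotated]) simp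
  then show ?thesis using u by (rule landau_o.big_trans)
qed

text \<open>Negative exponents occur for a Dirichlet condition at 0, where \<open>ind f\<close> is
  -1.\<close>

lemma near_one_powi:
  fixes u h :: "'a \<Rightarrow> real"
  assumes u: "(\<lambda>n. u n - 1) \<in> O[A](h)" and h: "h \<in> o[A](\<lambda>_. 1)"
  shows "(\<lambda>n. u n powi m - 1) \<in> O[A](h)"
proof -
  have pow: "(\<lambda>n. v n ^ i - 1) \<in> O[A](h)" if "(\<lambda>n. v n - 1) \<in> O[A](h)" for i and v :: "'a \<Rightarrow> real"
  proof (induction i)
    case (Suc i)
    from near_one_mult[OF that Suc landau_o.small_imp_big[OF h]] show ?case by simp
  qed simp
  show ?thesis
    using pow[OF u, of "nat m"] pow[OF near_one_inverse[OF u h], of "nat (- m)"]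
    by (cases "m \<ge> 0") (simp_all add: power_int_def)
qed

section \<open>Eigenvalues in the scale given by their own square root\<close>

locale spectral_problem =
  fixes q :: "real \<Rightarrow> real" and f F :: rfun and lam gam :: "nat \<Rightarrow> real"
  assumes q: "q absolutely_integrable_on {0..pi}" and R: "in_R f" "in_R F"
    and sd: "spectral_data q f F lam gam"
begin

text \<open>The scale now varies with n. For nonpositive \<open>lam n\<close> the root is no
  admissible scale, hence the recurring condition \<open>0 < lam n\<close>, which holds
  eventually.\<close>

definition k :: "nat \<Rightarrow> real" where "k n = sqrt (lam n)"
definition \<theta> :: "nat \<Rightarrow> real \<Rightarrow> real" where "\<theta> n = phi_angle q f (k n) (lam n)"
definition \<alpha> :: "nat \<Rightarrow> real" where "\<alpha> n = bc_angle (k n) f (lam n)"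
definition \<alpha>' :: "nat \<Rightarrow> real" where "\<alpha>' n = bc_angle (k n) F (lam n)"
definition \<nu> :: "nat \<Rightarrow> real" where "\<nu> n = real n - real_of_int (ind f + ind F) / 2"
definition Q :: real where "Q = integral {0..pi} (\<lambda>x. \<bar>q x\<bar>)"

lemma lam_at_top: "filterlim lam at_top sequentially"
  by (rule eigenvalues_at_top[OF q R sd])

lemma k_at_top: "filterlim k at_top sequentially"
  unfolding k_def[abs_def] by (rule filterlim_sqrt_comp[OF lam_at_top])

lemma ev_lam: "\<forall>\<^sub>F n in sequentially. lam n \<ge> c"
  using lam_at_top unfolding filterlim_at_top by blast

lemma ev_k: "\<forall>\<^sub>F n in sequentially. k n \<ge> c"
  using k_at_top unfolding filterlim_at_top by blast

lemma Q_nonneg: "0 \<le> Q"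
  unfolding Q_def by (rule ai_integral_nonneg[OF ai_abs[OF q]]) auto

lemma k_pos: "0 < lam n \<Longrightarrow> 0 < k n"
  and k_sq: "0 < lam n \<Longrightarrow> (k n)^2 = lam n"
  by (simp_all add: k_def)

lemma coeff_eq: "0 < lam n \<Longrightarrow> pruefer_coeff q (k n) (lam n) x = - (q x / k n)"
  by (simp add: pruefer_coeff_def k_sq)

lemma \<theta>_primitive:
  assumes "0 < lam n"
  shows "ac_primitive (\<theta> n) (\<lambda>x. k n - q x / k n * (sin (\<theta> n x))^2) 0 pi"
  using phi_angle_ac_primitive[OF q, of f "k n" "lam n"] by (simp add: \<theta>_def coeff_eq[OF assms])

lemma \<theta>_cont: "continuous_on {0..pi} (\<theta> n)"
  unfolding \<theta>_def by (rule phi_angle_cont[OF q])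

lemma \<theta>_0: "\<theta> n 0 = \<alpha> n"
  unfolding \<theta>_def \<alpha>_def by (rule phi_angle(1)[OF q])

lemma \<theta>_pi: "0 < lam n \<Longrightarrow> \<theta> n pi = real n * pi + pi - \<alpha>' n"
  using total_angle_eigenvalue[OF q R k_pos sd, of n n] by (simp add: total_angle_def \<theta>_def \<alpha>'_def)

lemma q_bound:
  assumes "continuous_on {0..pi} h" "\<And>x. x \<in> {0..pi} \<Longrightarrow> \<bar>h x\<bar> \<le> B"
  shows "\<bar>integral {0..pi} (\<lambda>x. q x * h x)\<bar> \<le> B * Q"
  unfolding Q_def by (rule weighted_integral_bound[OF q assms])

lemma q_bound_upto:
  assumes "continuous_on {0..pi} h" "\<And>x. x \<in> {0..pi} \<Longrightarrow> \<bar>h x\<bar> \<le> 1" "x \<in> {0..pi}"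
  shows "\<bar>integral {0..x} (\<lambda>x. q x * h x)\<bar> \<le> Q"
proof -
  have "\<bar>integral {0..x} (\<lambda>x. q x * h x)\<bar> \<le> integral {0..x} (\<lambda>x. \<bar>q x\<bar>)"
    using assms by (intro integral_abs_le ai_subinterval[OF ai_mult_cont[OF q]] ai_subinterval[OF ai_abs[OF q]])
      (auto simp: abs_mult intro: mult_left_le)
  also have "\<dots> \<le> Q"
    unfolding Q_def using assms(3)
    by (intro integral_subset_le ai_integrable ai_abs q ai_subinterval[OF ai_abs[OF q]]) auto
  finally show ?thesis .
qed

lemma \<theta>_eq:
  assumes n: "0 < lam n" and x: "x \<in> {0..pi}"
  shows "\<theta> n x = \<alpha> n + k n * x - integral {0..x} (\<lambda>t. q t * (sin (\<theta> n t))^2) / k n"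
proof -
  have qs: "(\<lambda>t. q t * (sin (\<theta> n t))^2) integrable_on {0..x}"
    using x by (intro ai_integrable[OF ai_subinterval[OF ai_mult_cont[OF q]]] continuous_intros \<theta>_cont) auto
  have "integral {0..x} (\<lambda>t. k n - q t / k n * (sin (\<theta> n t))^2)
    = integral {0..x} (\<lambda>t. k n - 1 / k n * (q t * (sin (\<theta> n t))^2))" by simp
  also have "\<dots> = k n * x - 1 / k n * integral {0..x} (\<lambda>t. q t * (sin (\<theta> n t))^2)"
    using integral_diff[OF integrable_const_ivl integrable_on_mult_right[OF qs], of "k n" "1 / k n"] x by simp
  finally show ?thesis using ac_primitive_eq[OF \<theta>_primitive[OF n] x] by (simp add: \<theta>_0)
qed

lemma boundary_angles_bigo:
  shows "(\<lambda>n. \<alpha> n - (pi * real_of_int (ind f + 1) / 2 - omega1 f / k n)) \<in> O(\<lambda>n. 1 / lam n)"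
    and "(\<lambda>n. \<alpha>' n - (pi * real_of_int (ind F + 1) / 2 - omega1 F / k n)) \<in> O(\<lambda>n. 1 / lam n)"
  using landau_o.big.compose[OF bc_angle_asymp[OF R(1)] lam_at_top]
    landau_o.big.compose[OF bc_angle_asymp[OF R(2)] lam_at_top]
  by (simp_all add: \<alpha>_def \<alpha>'_def k_def)

lemma inv_lam_inv_k: "(\<lambda>n. 1 / lam n) \<in> O(\<lambda>n. 1 / k n)"
proof (rule landau_o.bigI[of 1])
  show "\<forall>\<^sub>F n in sequentially. norm (1 / lam n) \<le> 1 * norm (1 / k n)"
    using ev_k[of 1] ev_lam[of 1]
  proof eventually_elim
    case (elim n)
    have "lam n = k n * k n" using k_sq[of n] elim by (simp add: power2_eq_square)
    then show ?case using elim by (simp add: field_simps)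
  qed
qed simp

lemma boundary_angle_bigo_k:
  shows "(\<lambda>n. \<alpha> n - pi * real_of_int (ind f + 1) / 2) \<in> O(\<lambda>n. 1 / k n)"
    and "(\<lambda>n. \<alpha>' n - pi * real_of_int (ind F + 1) / 2) \<in> O(\<lambda>n. 1 / k n)"
proof -
  have c: "(\<lambda>n. c / k n) \<in> O(\<lambda>n. 1 / k n)" for c
    using landau_o.big.mult[OF bigo_const landau_o.big_refl[of "\<lambda>n. 1 / k n" sequentially], of c] by simp
  show "(\<lambda>n. \<alpha> n - pi * real_of_int (ind f + 1) / 2) \<in> O(\<lambda>n. 1 / k n)"
    using sum_in_bigo(2)[OF landau_o.big_trans[OF boundary_angles_bigo(1) inv_lam_inv_k] c[of "omega1 f"]] by simp
  show "(\<lambda>n. \<alpha>' n - pi * real_of_int (ind F + 1) / 2) \<in> O(\<lambda>n. 1 / k n)"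
    using sum_in_bigo(2)[OF landau_o.big_trans[OF boundary_angles_bigo(2) inv_lam_inv_k] c[of "omega1 F"]] by simp
qed

text \<open>Two evaluations of the angle at pi are equated: the integrated angle equation and the
  eigenvalue count.\<close>

lemma k_eq:
  assumes n: "0 < lam n"
  shows "(k n - \<nu> n) * pi = - (\<alpha> n - pi * real_of_int (ind f + 1) / 2) - (\<alpha>' n - pi * real_of_int (ind F + 1) / 2)
    + integral {0..pi} (\<lambda>t. q t * (sin (\<theta> n t))^2) / k n"
  using \<theta>_eq[OF n, of pi] \<theta>_pi[OF n] by (simp add: \<nu>_def field_simps)

lemma inv_k_bigo_of_bound:
  assumes "\<And>n. 0 < lam n \<Longrightarrow> \<bar>u n\<bar> \<le> C / k n"
  shows "u \<in> O(\<lambda>n. 1 / k n)"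
proof (rule landau_o.big_trans)
  show "u \<in> O(\<lambda>n. C / k n)"
  proof (rule landau_o.bigI[of 1])
    show "\<forall>\<^sub>F n in sequentially. norm (u n) \<le> 1 * norm (C / k n)"
      using ev_lam[of 1]
    proof eventually_elim
      case (elim n)
      then have "\<bar>u n\<bar> \<le> C / k n" by (intro assms) simp
      also have "\<dots> \<le> \<bar>C / k n\<bar>" by (rule abs_ge_self)
      finally show ?case by simp
    qed
  qed simp
  show "(\<lambda>n. C / k n) \<in> O(\<lambda>n. 1 / k n)"
    using landau_o.big.mult[OF bigo_const landau_o.big_refl[of "\<lambda>n. 1 / k n" sequentially], of C] by simp
qed

lemma q_sin2_bigo: "(\<lambda>n. integral {0..pi} (\<lambda>t. q t * (sin (\<theta> n t))^2) / k n) \<in> O(\<lambda>n. 1 / k n)"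
proof (rule inv_k_bigo_of_bound)
  fix n assume "0 < lam n"
  then have "0 < k n" by (rule k_pos)
  moreover have "\<bar>integral {0..pi} (\<lambda>t. q t * (sin (\<theta> n t))^2)\<bar> \<le> 1 * Q"
    by (intro q_bound continuous_intros \<theta>_cont) (simp add: abs_square_le_1)
  ultimately show "\<bar>integral {0..pi} (\<lambda>t. q t * (sin (\<theta> n t))^2) / k n\<bar> \<le> Q / k n"
    by (simp add: divide_right_mono)
qed

lemma k_\<nu>_bigo_k: "(\<lambda>n. k n - \<nu> n) \<in> O(\<lambda>n. 1 / k n)"
proof -
  have "(\<lambda>n. (k n - \<nu> n) * pi) \<in> \<Theta>(\<lambda>n. - (\<alpha> n - pi * real_of_int (ind f + 1) / 2) - (\<alpha>' n - pi * real_of_int (ind F + 1) / 2)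
    + integral {0..pi} (\<lambda>t. q t * (sin (\<theta> n t))^2) / k n)"
    by (rule bigthetaI_cong) (use ev_lam[of 1] in eventually_elim, simp add: k_eq)
  also have "(\<lambda>n. - (\<alpha> n - pi * real_of_int (ind f + 1) / 2) - (\<alpha>' n - pi * real_of_int (ind F + 1) / 2)
    + integral {0..pi} (\<lambda>t. q t * (sin (\<theta> n t))^2) / k n) \<in> O(\<lambda>n. 1 / k n)"
    by (rule sum_in_bigo(1)[OF sum_in_bigo(2)[OF _ boundary_angle_bigo_k(2)] q_sin2_bigo])
      (use boundary_angle_bigo_k(1) in \<open>simp only: landau_o.big.uminus_in_iff\<close>)
  finally show ?thesis by simp
qed

text \<open>The first estimate of \<open>k n - \<nu> n\<close> is in terms of 1/k. It suffices for
  this limit, which then converts all errors from powers of 1/k to powers of 1/n.\<close>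

lemma n_over_k: "(\<lambda>n. real n / k n) \<longlonglongrightarrow> 1"
proof -
  have "(\<lambda>n. 1 / k n) \<longlonglongrightarrow> 0"
    using tendsto_inverse_0_at_top[OF k_at_top] by (simp add: inverse_eq_divide)
  then have ik: "(\<lambda>n. 1 / k n) \<in> o(\<lambda>_. 1)" by (intro smalloI_tendsto) auto
  have "(\<lambda>n. k n - \<nu> n) \<longlonglongrightarrow> 0"
    using smalloD_tendsto[OF landau_o.big_small_trans[OF k_\<nu>_bigo_k ik]] by simp
  from tendsto_diff[OF tendsto_const this, of "real_of_int (ind f + ind F) / 2"]
  have "(\<lambda>n. (real n - k n)) \<longlonglongrightarrow> real_of_int (ind f + ind F) / 2 - 0" by (simp add: \<nu>_def)
  from tendsto_add[OF tendsto_const tendsto_mult[OF this \<open>(\<lambda>n. 1 / k n) \<longlonglongrightarrow> 0\<close>], of 1]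
  have "(\<lambda>n. 1 + (real n - k n) * (1 / k n)) \<longlonglongrightarrow> 1" by simp
  moreover have "\<forall>\<^sub>F n in sequentially. 1 + (real n - k n) * (1 / k n) = real n / k n"
    using ev_k[of 1] by eventually_elim (simp add: field_simps)
  ultimately show ?thesis by (rule Lim_transform_eventually)
qed

lemma inv_k_bigo: "(\<lambda>n. 1 / k n) \<in> O(\<lambda>n. 1 / real n)"
  by (rule bigoI_tendsto[of _ _ 1]) (use n_over_k eventually_gt_at_top[of 0] in \<open>auto elim: eventually_mono\<close>)

lemma inv_lam_bigo: "(\<lambda>n. 1 / lam n) \<in> O(\<lambda>n. 1 / real n * (1 / real n))"
proof -
  have "(\<lambda>n. 1 / lam n) \<in> \<Theta>(\<lambda>n. 1 / k n * (1 / k n))"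
  proof (rule bigthetaI_cong)
    show "\<forall>\<^sub>F n in sequentially. 1 / lam n = 1 / k n * (1 / k n)"
      using ev_lam[of 1]
    proof eventually_elim
      case (elim n)
      then have "k n * k n = lam n" using k_sq[of n] by (simp add: power2_eq_square)
      then show ?case by simp
    qed
  qed
  also have "(\<lambda>n. 1 / k n * (1 / k n)) \<in> O(\<lambda>n. 1 / real n * (1 / real n))"
    by (intro landau_o.big.mult inv_k_bigo)
  finally show ?thesis .
qed

lemma k_\<nu>_bigo: "(\<lambda>n. k n - \<nu> n) \<in> O(\<lambda>n. 1 / real n)"
  by (rule landau_o.big_trans[OF k_\<nu>_bigo_k inv_k_bigo])

lemma n_times_bigo:
  assumes "u \<in> O(\<lambda>n. 1 / lam n)"
  shows "(\<lambda>n. real n * u n) \<in> O(\<lambda>n. 1 / real n)"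
proof -
  have "(\<lambda>n. real n * u n) \<in> O(\<lambda>n. real n * (1 / real n * (1 / real n)))"
    by (intro landau_o.big.mult landau_o.big_refl landau_o.big_trans[OF assms inv_lam_bigo])
  also have "(\<lambda>n. real n * (1 / real n * (1 / real n))) \<in> \<Theta>(\<lambda>n. 1 / real n)"
    by (rule bigthetaI_cong) (use eventually_gt_at_top[of 0] in eventually_elim, simp)
  finally show ?thesis .
qed

text \<open>The angle is replaced by the line a + \<nu> x. The slope 2 \<nu> is the integer 2n -
  \<open>ind f\<close> - \<open>ind F\<close>, and 2a is a multiple of pi, so the addition theorem
  leaves only the fixed factor \<sigma> times a pure trigonometric coefficient. General
  \<open>g\<close> is kept since both q and (pi - x) q occur.\<close>

lemma trig_\<theta>_l2_null:
  assumes g: "g absolutely_integrable_on {0..pi}"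
    and g2: "L \<Longrightarrow> (\<lambda>x. (g x)^2) absolutely_integrable_on {0..pi}"
  shows "l2_null L (\<lambda>n. integral {0..pi} (\<lambda>x. g x * cos (2 * \<theta> n x)))"
    and "l2_null L (\<lambda>n. integral {0..pi} (\<lambda>x. g x * sin (2 * \<theta> n x)))"
proof -
  let ?I = "\<lambda>T n. integral {0..pi} (\<lambda>x. g x * T (2 * \<theta> n x))"
  define m where "m = ind f + ind F"
  define a where "a = pi * real_of_int (ind f + 1) / 2"
  define \<sigma> where "\<sigma> = cos (2 * a)"
  let ?K = "\<lambda>T n. integral {0..pi} (\<lambda>x. g x * T (2 * (a + \<nu> n * x)))"
  have a2: "2 * a = real_of_int (ind f + 1) * pi" by (simp add: a_def)
  have s0: "sin (2 * a) = 0" unfolding a2 sin_zero_iff_int2 by blast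
  define G where "G = integral {0..pi} (\<lambda>x. \<bar>g x\<bar>)"
  \<comment> \<open>Bound, uniform in x, for the distance of the angle from the line: initial angle,
    slope and the integral of q contribute O(1/n) each.\<close>
  define D where "D n = \<bar>\<alpha> n - a\<bar> + \<bar>k n - \<nu> n\<bar> * pi + \<bar>1 / k n * Q\<bar>" for n
  have "D \<in> O(\<lambda>n. 1 / real n)"
  proof -
    have "(\<lambda>n. \<bar>\<alpha> n - a\<bar>) \<in> O(\<lambda>n. 1 / real n)"
      using landau_o.big_trans[OF boundary_angle_bigo_k(1) inv_k_bigo] by (simp add: a_def)
    moreover have "(\<lambda>n. \<bar>k n - \<nu> n\<bar> * pi) \<in> O(\<lambda>n. 1 / real n)"
      using k_\<nu>_bigo by simp
    moreover have "(\<lambda>n. 1 / k n * Q) \<in> O(\<lambda>n. 1 / real n * 1)"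
      by (intro landau_o.big.mult inv_k_bigo bigo_const)
    then have "(\<lambda>n. \<bar>1 / k n * Q\<bar>) \<in> O(\<lambda>n. 1 / real n)"
      by (simp only: landau_o.big.abs_in_iff mult_1_right)
    ultimately show ?thesis unfolding D_def[abs_def] by (intro sum_in_bigo)
  qed
  then have GD: "(\<lambda>n. G * (2 * D n)) \<in> O(\<lambda>n. 1 / real n)"
    using landau_o.big.mult[OF bigo_const[of "2 * G"]] by (fastforce simp: mult_ac)
  have dist: "\<bar>\<theta> n x - (a + \<nu> n * x)\<bar> \<le> D n" if n: "0 < lam n" and x: "x \<in> {0..pi}" for n x
  proof -
    have kp: "k n > 0" by (rule k_pos[OF n])
    have I: "\<bar>integral {0..x} (\<lambda>t. q t * (sin (\<theta> n t))^2)\<bar> \<le> Q"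
      by (intro q_bound_upto continuous_intros \<theta>_cont x) (simp add: abs_square_le_1)
    have "\<theta> n x - (a + \<nu> n * x) = (\<alpha> n - a) + (k n - \<nu> n) * x - 1 / k n * integral {0..x} (\<lambda>t. q t * (sin (\<theta> n t))^2)"
      unfolding \<theta>_eq[OF n x] by (simp add: algebra_simps)
    moreover have "\<bar>(k n - \<nu> n) * x\<bar> \<le> \<bar>k n - \<nu> n\<bar> * pi"
      unfolding abs_mult using x by (intro mult_left_mono) auto
    moreover have "\<bar>1 / k n * integral {0..x} (\<lambda>t. q t * (sin (\<theta> n t))^2)\<bar> \<le> \<bar>1 / k n * Q\<bar>"
      unfolding abs_mult using I Q_nonneg by (intro mult_left_mono) auto
    ultimately show ?thesis unfolding D_def by (smt (verit))
  qed
  have \<nu>2: "2 * (a + \<nu> n * x) = 2 * a + of_int (2 * int n - m) * x" for n x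
    by (simp add: \<nu>_def m_def field_simps)
  have close: "\<bar>?I T n - ?K T n\<bar> \<le> G * (2 * D n)"
    if n: "0 < lam n" and T: "\<And>x y. \<bar>T x - T y\<bar> \<le> \<bar>x - y\<bar>" "continuous_on UNIV T" for n and T :: "real \<Rightarrow> real"
  proof -
    have c1: "continuous_on {0..pi} (\<lambda>x. T (2 * \<theta> n x))"
      by (rule continuous_on_compose2[OF T(2)]) (auto intro!: continuous_intros \<theta>_cont)
    have c2: "continuous_on {0..pi} (\<lambda>x. T (2 * (a + \<nu> n * x)))"
      by (rule continuous_on_compose2[OF T(2)]) (auto intro!: continuous_intros)
    have "?I T n - ?K T n
      = integral {0..pi} (\<lambda>x. g x * (T (2 * \<theta> n x) - T (2 * (a + \<nu> n * x))))"
      using integral_diff[OF ai_integrable[OF ai_mult_cont[OF g c1]] ai_integrable[OF ai_mult_cont[OF g c2]]]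
      by (simp add: right_diff_distrib)
    moreover have "\<bar>integral {0..pi} (\<lambda>x. g x * (T (2 * \<theta> n x) - T (2 * (a + \<nu> n * x))))\<bar> \<le> (2 * D n) * G"
      unfolding G_def
    proof (rule weighted_integral_bound[OF g continuous_on_diff[OF c1 c2]])
      fix x assume "x \<in> {0..pi}"
      from dist[OF n this] T(1)[of "2 * \<theta> n x" "2 * (a + \<nu> n * x)"]
      show "\<bar>T (2 * \<theta> n x) - T (2 * (a + \<nu> n * x))\<bar> \<le> 2 * D n" by (smt (verit))
    qed
    ultimately show ?thesis by (simp add: mult_ac)
  qed
  have bigo: "(\<lambda>n. ?I T n - ?K T n) \<in> O(\<lambda>n. 1 / real n)"
    if T: "\<And>x y. \<bar>T x - T y\<bar> \<le> \<bar>x - y\<bar>" "continuous_on UNIV T" for T :: "real \<Rightarrow> real"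
  proof (rule landau_o.big_trans[OF _ GD], rule landau_o.bigI[of 1])
    show "\<forall>\<^sub>F n in sequentially. norm (?I T n - ?K T n) \<le> 1 * norm (G * (2 * D n))"
      using ev_lam[of 1]
    proof eventually_elim
      case (elim n)
      then have "0 < lam n" by simp
      from close[OF this T] show ?case by (simp only: real_norm_def mult_1_left)
    qed
  qed simp
  have scale: "l2_null L (\<lambda>n. \<sigma> * e n)" if "l2_null L e" for e
    by (rule l2_null_bigo[OF that]) (auto simp: \<sigma>_def intro: landau_o.big.mult_in_1)
  show "l2_null L (\<lambda>n. integral {0..pi} (\<lambda>x. g x * cos (2 * \<theta> n x)))"
  proof (rule l2_null_bigo_add[OF _ bigo])
    have "integral {0..pi} (\<lambda>x. g x * cos (2 * (a + \<nu> n * x))) = \<sigma> * integral {0..pi} (\<lambda>x. g x * cos (of_int (2 * int n - m) * x))" for n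
      unfolding \<nu>2 cos_add s0 \<sigma>_def[symmetric] by (simp add: mult.left_commute[of _ \<sigma>])
    with scale[OF l2_null_trig_coefficients(1)[OF g g2, where m = m]]
    show "l2_null L (\<lambda>n. integral {0..pi} (\<lambda>x. g x * cos (2 * (a + \<nu> n * x))))" by simp
  qed (auto intro: cos_lipschitz continuous_intros)
  show "l2_null L (\<lambda>n. integral {0..pi} (\<lambda>x. g x * sin (2 * \<theta> n x)))"
  proof (rule l2_null_bigo_add[OF _ bigo])
    have "integral {0..pi} (\<lambda>x. g x * sin (2 * (a + \<nu> n * x))) = \<sigma> * integral {0..pi} (\<lambda>x. g x * sin (of_int (2 * int n - m) * x))" for n
      unfolding \<nu>2 sin_add s0 \<sigma>_def[symmetric] by (simp add: mult.left_commute[of _ \<sigma>])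
    with scale[OF l2_null_trig_coefficients(2)[OF g g2, where m = m]]
    show "l2_null L (\<lambda>n. integral {0..pi} (\<lambda>x. g x * sin (2 * (a + \<nu> n * x))))" by simp
  qed (auto intro: sin_lipschitz continuous_intros)
qed


definition E :: "nat \<Rightarrow> real \<Rightarrow> real" where
  "E n x = 1 / k n * integral {0..x} (\<lambda>t. q t * sin (2 * \<theta> n t))"

lemma E_log_amplitude:
  assumes n: "0 < lam n"
  shows "2 * log_amplitude q (k n) (lam n) (\<theta> n) x = E n x"
proof -
  have "log_amplitude q (k n) (lam n) (\<theta> n) x = integral {0..x} (\<lambda>t. 1 / (2 * k n) * (q t * sin (2 * \<theta> n t)))"
    unfolding log_amplitude_def coeff_eq[OF n]
    by (rule hk_integral_cong) (simp add: sin_double)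
  also have "\<dots> = 1 / (2 * k n) * integral {0..x} (\<lambda>t. q t * sin (2 * \<theta> n t))" by (rule integral_mult_right)
  finally show ?thesis by (simp add: E_def)
qed

section \<open>Expansion of the amplitude and of the norming integral\<close>

lemma trig2_cont: "continuous_on {0..pi} (\<lambda>x. sin (2 * \<theta> n x))" "continuous_on {0..pi} (\<lambda>x. cos (2 * \<theta> n x))"
  by (intro continuous_intros \<theta>_cont)+

lemma E_primitive: "ac_primitive (E n) (\<lambda>x. 1 / k n * (q x * sin (2 * \<theta> n x))) 0 pi"
  using ac_primitive_cmult[OF ac_primitive_integral[OF ai_mult_cont[OF q trig2_cont(1)], of 0], of "1 / k n"]
  by (simp add: E_def[abs_def])

lemma E_cont: "continuous_on {0..pi} (E n)"
  by (rule ac_primitive_cont[OF E_primitive])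

lemma E_0: "E n 0 = 0" by (simp add: E_def)

lemma E_bound:
  assumes n: "0 < lam n" and x: "x \<in> {0..pi}"
  shows "\<bar>E n x\<bar> \<le> Q / k n"
proof -
  have "\<bar>integral {0..x} (\<lambda>t. q t * sin (2 * \<theta> n t))\<bar> \<le> Q"
    by (intro q_bound_upto trig2_cont x) simp
  then show ?thesis using k_pos[OF n] by (simp add: E_def abs_mult divide_right_mono)
qed

text \<open>The condition \<open>Q \<le> k n\<close>, true eventually, forces
  \<open>\<bar>E n x\<bar> \<le> 1\<close>, as required for expanding the exponential.\<close>

lemma inv_lam_bigo_of_bound:
  assumes "\<And>n. 1 \<le> lam n \<Longrightarrow> Q \<le> k n \<Longrightarrow> \<bar>u n\<bar> \<le> C / lam n"
  shows "u \<in> O(\<lambda>n. 1 / lam n)"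
proof (rule landau_o.big_trans)
  show "u \<in> O(\<lambda>n. C / lam n)"
  proof (rule landau_o.bigI[of 1])
    show "\<forall>\<^sub>F n in sequentially. norm (u n) \<le> 1 * norm (C / lam n)"
      using ev_lam[of 1] ev_k[of Q]
    proof eventually_elim
      case (elim n)
      then have "\<bar>u n\<bar> \<le> C / lam n" by (intro assms)
      also have "\<dots> \<le> \<bar>C / lam n\<bar>" by (rule abs_ge_self)
      finally show ?case by simp
    qed
  qed simp
  show "(\<lambda>n. C / lam n) \<in> O(\<lambda>n. 1 / lam n)"
    using landau_o.big.mult[OF bigo_const landau_o.big_refl[of "\<lambda>n. 1 / lam n" sequentially], of C] by simp
qed

lemma sin2_primitive:
  assumes "0 < lam n"
  shows "ac_primitive (\<lambda>x. sin (2 * \<theta> n x)) (\<lambda>x. cos (2 * \<theta> n x) * 2 * (k n - q x / k n * (sin (\<theta> n x))^2)) 0 pi"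
  by (rule ac_primitive_chain[OF \<theta>_primitive[OF assms], where F = "\<lambda>u. sin (2 * u)" and F' = "\<lambda>u. cos (2 * u) * 2"])
    (auto intro!: derivative_eq_intros continuous_intros)

text \<open>The boundary angles tend to multiples of pi/2, where sin 2u vanishes. This decay is the
  additional 1/k that brings \<open>cos2_bigo\<close> to order 1/\<lambda>; a bounded boundary term
  would only give 1/k.\<close>

lemma sin2_boundary_bigo:
  shows "(\<lambda>n. sin (2 * \<theta> n pi) - sin (2 * \<theta> n 0)) \<in> O(\<lambda>n. 1 / k n)"
proof -
  define a b where "a = pi * real_of_int (ind f + 1) / 2" and "b = pi * real_of_int (ind F + 1) / 2"
  have ab: "2 * a = real_of_int (ind f + 1) * pi" "2 * b = real_of_int (ind F + 1) * pi" by (simp_all add: a_def b_def)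
  have s0: "sin (2 * a) = 0" "sin (2 * b) = 0" unfolding ab sin_zero_iff_int2 by blast+
  have bd: "\<bar>sin (2 * \<theta> n pi) - sin (2 * \<theta> n 0)\<bar> \<le> 2 * \<bar>\<alpha>' n - b\<bar> + 2 * \<bar>\<alpha> n - a\<bar>" if n: "0 < lam n" for n
  proof -
    have "2 * \<theta> n pi = real (2 * (n + 1)) * pi - 2 * \<alpha>' n" unfolding \<theta>_pi[OF n] by (simp add: algebra_simps)
    then have "sin (2 * \<theta> n pi) = - sin (2 * \<alpha>' n)"
      by (simp only: sin_diff sin_npi cos_npi) simp
    moreover have "\<bar>sin (2 * \<alpha>' n)\<bar> \<le> 2 * \<bar>\<alpha>' n - b\<bar>" "\<bar>sin (2 * \<alpha> n)\<bar> \<le> 2 * \<bar>\<alpha> n - a\<bar>"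
      by (rule abs_sin_double_le, rule s0)+
    ultimately show ?thesis unfolding \<theta>_0 by (smt (verit))
  qed
  have "(\<lambda>n. sin (2 * \<theta> n pi) - sin (2 * \<theta> n 0)) \<in> O(\<lambda>n. 2 * \<bar>\<alpha>' n - b\<bar> + 2 * \<bar>\<alpha> n - a\<bar>)"
  proof (rule landau_o.bigI[of 1])
    show "\<forall>\<^sub>F n in sequentially. norm (sin (2 * \<theta> n pi) - sin (2 * \<theta> n 0)) \<le> 1 * norm (2 * \<bar>\<alpha>' n - b\<bar> + 2 * \<bar>\<alpha> n - a\<bar>)"
      using ev_lam[of 1] by eventually_elim (use bd in simp)
  qed simp
  also have "(\<lambda>n. 2 * \<bar>\<alpha>' n - b\<bar> + 2 * \<bar>\<alpha> n - a\<bar>) \<in> O(\<lambda>n. 1 / k n)"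
    using boundary_angle_bigo_k unfolding a_def b_def by (intro sum_in_bigo(1)) simp_all
  finally show ?thesis .
qed

text \<open>Integrating the derivative of sin 2\<theta>, whose leading part is 2k cos 2\<theta>,
  expresses the integral by a boundary term over 2k and a remainder containing q over
  \<lambda>.\<close>

lemma cos2_bigo: "(\<lambda>n. integral {0..pi} (\<lambda>x. cos (2 * \<theta> n x))) \<in> O(\<lambda>n. 1 / lam n)"
proof -
  let ?s = "\<lambda>n. sin (2 * \<theta> n pi) - sin (2 * \<theta> n 0)"
  define X where "X n = integral {0..pi} (\<lambda>x. q x * (cos (2 * \<theta> n x) * (sin (\<theta> n x))^2))" for n
  have hc: "continuous_on {0..pi} (\<lambda>x. cos (2 * \<theta> n x) * (sin (\<theta> n x))^2)" for n
    by (intro continuous_intros \<theta>_cont)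
  have X: "\<bar>X n\<bar> \<le> 1 * Q" for n
    unfolding X_def by (rule q_bound[OF hc]) (auto simp: abs_mult abs_square_le_1 intro!: mult_le_one)
  have eq: "integral {0..pi} (\<lambda>x. cos (2 * \<theta> n x)) = ?s n * (1 / k n) / 2 + X n / lam n"
    if n: "0 < lam n" for n
  proof -
    have kp: "k n > 0" by (rule k_pos[OF n])
    have "?s n = integral {0..pi} (\<lambda>x. cos (2 * \<theta> n x) * 2 * (k n - q x / k n * (sin (\<theta> n x))^2))"
      by (rule ac_primitive_diff[OF sin2_primitive[OF n]]) auto
    also have "\<dots> = integral {0..pi} (\<lambda>x. 2 * k n * cos (2 * \<theta> n x) - 2 / k n * (q x * (cos (2 * \<theta> n x) * (sin (\<theta> n x))^2)))"
      by (simp add: algebra_simps)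
    also have "\<dots> = 2 * k n * integral {0..pi} (\<lambda>x. cos (2 * \<theta> n x)) - 2 / k n * X n"
    proof -
      have i1: "(\<lambda>x. 2 * k n * cos (2 * \<theta> n x)) integrable_on {0..pi}"
        by (rule integrable_on_mult_right[OF integrable_continuous_interval[OF trig2_cont(2)]])
      have i2: "(\<lambda>x. 2 / k n * (q x * (cos (2 * \<theta> n x) * (sin (\<theta> n x))^2))) integrable_on {0..pi}"
        by (rule integrable_on_mult_right[OF ai_integrable[OF ai_mult_cont[OF q hc]]])
      show ?thesis unfolding X_def integral_diff[OF i1 i2] integral_mult_right ..
    qed
    finally have e: "?s n = 2 * k n * integral {0..pi} (\<lambda>x. cos (2 * \<theta> n x)) - 2 / k n * X n" .
    show ?thesis unfolding e k_sq[OF n, symmetric] using kp by (simp add: field_simps power2_eq_square)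
  qed
  have "(\<lambda>n. ?s n * (1 / k n)) \<in> O(\<lambda>n. 1 / k n * (1 / k n))"
    by (intro landau_o.big.mult sin2_boundary_bigo landau_o.big_refl)
  also have "(\<lambda>n. 1 / k n * (1 / k n)) \<in> O(\<lambda>n. 1 / lam n)"
  proof (rule inv_lam_bigo_of_bound[where C = 1])
    fix n assume "1 \<le> lam n"
    then have "k n * k n = lam n" using k_sq[of n] by (simp add: power2_eq_square)
    then show "\<bar>1 / k n * (1 / k n)\<bar> \<le> 1 / lam n" using \<open>1 \<le> lam n\<close> by simp
  qed
  finally have "(\<lambda>n. ?s n * (1 / k n)) \<in> O(\<lambda>n. 1 / lam n)" .
  from landau_o.big.mult[OF bigo_const[of "1 / 2"] this]
  have 1: "(\<lambda>n. ?s n * (1 / k n) / 2) \<in> O(\<lambda>n. 1 / lam n)"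
    by (simp add: mult.commute)
  have 2: "(\<lambda>n. X n / lam n) \<in> O(\<lambda>n. 1 / lam n)"
    by (rule inv_lam_bigo_of_bound[where C = Q]) (use X in \<open>simp add: divide_right_mono\<close>)
  have "(\<lambda>n. integral {0..pi} (\<lambda>x. cos (2 * \<theta> n x))) \<in>
      \<Theta>(\<lambda>n. ?s n * (1 / k n) / 2 + X n / lam n)"
    by (rule bigthetaI_cong) (use ev_lam[of 1] in eventually_elim, simp add: eq)
  also have "(\<lambda>n. ?s n * (1 / k n) / 2 + X n / lam n) \<in> O(\<lambda>n. 1 / lam n)"
    by (rule sum_in_bigo(1)[OF 1 2])
  finally show ?thesis .
qed

text \<open>Integration by parts against pi - x, which kills the boundary term at pi, turns the mean
  of E into a trigonometric coefficient of (pi - x) q.\<close>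

lemma E_integral:
  "integral {0..pi} (E n) = 1 / k n * integral {0..pi} (\<lambda>x. ((pi - x) * q x) * sin (2 * \<theta> n x))"
proof -
  have lin: "ac_primitive (\<lambda>x. pi - x) (\<lambda>x. -1) 0 pi"
    by (rule ac_primitive_C1) (auto intro!: derivative_eq_intros)
  have qi: "(\<lambda>x. q x * ((pi - x) * sin (2 * \<theta> n x))) integrable_on {0..pi}"
    by (intro ai_integrable[OF ai_mult_cont[OF q]] continuous_intros trig2_cont)
  have "(pi - pi) * E n pi - (pi - 0) * E n 0
    = integral {0..pi} (\<lambda>x. -1 * E n x + (pi - x) * (1 / k n * (q x * sin (2 * \<theta> n x))))"
    by (rule ac_primitive_diff[OF ac_primitive_mult[OF lin E_primitive]]) auto
  also have "\<dots> = integral {0..pi} (\<lambda>x. 1 / k n * (q x * ((pi - x) * sin (2 * \<theta> n x))) - E n x)"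
    by (simp add: mult_ac)
  also have "\<dots> = 1 / k n * integral {0..pi} (\<lambda>x. q x * ((pi - x) * sin (2 * \<theta> n x))) - integral {0..pi} (E n)"
    using integral_diff[OF integrable_on_mult_right[OF qi, of "1 / k n"] integrable_continuous_interval[OF E_cont]]
    by (simp only: integral_mult_right)
  finally show ?thesis by (simp add: E_0 mult_ac)
qed

text \<open>One factor 1/k comes from the size of E, the other from integrating the derivative of E
  sin 2\<theta>.\<close>

lemma E_cos2_bigo: "(\<lambda>n. integral {0..pi} (\<lambda>x. E n x * cos (2 * \<theta> n x))) \<in> O(\<lambda>n. 1 / lam n)"
proof (rule inv_lam_bigo_of_bound[where C = "Q + Q * Q"])
  fix n assume l: "1 \<le> lam n"
  then have n: "0 < lam n" by simp
  have kp: "k n > 0" "k n \<ge> 1" using l by (simp_all add: k_def)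
  note Eb = E_bound[OF n]
  define X where "X = integral {0..pi} (\<lambda>x. q x * (sin (2 * \<theta> n x) * sin (2 * \<theta> n x)))"
  define Y where "Y = integral {0..pi} (\<lambda>x. q x * (E n x * cos (2 * \<theta> n x) * (sin (\<theta> n x))^2))"
  define Z where "Z = integral {0..pi} (\<lambda>x. E n x * cos (2 * \<theta> n x))"
  have xc: "continuous_on {0..pi} (\<lambda>x. sin (2 * \<theta> n x) * sin (2 * \<theta> n x))"
    and yc: "continuous_on {0..pi} (\<lambda>x. E n x * cos (2 * \<theta> n x) * (sin (\<theta> n x))^2)"
    and zc: "continuous_on {0..pi} (\<lambda>x. E n x * cos (2 * \<theta> n x))"
    by (intro continuous_intros \<theta>_cont E_cont)+
  have X: "\<bar>X\<bar> \<le> 1 * Q"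
    unfolding X_def by (rule q_bound[OF xc]) (simp add: abs_square_le_1 flip: power2_eq_square)
  have Y: "\<bar>Y\<bar> \<le> Q / k n * Q"
    unfolding Y_def
  proof (rule q_bound[OF yc])
    fix x assume "x \<in> {0..pi}"
    have "\<bar>E n x * (cos (2 * \<theta> n x) * (sin (\<theta> n x))^2)\<bar> \<le> Q / k n * 1"
      unfolding abs_mult[of "E n x"] using Eb[OF \<open>x \<in> {0..pi}\<close>] Q_nonneg kp
      by (intro mult_mono) (auto simp: abs_mult abs_square_le_1 intro!: mult_le_one)
    then show "\<bar>E n x * cos (2 * \<theta> n x) * (sin (\<theta> n x))^2\<bar> \<le> Q / k n" by (simp add: mult.assoc)
  qed
  have "E n pi * sin (2 * \<theta> n pi) - E n 0 * sin (2 * \<theta> n 0)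
    = integral {0..pi} (\<lambda>x. 1 / k n * (q x * sin (2 * \<theta> n x)) * sin (2 * \<theta> n x)
      + E n x * (cos (2 * \<theta> n x) * 2 * (k n - q x / k n * (sin (\<theta> n x))^2)))"
    by (rule ac_primitive_diff[OF ac_primitive_mult[OF E_primitive sin2_primitive[OF n]]]) auto
  also have "\<dots> = integral {0..pi} (\<lambda>x. 1 / k n * (q x * (sin (2 * \<theta> n x) * sin (2 * \<theta> n x)))
      + (2 * k n * (E n x * cos (2 * \<theta> n x)) - 2 / k n * (q x * (E n x * cos (2 * \<theta> n x) * (sin (\<theta> n x))^2))))"
    by (simp add: algebra_simps)
  also have "\<dots> = 1 / k n * X + (2 * k n * Z - 2 / k n * Y)"
    unfolding X_def Y_def Z_def
    by (subst integral_add, (intro integrable_diff integrable_on_mult_right integrable_continuous_interval zc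
        ai_integrable[OF ai_mult_cont[OF q xc]] ai_integrable[OF ai_mult_cont[OF q yc]])+,
      subst integral_diff, (intro integrable_on_mult_right integrable_continuous_interval zc
        ai_integrable[OF ai_mult_cont[OF q yc]])+, simp only: integral_mult_right)
  finally have Zeq: "2 * k n * Z = E n pi * sin (2 * \<theta> n pi) - 1 / k n * X + 2 / k n * Y"
    by (simp add: E_0)
  have b1: "\<bar>E n pi * sin (2 * \<theta> n pi)\<bar> \<le> Q / k n * 1"
    unfolding abs_mult using Eb[of pi] Q_nonneg kp by (intro mult_mono) auto
  have b2: "\<bar>1 / k n * X\<bar> \<le> Q / k n" using X kp by (simp add: abs_mult divide_right_mono)
  have b3: "\<bar>2 / k n * Y\<bar> \<le> 2 / k n * (Q * Q)"
  proof -
    have "Q / k n * Q \<le> Q * Q" using kp Q_nonneg by (intro mult_right_mono) (auto simp: divide_le_eq mult_le_cancel_left1)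
    then have "\<bar>Y\<bar> \<le> Q * Q" using Y by linarith
    then show ?thesis using kp by (simp add: abs_mult divide_right_mono)
  qed
  have tri: "\<bar>u - v + w\<bar> \<le> \<bar>u\<bar> + \<bar>v\<bar> + \<bar>w\<bar>" for u v w :: real by linarith
  have "\<bar>2 * k n * Z\<bar> \<le> Q / k n * 1 + Q / k n + 2 / k n * (Q * Q)"
    unfolding Zeq by (rule order_trans[OF tri add_mono[OF add_mono[OF b1 b2] b3]])
  also have "\<dots> = 2 * ((Q + Q * Q) / k n)" by (simp add: add_divide_distrib)
  also have "\<bar>2 * k n * Z\<bar> = 2 * (k n * \<bar>Z\<bar>)" using kp by (simp add: abs_mult)
  finally have "k n * \<bar>Z\<bar> \<le> (Q + Q * Q) / k n" by (simp only: mult_le_cancel_left_pos zero_less_numeral)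
  then have "\<bar>Z\<bar> \<le> (Q + Q * Q) / k n / k n" using kp by (simp add: pos_le_divide_eq mult_ac)
  then show "\<bar>integral {0..pi} (\<lambda>x. E n x * cos (2 * \<theta> n x))\<bar> \<le> (Q + Q * Q) / lam n"
    unfolding Z_def using k_sq[OF n] by (simp add: power2_eq_square)
qed

definition J :: "nat \<Rightarrow> real" where
  "J n = integral {0..pi} (\<lambda>x. exp (E n x) * (sin (\<theta> n x))^2)"

text \<open>Expands exp E to first order. The part linear in E carries the coefficient from
  \<open>E_integral\<close>; the quadratic remainder and the cosine integrals are
  O(1/\<lambda>).\<close>

lemma J_l2_null:
  assumes q2: "L \<Longrightarrow> (\<lambda>x. (q x)^2) absolutely_integrable_on {0..pi}"
  shows "l2_null L (\<lambda>n. real n * (J n - pi / 2))"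
proof -
  let ?g = "\<lambda>x. (pi - x) * q x"
  define Y where "Y n = integral {0..pi} (\<lambda>x. ?g x * sin (2 * \<theta> n x))" for n
  let ?m = "\<lambda>n. 1 / 2 * (real n / k n * Y n)" and ?e = "\<lambda>n x. exp (E n x) - 1 - E n x"
  have g: "?g absolutely_integrable_on {0..pi}"
    using ai_mult_cont[OF q, of "\<lambda>x. pi - x"] by (simp add: mult.commute continuous_intros)
  have g2: "(\<lambda>x. (?g x)^2) absolutely_integrable_on {0..pi}" if L
    using ai_mult_cont[OF q2[OF that], of "\<lambda>x. (pi - x)^2"] by (simp add: mult.commute power_mult_distrib continuous_intros)
  have Y: "l2_null L Y" unfolding Y_def[abs_def] by (rule trig_\<theta>_l2_null(2)[OF g g2])
  have "(\<lambda>n. real n / k n) \<in> O(\<lambda>_. 1)"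
    by (rule bigoI_tendsto[of _ _ 1]) (use n_over_k in auto)
  from landau_o.big.mult[OF bigo_const[of "1 / 2"] landau_o.big.mult[OF this landau_o.big_refl[of Y]]]
  have "?m \<in> O(Y)" by (simp only: mult_1_left)
  from l2_null_bigo[OF Y this] have main: "l2_null L ?m" .
  define C where "C n = integral {0..pi} (\<lambda>x. cos (2 * \<theta> n x))" for n
  define Z where "Z n = integral {0..pi} (\<lambda>x. E n x * cos (2 * \<theta> n x))" for n
  define r where "r n = integral {0..pi} (\<lambda>x. (?e n x) * (sin (\<theta> n x))^2)" for n
  have J: "J n - pi / 2 = 1 / 2 * (1 / k n * Y n) + (r n - C n / 2 - Z n / 2)" for n
  proof -
    \<comment> \<open>This is (1 + E) sin^2 \<theta> with sin^2 \<theta> written as (1 - cos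
      2\<theta>) / 2.\<close>
    let ?w = "\<lambda>x. 1 / 2 + (1 / 2 * E n x - (1 / 2 * cos (2 * \<theta> n x) + 1 / 2 * (E n x * cos (2 * \<theta> n x))))"
    have "J n = integral {0..pi} (\<lambda>x. (?e n x) * (sin (\<theta> n x))^2
      + (?w x))"
      unfolding J_def
    proof (rule hk_integral_cong)
      fix x
      have s: "(sin (\<theta> n x))^2 = 1 / 2 - cos (2 * \<theta> n x) / 2" by (simp add: cos_double_sin diff_divide_distrib)
      show "exp (E n x) * (sin (\<theta> n x))^2 = (?e n x) * (sin (\<theta> n x))^2
      + (?w x)"
        unfolding s by (simp add: field_simps)
    qed
    also have "\<dots> = r n + (pi / 2 + (1 / 2 * integral {0..pi} (E n) - (1 / 2 * C n + 1 / 2 * Z n)))"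
    proof -
      have i1: "(\<lambda>x. (?e n x) * (sin (\<theta> n x))^2) integrable_on {0..pi}"
        and i2: "(\<lambda>x. 1 / 2 * E n x) integrable_on {0..pi}"
        and i3: "(\<lambda>x. 1 / 2 * cos (2 * \<theta> n x)) integrable_on {0..pi}"
        and i4: "(\<lambda>x. 1 / 2 * (E n x * cos (2 * \<theta> n x))) integrable_on {0..pi}"
        and i5: "(\<lambda>x. 1 / 2 :: real) integrable_on {0..pi}"
        by (intro integrable_continuous_interval continuous_intros E_cont \<theta>_cont)+
      note i34 = integrable_add[OF i3 i4] and i234 = integrable_diff[OF i2 integrable_add[OF i3 i4]]
      have "integral {0..pi} (\<lambda>x. 1 / 2 :: real) = pi / 2" by simp
      then show ?thesis
        unfolding integral_add[OF i1 integrable_add[OF i5 i234]] integral_add[OF i5 i234] integral_diff[OF i2 i34]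
          integral_add[OF i3 i4] integral_mult_right r_def C_def Z_def by simp
    qed
    finally show ?thesis unfolding E_integral Y_def by simp
  qed
  have "r \<in> O(\<lambda>n. 1 / lam n)"
  proof (rule inv_lam_bigo_of_bound[where C = "Q * Q * pi"])
    fix n assume l: "1 \<le> lam n" and Qk: "Q \<le> k n"
    then have n: "0 < lam n" by simp
    have kp: "k n > 0" by (rule k_pos[OF n])
    have "\<bar>r n\<bar> \<le> integral {0..pi} (\<lambda>x. (Q / k n)^2)"
      unfolding r_def
    proof (rule integral_abs_le)
      show "(\<lambda>x. (?e n x) * (sin (\<theta> n x))^2) absolutely_integrable_on {0..pi}"
        by (intro absolutely_integrable_continuous_real continuous_intros E_cont \<theta>_cont)
      fix x assume x: "x \<in> {0..pi}"
      have e: "\<bar>E n x\<bar> \<le> Q / k n" by (rule E_bound[OF n x])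
      also have "Q / k n \<le> 1" using Qk kp by simp
      finally have "\<bar>?e n x\<bar> \<le> (E n x)^2" by (rule exp_remainder_le)
      also have "\<dots> \<le> (Q / k n)^2" using power_mono[OF e, of 2] by simp
      finally have "\<bar>?e n x\<bar> * \<bar>(sin (\<theta> n x))^2\<bar> \<le> (Q / k n)^2 * 1"
        by (intro mult_mono) (auto simp: abs_square_le_1)
      then show "\<bar>(?e n x) * (sin (\<theta> n x))^2\<bar> \<le> (Q / k n)^2" by (simp add: abs_mult)
    qed simp
    also have "\<dots> = Q * Q * pi / lam n" using k_sq[OF n] by (simp add: power_divide power2_eq_square)
    finally show "\<bar>r n\<bar> \<le> Q * Q * pi / lam n" .
  qed
  then have rest: "(\<lambda>n. r n - C n / 2 - Z n / 2) \<in> O(\<lambda>n. 1 / lam n)"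
    using cos2_bigo E_cos2_bigo unfolding C_def Z_def by (intro sum_in_bigo(2)) simp_all
  show ?thesis
  proof (rule l2_null_bigo_add[OF main])
    have "real n * (J n - pi / 2) - ?m n = real n * (r n - C n / 2 - Z n / 2)" for n
      unfolding J by (simp add: algebra_simps)
    then show "(\<lambda>n. real n * (J n - pi / 2) - ?m n) \<in> O(\<lambda>n. 1 / real n)"
      using n_times_bigo[OF rest] by simp
  qed
qed

text \<open>The asserted formula solved for its remainder, so that only \<open>l2_null\<close> has
  to be shown.\<close>

definition \<xi> :: "nat \<Rightarrow> real" where
  "\<xi> n = real n * (k n - \<nu> n) - (1 / 2 * integral {0..pi} q + omega1 f + omega1 F) / pi"

text \<open>Multiplying \<open>k_eq\<close> by n isolates the cosine coefficient \<eta> of q; the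
  constant terms of order 1/k produce the mean of q and both \<open>omega1\<close>.\<close>

lemma \<xi>_l2_null:
  assumes q2: "L \<Longrightarrow> (\<lambda>x. (q x)^2) absolutely_integrable_on {0..pi}"
  shows "l2_null L \<xi>"
proof -
  define S where "S = 1 / 2 * integral {0..pi} q + omega1 f + omega1 F"
  define \<eta> where "\<eta> n = integral {0..pi} (\<lambda>x. q x * cos (2 * \<theta> n x))" for n
  define r1 where "r1 n = \<alpha> n - (pi * real_of_int (ind f + 1) / 2 - omega1 f / k n)" for n
  define r2 where "r2 n = \<alpha>' n - (pi * real_of_int (ind F + 1) / 2 - omega1 F / k n)" for n
  let ?M = "\<lambda>n. - (1 / (2 * pi)) * (real n / k n * \<eta> n)"
  let ?Y = "\<lambda>n. (S * (real n / k n - 1) - real n * r1 n - real n * r2 n) / pi"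
  have \<eta>: "l2_null L \<eta>" unfolding \<eta>_def[abs_def] by (rule trig_\<theta>_l2_null(1)[OF q q2])
  have O1: "(\<lambda>n. real n / k n) \<in> O(\<lambda>_. 1)"
    by (rule bigoI_tendsto[of _ _ 1]) (use n_over_k in auto)
  from landau_o.big.mult[OF bigo_const[of "- (1 / (2 * pi))"] landau_o.big.mult[OF this landau_o.big_refl[of \<eta>]]]
  have "?M \<in> O(\<eta>)" by (simp only: mult_1_left)
  from l2_null_bigo[OF \<eta> this] have main: "l2_null L ?M" .
  have qs: "integral {0..pi} (\<lambda>t. q t * (sin (\<theta> n t))^2) = 1 / 2 * integral {0..pi} q - 1 / 2 * \<eta> n" for n
  proof -
    have "integral {0..pi} (\<lambda>t. q t * (sin (\<theta> n t))^2) = integral {0..pi} (\<lambda>t. 1 / 2 * q t - 1 / 2 * (q t * cos (2 * \<theta> n t)))"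
      by (rule hk_integral_cong) (simp add: cos_double_sin field_simps)
    also have "\<dots> = 1 / 2 * integral {0..pi} q - 1 / 2 * \<eta> n"
      using integral_diff[OF integrable_on_mult_right[OF ai_integrable[OF q]]
          integrable_on_mult_right[OF ai_integrable[OF ai_mult_cont[OF q trig2_cont(2)[of n]]]], of "1 / 2" "1 / 2"]
      unfolding \<eta>_def integral_mult_right .
    finally show ?thesis .
  qed
  \<comment> \<open>A rate is required here, not only the limit: this quantity multiplies the
    constant \<open>S\<close>, and the product must be square summable.\<close>
  have nk: "(\<lambda>n. real n / k n - 1) \<in> O(\<lambda>n. 1 / real n)"
  proof -
    have "(\<lambda>n. 1 / k n) \<in> o(\<lambda>_. 1)"
      using tendsto_inverse_0_at_top[OF k_at_top] by (intro smalloI_tendsto) (auto simp: inverse_eq_divide)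
    from landau_o.big_small_trans[OF k_\<nu>_bigo_k this] have "(\<lambda>n. k n - \<nu> n) \<in> O(\<lambda>_. 1)"
      by (rule landau_o.small_imp_big)
    from sum_in_bigo(2)[OF bigo_const[of "real_of_int (ind f + ind F) / 2"] this]
    have "(\<lambda>n. real n - k n) \<in> O(\<lambda>_. 1)" by (simp add: \<nu>_def)
    from landau_o.big.mult[OF this inv_k_bigo]
    have "(\<lambda>n. (real n - k n) * (1 / k n)) \<in> O(\<lambda>n. 1 / real n)" by simp
    moreover have "(\<lambda>n. real n / k n - 1) \<in> \<Theta>(\<lambda>n. (real n - k n) * (1 / k n))"
      by (rule bigthetaI_cong) (use ev_k[of 1] in eventually_elim, simp add: field_simps)
    ultimately show ?thesis using landau_o.big_trans bigthetaD1 by blast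
  qed
  show ?thesis
  proof (rule l2_null_bigo_add[OF main])
    have eq: "\<xi> n - ?M n = ?Y n"
      if n: "0 < lam n" for n
    proof -
      have "(k n - \<nu> n) * pi = - r1 n - r2 n + (S - 1 / 2 * \<eta> n) / k n"
        unfolding k_eq[OF n] qs r1_def r2_def S_def by (simp add: add_divide_distrib diff_divide_distrib)
      then have e: "k n - \<nu> n = (- r1 n - r2 n + (S - 1 / 2 * \<eta> n) / k n) / pi" by (simp add: eq_divide_eq)
      show ?thesis unfolding \<xi>_def S_def[symmetric] e using k_pos[OF n] by (simp add: field_simps)
    qed
    have "(\<lambda>n. \<xi> n - ?M n) \<in> \<Theta>(?Y)"
      by (rule bigthetaI_cong) (use ev_lam[of 1] in eventually_elim, simp only: eq)
    also have "(?Y) \<in> O(\<lambda>n. 1 / real n)"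
    proof -
      have "(\<lambda>n. S * (real n / k n - 1)) \<in> O(\<lambda>n. 1 / real n)"
        using landau_o.big.mult[OF bigo_const nk, of S] by simp
      moreover have "(\<lambda>n. real n * r1 n) \<in> O(\<lambda>n. 1 / real n)" "(\<lambda>n. real n * r2 n) \<in> O(\<lambda>n. 1 / real n)"
        using boundary_angles_bigo unfolding r1_def r2_def by (auto intro: n_times_bigo)
      ultimately have "(\<lambda>n. S * (real n / k n - 1) - real n * r1 n - real n * r2 n) \<in> O(\<lambda>n. 1 / real n)"
        by (intro sum_in_bigo(2))
      then show ?thesis by simp
    qed
    finally show "(\<lambda>n. \<xi> n - ?M n) \<in> O(\<lambda>n. 1 / real n)" .
  qed
qed

text \<open>With the squared amplitude of \<phi> at 0 factored out, the boundary contributions of f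
  and F appear only as quotients of order 1/\<lambda>.\<close>

lemma gam_eq:
  assumes n: "0 < lam n"
  shows "gam n = amplitude_sq f (lam n) * (J n + poly (deriv_down2 f) (lam n) / amplitude_sq f (lam n)
    + exp (E n pi) * (poly (deriv_down2 F) (lam n) / amplitude_sq F (lam n)))"
    and "amplitude_sq f (lam n) > 0"
proof -
  have kp: "k n > 0" by (rule k_pos[OF n])
  have amp: "(\<rho> * sin a)^2 + (- k n * \<rho> * cos a)^2 / lam n = \<rho>^2" for \<rho> a
  proof -
    have "(\<rho> * sin a)^2 + (- k n * \<rho> * cos a)^2 / lam n = \<rho>^2 * (sin a)^2 + \<rho>^2 * (cos a)^2"
      using n by (simp add: power_mult_distrib k_sq[OF n])
    then show ?thesis by (simp flip: distrib_left)
  qed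
  obtain \<rho> \<rho>' where \<rho>: "\<rho> \<noteq> 0" "\<rho>' \<noteq> 0"
    "poly (down f) (lam n) = \<rho> * sin (\<alpha> n)" "poly (up f) (lam n) = - k n * \<rho> * cos (\<alpha> n)"
    "poly (down F) (lam n) = \<rho>' * sin (\<alpha>' n)" "poly (up F) (lam n) = - k n * \<rho>' * cos (\<alpha>' n)"
    "sin (total_angle q f F (k n) (lam n)) = 0"
    "gam n = \<rho>^2 * integral {0..pi} (\<lambda>x. exp (2 * log_amplitude q (k n) (lam n) (\<theta> n) x) * (sin (\<theta> n x))^2)
      + poly (deriv_down2 f) (lam n)
      + \<rho>^2 * exp (2 * log_amplitude q (k n) (lam n) (\<theta> n) pi) / \<rho>'^2 * poly (deriv_down2 F) (lam n)"
    by (rule spectral_data_pruefer[OF q R kp sd, where n = n, folded \<theta>_def \<alpha>_def \<alpha>'_def])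
  have A: "amplitude_sq f (lam n) = \<rho>^2" "amplitude_sq F (lam n) = \<rho>'^2"
    unfolding amplitude_sq_def \<rho>(3-6) by (rule amp)+
  show "amplitude_sq f (lam n) > 0" unfolding A using \<rho>(1) by simp
  show "gam n = amplitude_sq f (lam n) * (J n + poly (deriv_down2 f) (lam n) / amplitude_sq f (lam n)
    + exp (E n pi) * (poly (deriv_down2 F) (lam n) / amplitude_sq F (lam n)))"
    unfolding \<rho>(8) A E_log_amplitude[OF n] J_def[symmetric] using \<rho>(1) by (simp add: field_simps)
qed

definition \<xi>' :: "nat \<Rightarrow> real" where
  "\<xi>' n = real n * (gam n / (pi / 2 * \<nu> n powi (2 * ind f)) - 1)"

lemma ev_\<nu>: "\<forall>\<^sub>F n in sequentially. \<nu> n > 0"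
proof -
  have "filterlim \<nu> at_top sequentially" unfolding \<nu>_def[abs_def] by real_asymp
  then show ?thesis by (simp add: filterlim_at_top_dense)
qed

text \<open>Splits the normalised constant into \<open>X\<close>, whose deviation from pi/2 is
  governed by \<open>J_l2_null\<close>, and \<open>Y\<close>, the amplitude relative to the claimed
  power, which is 1 + O(1/n^2).\<close>

lemma \<xi>'_l2_null:
  assumes q2: "L \<Longrightarrow> (\<lambda>x. (q x)^2) absolutely_integrable_on {0..pi}"
  shows "l2_null L \<xi>'"
proof -
  let ?h = "\<lambda>n. 1 / real n * (1 / real n)"
  have h: "?h \<in> o(\<lambda>_. 1)" by real_asymp
  define X where "X n = gam n / amplitude_sq f (lam n)" for n
  \<comment> \<open>Written as a product of two quantities near 1: one compares the amplitude with a
    power of \<lambda>, the other compares \<open>k n\<close> with \<open>\<nu> n\<close>.\<close>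
  define Y where "Y n = amplitude_sq f (lam n) / lam n powi ind f * (k n / \<nu> n) powi (2 * ind f)" for n
  let ?M = "\<lambda>n. 2 / pi * (real n * (X n - pi / 2) * Y n)"
  have X: "l2_null L (\<lambda>n. real n * (X n - pi / 2))"
  proof (rule l2_null_bigo_add[OF J_l2_null[OF q2]])
    let ?d = "\<lambda>n. poly (deriv_down2 f) (lam n) / amplitude_sq f (lam n)"
    let ?D = "\<lambda>n. poly (deriv_down2 F) (lam n) / amplitude_sq F (lam n)"
    have d: "?d \<in> O(\<lambda>n. 1 / lam n)" "?D \<in> O(\<lambda>n. 1 / lam n)"
      using landau_o.big.compose[OF deriv_down2_asymp[OF R(1)] lam_at_top]
        landau_o.big.compose[OF deriv_down2_asymp[OF R(2)] lam_at_top] by simp_all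
    have "(\<lambda>n. exp (E n pi)) \<in> O(\<lambda>_. 1)"
    proof (rule landau_o.bigI[of "exp 1"])
      show "\<forall>\<^sub>F n in sequentially. norm (exp (E n pi)) \<le> exp 1 * norm (1 :: real)"
        using ev_lam[of 1] ev_k[of Q]
      proof eventually_elim
        case (elim n)
        have "E n pi \<le> Q / k n" using E_bound[of n pi] elim by auto
        also have "\<dots> \<le> 1" using elim k_pos[of n] by simp
        finally show ?case by simp
      qed
    qed simp
    from landau_o.big.mult[OF this d(2)] have "(\<lambda>n. exp (E n pi) * ?D n) \<in> O(\<lambda>n. 1 / lam n)" by simp
    from n_times_bigo[OF sum_in_bigo(1)[OF d(1) this]]
    have "(\<lambda>n. real n * (?d n + exp (E n pi) * ?D n)) \<in> O(\<lambda>n. 1 / real n)" .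
    moreover have "(\<lambda>n. real n * (X n - pi / 2) - real n * (J n - pi / 2)) \<in> \<Theta>(\<lambda>n. real n * (?d n + exp (E n pi) * ?D n))"
    proof (rule bigthetaI_cong)
      show "\<forall>\<^sub>F n in sequentially. real n * (X n - pi / 2) - real n * (J n - pi / 2) = real n * (?d n + exp (E n pi) * ?D n)"
        using ev_lam[of 1]
      proof eventually_elim
        case (elim n)
        then have n: "0 < lam n" by simp
        have "X n = J n + ?d n + exp (E n pi) * ?D n"
          unfolding X_def using gam_eq[OF n] by simp
        then show ?case by (simp add: algebra_simps)
      qed
    qed
    ultimately show "(\<lambda>n. real n * (X n - pi / 2) - real n * (J n - pi / 2)) \<in> O(\<lambda>n. 1 / real n)"
      using landau_o.big_trans bigthetaD1 by blast
  qed
  have Y: "(\<lambda>n. Y n - 1) \<in> O(?h)"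
    unfolding Y_def
  proof (rule near_one_mult[OF _ near_one_powi[OF _ h] landau_o.small_imp_big[OF h]])
    show "(\<lambda>n. amplitude_sq f (lam n) / lam n powi ind f - 1) \<in> O(?h)"
      using landau_o.big_trans[OF landau_o.big.compose[OF amplitude_sq_asymp[OF R(1)] lam_at_top] inv_lam_bigo] by simp
    have "(\<lambda>n. 1 / \<nu> n) \<in> O(\<lambda>n. 1 / real n)" unfolding \<nu>_def[abs_def] by real_asymp
    from landau_o.big.mult[OF k_\<nu>_bigo this] have "(\<lambda>n. (k n - \<nu> n) * (1 / \<nu> n)) \<in> O(?h)" .
    moreover have "(\<lambda>n. k n / \<nu> n - 1) \<in> \<Theta>(\<lambda>n. (k n - \<nu> n) * (1 / \<nu> n))"
      by (rule bigthetaI_cong) (use ev_\<nu> in eventually_elim, simp add: field_simps)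
    ultimately show "(\<lambda>n. k n / \<nu> n - 1) \<in> O(?h)"
      using landau_o.big_trans bigthetaD1 by blast
  qed
  have "(\<lambda>n. Y n - 1) \<in> O(\<lambda>_. 1)" by (rule landau_o.small_imp_big[OF landau_o.big_small_trans[OF Y h]])
  from sum_in_bigo(1)[OF this bigo_const[of 1]] have "Y \<in> O(\<lambda>_. 1)" by simp
  from landau_o.big.mult[OF landau_o.big_refl this, of "\<lambda>n. real n * (X n - pi / 2)"]
  have "?M \<in> O(\<lambda>n. real n * (X n - pi / 2))" by simp
  from l2_null_bigo[OF X this]
  have main: "l2_null L ?M" .
  show ?thesis
  proof (rule l2_null_bigo_add[OF main])
    have "(\<lambda>n. real n * (Y n - 1)) \<in> O(\<lambda>n. real n * (1 / real n * (1 / real n)))"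
      by (intro landau_o.big.mult landau_o.big_refl Y)
    also have "(\<lambda>n. real n * (1 / real n * (1 / real n))) \<in> \<Theta>(\<lambda>n. 1 / real n)"
      by (rule bigthetaI_cong) (use eventually_gt_at_top[of 0] in eventually_elim, simp)
    finally have "(\<lambda>n. real n * (Y n - 1)) \<in> O(\<lambda>n. 1 / real n)" .
    moreover have "(\<lambda>n. \<xi>' n - ?M n) \<in> \<Theta>(\<lambda>n. real n * (Y n - 1))"
    proof (rule bigthetaI_cong)
      show "\<forall>\<^sub>F n in sequentially. \<xi>' n - ?M n = real n * (Y n - 1)"
        using ev_lam[of 1] ev_\<nu>
      proof eventually_elim
        case (elim n)
        then have n: "0 < lam n" by simp
        have kp: "k n > 0" by (rule k_pos[OF n])
        have a: "amplitude_sq f (lam n) > 0" by (rule gam_eq(2)[OF n])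
        have "lam n powi ind f = k n powi (2 * ind f)"
          unfolding k_sq[OF n, symmetric] by (simp add: power_int_mult)
        then have "Y n = amplitude_sq f (lam n) / \<nu> n powi (2 * ind f)"
          unfolding Y_def using kp elim(2) by (simp add: power_int_divide_distrib)
        then have XY: "gam n / (pi / 2 * \<nu> n powi (2 * ind f)) = 2 / pi * (X n * Y n)"
          unfolding X_def using a by simp
        show ?case unfolding \<xi>'_def XY by (simp add: algebra_simps)
      qed
    qed
    ultimately show "(\<lambda>n. \<xi>' n - ?M n) \<in> O(\<lambda>n. 1 / real n)"
      using landau_o.big_trans bigthetaD1 by blast
  qed
qed

end

theorem theorem4p2:
  fixes q :: "real \<Rightarrow> real" and f F :: rfun and lam gam :: "nat \<Rightarrow> real"
  assumes "q absolutely_integrable_on {0<..<pi}"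
    and "in_R f" and "in_R F"
    and "spectral_data q f F lam gam"
  shows "\<exists>\<xi> \<xi>' :: nat \<Rightarrow> real.
    (\<forall>\<^sub>F n in sequentially.
       0 < lam n \<and>
       sqrt (lam n) = real n - real_of_int (ind f + ind F) / 2
         + 1 / (pi * real n) * (1 / 2 * integral {0..pi} q + omega1 f + omega1 F)
         + \<xi> n / real n \<and>
       gam n = pi / 2 * (real n - real_of_int (ind f + ind F) / 2) powi (2 * ind f)
         * (1 + \<xi>' n / real n)) \<and>
    \<xi> \<longlonglongrightarrow> 0 \<and> \<xi>' \<longlonglongrightarrow> 0 \<and>
    ((\<lambda>x. (q x)^2) absolutely_integrable_on {0<..<pi} \<longrightarrow>
       summable (\<lambda>n. (\<xi> n)^2) \<and> summable (\<lambda>n. (\<xi>' n)^2))"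
proof -
  have q: "q absolutely_integrable_on {0..pi}"
    using assms(1) unfolding absolutely_integrable_on_Icc_iff_Ioo .
  interpret spectral_problem q f F lam gam
    using q assms(2-4) by unfold_locales
  let ?L = "(\<lambda>x. (q x)^2) absolutely_integrable_on {0<..<pi}"
  have q2: "(\<lambda>x. (q x)^2) absolutely_integrable_on {0..pi}" if ?L
    using that unfolding absolutely_integrable_on_Icc_iff_Ioo .
  \<comment> \<open>The flag is instantiated by square integrability itself, which makes exactly the
    square summable claims conditional.\<close>
  have l2: "l2_null ?L \<xi>" "l2_null ?L \<xi>'"
    by (rule \<xi>_l2_null[OF q2], assumption) (rule \<xi>'_l2_null[OF q2])
  have "\<forall>\<^sub>F n in sequentially.
       0 < lam n \<and>
       sqrt (lam n) = real n - real_of_int (ind f + ind F) / 2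
         + 1 / (pi * real n) * (1 / 2 * integral {0..pi} q + omega1 f + omega1 F)
         + \<xi> n / real n \<and>
       gam n = pi / 2 * (real n - real_of_int (ind f + ind F) / 2) powi (2 * ind f)
         * (1 + \<xi>' n / real n)"
    using ev_lam[of 1] ev_\<nu> eventually_gt_at_top[of 0]
  proof eventually_elim
    case (elim n)
    define S where "S = 1 / 2 * integral {0..pi} q + omega1 f + omega1 F"
    have "\<xi> n / real n = k n - \<nu> n - 1 / (pi * real n) * S"
      unfolding \<xi>_def S_def[symmetric] using elim(3) by (simp add: field_simps)
    then have "k n = \<nu> n + 1 / (pi * real n) * S + \<xi> n / real n" by simp
    moreover have "gam n = pi / 2 * \<nu> n powi (2 * ind f) * (1 + \<xi>' n / real n)"
      using elim by (simp add: \<xi>'_def)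
    ultimately show ?case using elim(1) unfolding k_def \<nu>_def S_def by simp
  qed
  with l2 show ?thesis unfolding l2_null_def by blast
qed

end
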